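(* Let $(\hat M,\hat g,\hat\nabla,\Lambda)$ be a quaternionic Kaehler-like statistical manifold of dimension $4m$ whose curvature tensors $\hat R,\hat R^*$ have the form given in the context with real constant $c$, and let $M$ be a Lagrangian statistical submanifold of $\hat M$ of dimension $n$. Suppose $n\ge6$ and that $M$ satisfies the equality case of the Chen $\delta(2,2)$ inequality, i.e. for every $p\in M$ there are mutually orthogonal $2$-planes $\pi_1,\pi_2\subset T_pM$ such that at $p$ $$(\tau-K(\pi_1)-K(\pi_2))-(\tau_\circ-K_\circ(\pi_1)-K_\circ(\pi_2))=\frac c8(n^2-n-4)-\frac{n^2(n-3)}{4(n-2)}\left[\|H\|^2+\|H^*\|^2\right]-2\left(\hat\tau_\circ-\hat K_\circ(\pi_1)-\hat K_\circ(\pi_2)\right).$$ Then $M$ is minimal, i.e. $H=H^*=0$.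
   Context: Statistical manifold: a Riemannian manifold $(\hat M,\hat g)$ with torsion-free affine connections $\hat\nabla,\hat\nabla^*$ such that $X\hat g(Y,Z)=\hat g(\hat\nabla_XY,Z)+\hat g(Y,\hat\nabla^*_XZ)$ and $(\hat\nabla_X\hat g)(Y,Z)=(\hat\nabla_Y\hat g)(X,Z)$. The Levi-Civita connection is $\hat\nabla^\circ=\frac12(\hat\nabla+\hat\nabla^* )$. The curvature tensors of $\hat\nabla,\hat\nabla^*,\hat\nabla^\circ$ are $\hat R,\hat R^*,\hat R^\circ$. Almost quaternionic structure: a rank-3 subbundle $\Lambda\subset \mathrm{End}(T\hat M)$ with local bases $\{J_1,J_2,J_3\}$ satisfying $J_\alpha^2=-I$, $J_\alpha J_{\alpha+1}=-J_{\alpha+1}J_\alpha=J_{\alpha+2}$ (indices mod 3). Let $J_\alpha^*$ be defined by $\hat g(J_\alpha X,Y)+\hat g(X,J_\alpha^*Y)=0$; $(\hat M,\hat\nabla,\Lambda,\hat g)$ is then almost Hermite-like quaternionic statistical. It is quaternionic Kaehler-like if there are locally defined 1-forms $\omega_1,\omega_2,\omega_3$ with $(\hat\nabla_XJ_\alpha)Y=\omega_{\alpha+2}(X)J_{\alpha+1}Y-\omega_{\alpha+1}(X)J_{\alpha+2}Y$. It is assumed that, for a real constant $c$, $$\hat R(X,Y)Z=\tfrac c4\Big\{\hat g(Y,Z)X-\hat g(X,Z)Y+\sum_{\alpha=1}^3[\hat g(Z,J_\alpha Y)J_\alpha X-\hat g(Z,J_\alpha X)J_\alpha Y]+\sum_{\alpha=1}^3[\hat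 g(X,J_\alpha Y)J_\alpha Z-\hat g(J_\alpha X,Y)J_\alpha Z]\Big\},$$ and $\hat R^*$ is given by the same formula with $J_\alpha$ replaced by $J_\alpha^*$. Submanifold: $M\subset\hat M$ carries the induced metric $g$ and induced connections $\nabla,\nabla^*$, with $\hat\nabla_XY=\nabla_XY+\sigma(X,Y)$, $\hat\nabla^*_XY=\nabla^*_XY+\sigma^*(X,Y)$ (tangential and normal parts). $R,R^*,R^\circ$ are the curvature tensors of $\nabla,\nabla^*$ and the Levi-Civita connection of $g$. $M$ is totally real if $J_\alpha(T_pM)\subset T_p^\perp M$ for all $p\in M$ and $\alpha=1,2,3$; it is Lagrangian if it is totally real of maximal dimension $n=m$. For an orthonormal basis $\{e_1,\dots,e_n\}$ of $T_pM$: $H=\frac1n\sum_i\sigma(e_i,e_i)$, $H^*=\frac1n\sum_i\sigma^*(e_i,e_i)$. Curvatures: for a 2-plane $\pi\subset T_pM$ with orthonormal basis $\{X,Y\}$, the sectional $K$-curvature is $K(\pi)=\frac12[g(R(X,Y)Y,X)+g(R^*(X,Y)Y,X)-2g(R^\circ(X,Y)Y,X)]$; $K_\circ(\pi)$ is the usual sectional curvature of $(M,g)$ and $\hat K_\circ(\pi)$ that of $(\hat M,\hat g)$. Further $\tau=\sum_{1\le i<j\le n}K(e_i\wedge e_j)$, $\tau_\circ=\sum_{1\le i<j\le n}K_\circ(e_i\wedge e_j)$, $\hat\tau_\circ=\sum_{1\le i<j\le n}\hat K_\circ(e_i\wedge e_j)$, where $e_i\wedge e_j$ is the plane spanned by $e_i,e_j$.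 *)

theory Defs
  imports "HOL-Analysis.Analysis" "HOL-Library.Function_Algebras"
begin

text \<open>Tangent vectors are operators on functions, so tangent spaces are subspaces of a function
  space.  Endomorphisms of tangent spaces are functions again and use the same instance.\<close>

instantiation "fun" :: (type, real_vector) real_vector
begin

definition scaleR_fun :: "real \<Rightarrow> ('a \<Rightarrow> 'b) \<Rightarrow> 'a \<Rightarrow> 'b"
  where "scaleR_fun r f = (\<lambda>x. r *\<^sub>R f x)"

instance
  by standard (simp_all add: scaleR_fun_def fun_eq_iff scaleR_add_right scaleR_add_left)

end

primrec Ck_on :: "nat \<Rightarrow> 'a::real_normed_vector set \<Rightarrow> ('a \<Rightarrow> 'b::real_normed_vector) \<Rightarrow> bool"
  where
    "Ck_on 0 U f \<longleftrightarrow> continuous_on U f"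
  | "Ck_on (Suc k) U f \<longleftrightarrow>
       (\<forall>x\<in>U. f differentiable (at x)) \<and> (\<forall>v. Ck_on k U (\<lambda>x. frechet_derivative f (at x) v))"

text \<open>Only used for open sets \<open>U\<close> of Euclidean spaces, where it is the usual class of infinitely
  differentiable maps.\<close>

definition smooth_on :: "'a::real_normed_vector set \<Rightarrow> ('a \<Rightarrow> 'b::real_normed_vector) \<Rightarrow> bool"
  where "smooth_on U f \<longleftrightarrow> (\<forall>k. Ck_on k U f)"

record ('a, 'e) smooth_mfd =
  mtop :: "'a topology"
  atlas :: "('a set \<times> ('a \<Rightarrow> 'e)) set"

definition chart :: "('a, 'e::euclidean_space) smooth_mfd \<Rightarrow> 'a set \<Rightarrow> ('a \<Rightarrow> 'e) \<Rightarrow> bool"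
  where "chart N U \<phi> \<longleftrightarrow>
    openin (mtop N) U \<and> open (\<phi> ` U) \<and>
    homeomorphic_map (subtopology (mtop N) U) (top_of_set (\<phi> ` U)) \<phi> \<and>
    (\<forall>(V, \<psi>) \<in> atlas N.
       smooth_on (\<phi> ` (U \<inter> V)) (\<psi> \<circ> inv_into U \<phi>) \<and>
       smooth_on (\<psi> ` (U \<inter> V)) (\<phi> \<circ> inv_into V \<psi>))"

text \<open>A smooth manifold of dimension \<open>DIM('e)\<close>.  The atlas need not be maximal; \<open>chart N\<close> describes
  all charts of the maximal atlas.\<close>

definition smooth_manifold :: "('a, 'e::euclidean_space) smooth_mfd \<Rightarrow> bool"
  where "smooth_manifold N \<longleftrightarrow>
    Hausdorff_space (mtop N) \<and> second_countable (mtop N) \<and>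
    (\<Union>(U, \<phi>) \<in> atlas N. U) = topspace (mtop N) \<and>
    (\<forall>(U, \<phi>) \<in> atlas N. chart N U \<phi>)"

text \<open>An immersed submanifold of dimension \<open>n\<close> is given by its own topology \<open>S\<close> on a subset of the
  ambient manifold; every point has an \<open>S\<close>-open neighbourhood that is a slice of some ambient chart.
  Embedded submanifolds are the case of the subspace topology, and the ambient manifold itself is the
  submanifold \<open>mtop N\<close> of dimension \<open>DIM('e)\<close>.  Everything below that concerns a manifold
  (tangent spaces, vector fields, connections, curvature) is therefore defined for a submanifold \<open>S\<close>
  of \<open>N\<close>, and the ambient notions are obtained for \<open>S = mtop N\<close>.\<close>

definition immersed_submanifold ::
    "('a, 'e::euclidean_space) smooth_mfd \<Rightarrow> 'a topology \<Rightarrow> nat \<Rightarrow> bool"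
  where "immersed_submanifold N S n \<longleftrightarrow>
    topspace S \<subseteq> topspace (mtop N) \<and> second_countable S \<and>
    (\<forall>p \<in> topspace S. \<exists>W U \<phi> L.
       openin S W \<and> p \<in> W \<and> chart N U \<phi> \<and> W \<subseteq> U \<and>
       subtopology S W = subtopology (mtop N) W \<and>
       subspace L \<and> dim L = n \<and> \<phi> ` W = \<phi> ` U \<inter> L)"

text \<open>Smoothness ``at \<open>p\<close>'' always means smoothness on a neighbourhood of \<open>p\<close>.\<close>

definition smooth_at :: "('a, 'e::euclidean_space) smooth_mfd \<Rightarrow> 'a \<Rightarrow> ('a \<Rightarrow> real) \<Rightarrow> bool"
  where "smooth_at N p f \<longleftrightarrow>
    (\<exists>U. openin (mtop N) U \<and> p \<in> U \<and>
       (\<forall>(V, \<phi>) \<in> atlas N. smooth_on (\<phi> ` (U \<inter> V)) (f \<circ> inv_into V \<phi>)))"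

definition agree_near :: "'a topology \<Rightarrow> 'a \<Rightarrow> ('a \<Rightarrow> 'b) \<Rightarrow> ('a \<Rightarrow> 'b) \<Rightarrow> bool"
  where "agree_near S p f h \<longleftrightarrow> (\<exists>W. openin S W \<and> p \<in> W \<and> (\<forall>q\<in>W. f q = h q))"

definition smooth_fun_at ::
    "('a, 'e::euclidean_space) smooth_mfd \<Rightarrow> 'a topology \<Rightarrow> 'a \<Rightarrow> ('a \<Rightarrow> real) \<Rightarrow> bool"
  where "smooth_fun_at N S p f \<longleftrightarrow> (\<exists>F. smooth_at N p F \<and> agree_near S p f F)"

definition smooth_curve ::
    "('a, 'e::euclidean_space) smooth_mfd \<Rightarrow> 'a topology \<Rightarrow> 'a \<Rightarrow> (real \<Rightarrow> 'a) \<Rightarrow> bool"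
  where "smooth_curve N S p \<gamma> \<longleftrightarrow> \<gamma> 0 = p \<and>
    (\<exists>\<epsilon>>0. continuous_map (top_of_set {-\<epsilon><..<\<epsilon>}) S \<gamma> \<and>
       (\<forall>(V, \<phi>) \<in> atlas N. smooth_on {t \<in> {-\<epsilon><..<\<epsilon>}. \<gamma> t \<in> V} (\<phi> \<circ> \<gamma>)))"

text \<open>A tangent vector at \<open>p\<close> is the velocity of a smooth curve through \<open>p\<close>, regarded as an operator on
  the ambient functions that are smooth near \<open>p\<close>.  It is set to \<open>0\<close> on all other functions, so
  that equality of tangent vectors is equality of operators and the tangent space of a submanifold is
  literally a subspace of the ambient one.\<close>

type_synonym 'a tvec = "('a \<Rightarrow> real) \<Rightarrow> real"
type_synonym 'a vfield = "'a \<Rightarrow> 'a tvec"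
type_synonym 'a tmetric = "'a \<Rightarrow> 'a tvec \<Rightarrow> 'a tvec \<Rightarrow> real"

definition velocity :: "('a, 'e::euclidean_space) smooth_mfd \<Rightarrow> (real \<Rightarrow> 'a) \<Rightarrow> 'a tvec"
  where "velocity N \<gamma> = (\<lambda>f. if smooth_at N (\<gamma> 0) f then deriv (f \<circ> \<gamma>) 0 else 0)"

definition tangent_space ::
    "('a, 'e::euclidean_space) smooth_mfd \<Rightarrow> 'a topology \<Rightarrow> 'a \<Rightarrow> 'a tvec set"
  where "tangent_space N S p = velocity N ` {\<gamma>. smooth_curve N S p \<gamma>}"

text \<open>Derivative of a smooth function \<open>f\<close> on \<open>S\<close> in the direction \<open>v\<close> tangent to \<open>S\<close>: apply \<open>v\<close> to a
  local smooth extension of \<open>f\<close> to the ambient manifold (the value does not depend on the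
  extension).\<close>

definition dir_deriv ::
    "('a, 'e::euclidean_space) smooth_mfd \<Rightarrow> 'a topology \<Rightarrow> 'a \<Rightarrow> 'a tvec \<Rightarrow> ('a \<Rightarrow> real) \<Rightarrow> real"
  where "dir_deriv N S p v f = v (SOME F. smooth_at N p F \<and> agree_near S p f F)"

definition vfield_at ::
    "('a, 'e::euclidean_space) smooth_mfd \<Rightarrow> 'a topology \<Rightarrow> 'a \<Rightarrow> 'a vfield \<Rightarrow> bool"
  where "vfield_at N S p X \<longleftrightarrow>
    (\<exists>W. openin S W \<and> p \<in> W \<and>
       (\<forall>q\<in>W. X q \<in> tangent_space N S q \<and>
          (\<forall>F. smooth_at N q F \<longrightarrow> smooth_fun_at N S q (\<lambda>r. X r F))))"

definition lie_bracket ::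
    "('a, 'e::euclidean_space) smooth_mfd \<Rightarrow> 'a topology \<Rightarrow> 'a vfield \<Rightarrow> 'a vfield \<Rightarrow> 'a vfield"
  where "lie_bracket N S X Y p = (\<lambda>F.
    if smooth_at N p F
    then dir_deriv N S p (X p) (\<lambda>q. Y q F) - dir_deriv N S p (Y p) (\<lambda>q. X q F)
    else 0)"

definition linear_on_subspace :: "'v::real_vector set \<Rightarrow> ('v \<Rightarrow> 'w::real_vector) \<Rightarrow> bool"
  where "linear_on_subspace T A \<longleftrightarrow>
    (\<forall>u\<in>T. \<forall>v\<in>T. \<forall>a b. A (a *\<^sub>R u + b *\<^sub>R v) = a *\<^sub>R A u + b *\<^sub>R A v)"

text \<open>Since tangent spaces of a submanifold are contained in the ambient ones, a metric \<open>g\<close> of the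
  ambient manifold and the metric it induces on a submanifold are the same function.\<close>

definition riemannian_metric ::
    "('a, 'e::euclidean_space) smooth_mfd \<Rightarrow> 'a topology \<Rightarrow> 'a tmetric \<Rightarrow> bool"
  where "riemannian_metric N S g \<longleftrightarrow>
    (\<forall>p \<in> topspace S.
       (\<forall>u \<in> tangent_space N S p. linear_on_subspace (tangent_space N S p) (g p u)) \<and>
       (\<forall>u \<in> tangent_space N S p. \<forall>v \<in> tangent_space N S p. g p u v = g p v u) \<and>
       (\<forall>u \<in> tangent_space N S p. u \<noteq> 0 \<longrightarrow> g p u u > 0) \<and>
       (\<forall>X Y. vfield_at N S p X \<longrightarrow> vfield_at N S p Y \<longrightarrow>
          smooth_fun_at N S p (\<lambda>q. g q (X q) (Y q))))"

text \<open>\<open>D p v Y\<close> is the covariant derivative at \<open>p\<close> of the locally defined field \<open>Y\<close> in the direction of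
  the tangent vector \<open>v\<close>, and \<open>covd D X Y\<close> is the field usually written \<open>D_X Y\<close>.\<close>

type_synonym 'a connection = "'a \<Rightarrow> 'a tvec \<Rightarrow> 'a vfield \<Rightarrow> 'a tvec"

definition covd :: "'a connection \<Rightarrow> 'a vfield \<Rightarrow> 'a vfield \<Rightarrow> 'a vfield"
  where "covd D X Y = (\<lambda>q. D q (X q) Y)"

definition affine_connection ::
    "('a, 'e::euclidean_space) smooth_mfd \<Rightarrow> 'a topology \<Rightarrow> 'a connection \<Rightarrow> bool"
  where "affine_connection N S D \<longleftrightarrow>
    (\<forall>p \<in> topspace S.
       (\<forall>Y. vfield_at N S p Y \<longrightarrow>
          linear_on_subspace (tangent_space N S p) (\<lambda>v. D p v Y)) \<and>
       (\<forall>v \<in> tangent_space N S p. \<forall>Y. vfield_at N S p Y \<longrightarrow> D p v Y \<in> tangent_space N S p) \<and>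
       (\<forall>v \<in> tangent_space N S p. \<forall>Y Z. vfield_at N S p Y \<longrightarrow> vfield_at N S p Z \<longrightarrow>
          D p v (Y + Z) = D p v Y + D p v Z) \<and>
       (\<forall>v \<in> tangent_space N S p. \<forall>f Y. smooth_fun_at N S p f \<longrightarrow> vfield_at N S p Y \<longrightarrow>
          D p v (\<lambda>q. f q *\<^sub>R Y q) = dir_deriv N S p v f *\<^sub>R Y p + f p *\<^sub>R D p v Y) \<and>
       (\<forall>v \<in> tangent_space N S p. \<forall>Y Z. vfield_at N S p Y \<longrightarrow> agree_near S p Y Z \<longrightarrow>
          D p v Y = D p v Z) \<and>
       (\<forall>X Y. vfield_at N S p X \<longrightarrow> vfield_at N S p Y \<longrightarrow> vfield_at N S p (covd D X Y)))"

definition torsion_free ::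
    "('a, 'e::euclidean_space) smooth_mfd \<Rightarrow> 'a topology \<Rightarrow> 'a connection \<Rightarrow> bool"
  where "torsion_free N S D \<longleftrightarrow>
    (\<forall>p \<in> topspace S. \<forall>X Y. vfield_at N S p X \<longrightarrow> vfield_at N S p Y \<longrightarrow>
       covd D X Y p - covd D Y X p = lie_bracket N S X Y p)"

definition dual_connections ::
    "('a, 'e::euclidean_space) smooth_mfd \<Rightarrow> 'a topology \<Rightarrow> 'a tmetric \<Rightarrow> 'a connection
      \<Rightarrow> 'a connection \<Rightarrow> bool"
  where "dual_connections N S g D Ds \<longleftrightarrow>
    (\<forall>p \<in> topspace S. \<forall>X Y Z.
       vfield_at N S p X \<longrightarrow> vfield_at N S p Y \<longrightarrow> vfield_at N S p Z \<longrightarrow>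
       dir_deriv N S p (X p) (\<lambda>q. g q (Y q) (Z q))
         = g p (covd D X Y p) (Z p) + g p (Y p) (covd Ds X Z p))"

definition is_levi_civita ::
    "('a, 'e::euclidean_space) smooth_mfd \<Rightarrow> 'a topology \<Rightarrow> 'a tmetric \<Rightarrow> 'a connection \<Rightarrow> bool"
  where "is_levi_civita N S g D \<longleftrightarrow>
    affine_connection N S D \<and> torsion_free N S D \<and> dual_connections N S g D D"

text \<open>The Levi-Civita connection is unique up to its values on arguments that are not tangent vectors
  and local smooth vector fields, hence \<open>SOME\<close> rather than \<open>THE\<close>.\<close>

definition levi_civita ::
    "('a, 'e::euclidean_space) smooth_mfd \<Rightarrow> 'a topology \<Rightarrow> 'a tmetric \<Rightarrow> 'a connection"
  where "levi_civita N S g = (SOME D. is_levi_civita N S g D)"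

definition cov_deriv_metric ::
    "('a, 'e::euclidean_space) smooth_mfd \<Rightarrow> 'a topology \<Rightarrow> 'a tmetric \<Rightarrow> 'a connection
      \<Rightarrow> 'a vfield \<Rightarrow> 'a vfield \<Rightarrow> 'a vfield \<Rightarrow> 'a \<Rightarrow> real"
  where "cov_deriv_metric N S g D X Y Z p =
    dir_deriv N S p (X p) (\<lambda>q. g q (Y q) (Z q))
      - g p (covd D X Y p) (Z p) - g p (Y p) (covd D X Z p)"

definition statistical_structure ::
    "('a, 'e::euclidean_space) smooth_mfd \<Rightarrow> 'a topology \<Rightarrow> 'a tmetric \<Rightarrow> 'a connection
      \<Rightarrow> 'a connection \<Rightarrow> bool"
  where "statistical_structure N S g D Ds \<longleftrightarrow>
    riemannian_metric N S g \<and>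
    affine_connection N S D \<and> torsion_free N S D \<and>
    affine_connection N S Ds \<and> torsion_free N S Ds \<and>
    dual_connections N S g D Ds \<and>
    (\<forall>p \<in> topspace S. \<forall>X Y Z.
       vfield_at N S p X \<longrightarrow> vfield_at N S p Y \<longrightarrow> vfield_at N S p Z \<longrightarrow>
       cov_deriv_metric N S g D X Y Z p = cov_deriv_metric N S g D Y X Z p)"

definition curvature_field ::
    "('a, 'e::euclidean_space) smooth_mfd \<Rightarrow> 'a topology \<Rightarrow> 'a connection
      \<Rightarrow> 'a vfield \<Rightarrow> 'a vfield \<Rightarrow> 'a vfield \<Rightarrow> 'a vfield"
  where "curvature_field N S D X Y Z =
    covd D X (covd D Y Z) - covd D Y (covd D X Z) - covd D (lie_bracket N S X Y) Z"

definition local_ext ::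
    "('a, 'e::euclidean_space) smooth_mfd \<Rightarrow> 'a topology \<Rightarrow> 'a \<Rightarrow> 'a tvec \<Rightarrow> 'a vfield"
  where "local_ext N S p v = (SOME X. vfield_at N S p X \<and> X p = v)"

text \<open>The curvature tensor \<open>R(u,v)w\<close> at \<open>p\<close>; by tensoriality it does not depend on the chosen local
  extensions of the vectors to fields.\<close>

definition curvature ::
    "('a, 'e::euclidean_space) smooth_mfd \<Rightarrow> 'a topology \<Rightarrow> 'a connection
      \<Rightarrow> 'a \<Rightarrow> 'a tvec \<Rightarrow> 'a tvec \<Rightarrow> 'a tvec \<Rightarrow> 'a tvec"
  where "curvature N S D p u v w =
    curvature_field N S D (local_ext N S p u) (local_ext N S p v) (local_ext N S p w) p"

text \<open>Elements of \<open>End(T_p)\<close> are represented by functions that vanish outside \<open>T_p\<close>.\<close>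

definition tangent_End ::
    "('a, 'e::euclidean_space) smooth_mfd \<Rightarrow> 'a \<Rightarrow> ('a tvec \<Rightarrow> 'a tvec) set"
  where "tangent_End N p = {A.
    linear_on_subspace (tangent_space N (mtop N) p) A \<and>
    (\<forall>v \<in> tangent_space N (mtop N) p. A v \<in> tangent_space N (mtop N) p) \<and>
    (\<forall>v. v \<notin> tangent_space N (mtop N) p \<longrightarrow> A v = 0)}"

text \<open>The index type \<open>3\<close> has arithmetic modulo 3.  The quaternion relations imply that the three
  endomorphisms are linearly independent, so their span has rank 3.\<close>

definition local_basis ::
    "('a, 'e::euclidean_space) smooth_mfd \<Rightarrow> ('a \<Rightarrow> ('a tvec \<Rightarrow> 'a tvec) set) \<Rightarrow> 'a set
      \<Rightarrow> (3 \<Rightarrow> 'a \<Rightarrow> 'a tvec \<Rightarrow> 'a tvec) \<Rightarrow> bool"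
  where "local_basis N Q U J \<longleftrightarrow>
    openin (mtop N) U \<and>
    (\<forall>p\<in>U. \<forall>\<alpha>.
       J \<alpha> p \<in> tangent_End N p \<and>
       (\<forall>v \<in> tangent_space N (mtop N) p.
          J \<alpha> p (J \<alpha> p v) = - v \<and>
          J \<alpha> p (J (\<alpha> + 1) p v) = J (\<alpha> + 2) p v \<and>
          J (\<alpha> + 1) p (J \<alpha> p v) = - J (\<alpha> + 2) p v) \<and>
       (\<forall>X. vfield_at N (mtop N) p X \<longrightarrow> vfield_at N (mtop N) p (\<lambda>q. J \<alpha> q (X q)))) \<and>
    (\<forall>p\<in>U. Q p = span (range (\<lambda>\<alpha>. J \<alpha> p)))"

definition almost_quaternionic ::
    "('a, 'e::euclidean_space) smooth_mfd \<Rightarrow> ('a \<Rightarrow> ('a tvec \<Rightarrow> 'a tvec) set) \<Rightarrow> bool"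
  where "almost_quaternionic N Q \<longleftrightarrow>
    (\<forall>p \<in> topspace (mtop N). \<exists>U J. p \<in> U \<and> local_basis N Q U J)"

definition one_form ::
    "('a, 'e::euclidean_space) smooth_mfd \<Rightarrow> 'a set \<Rightarrow> ('a \<Rightarrow> 'a tvec \<Rightarrow> real) \<Rightarrow> bool"
  where "one_form N U \<omega> \<longleftrightarrow>
    (\<forall>p\<in>U. linear_on_subspace (tangent_space N (mtop N) p) (\<omega> p) \<and>
       (\<forall>X. vfield_at N (mtop N) p X \<longrightarrow> smooth_fun_at N (mtop N) p (\<lambda>q. \<omega> q (X q))))"

text \<open>The left-hand side of the last equation is \<open>(D_X J_\<alpha>) Y\<close>.\<close>

definition quaternionic_kaehler_like ::
    "('a, 'e::euclidean_space) smooth_mfd \<Rightarrow> 'a tmetric \<Rightarrow> 'a connection \<Rightarrow> 'a connection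
      \<Rightarrow> ('a \<Rightarrow> ('a tvec \<Rightarrow> 'a tvec) set) \<Rightarrow> bool"
  where "quaternionic_kaehler_like N g D Ds Q \<longleftrightarrow>
    statistical_structure N (mtop N) g D Ds \<and> almost_quaternionic N Q \<and>
    (\<forall>U J. local_basis N Q U J \<longrightarrow>
       (\<exists>\<omega> :: 3 \<Rightarrow> 'a \<Rightarrow> 'a tvec \<Rightarrow> real. (\<forall>\<alpha>. one_form N U (\<omega> \<alpha>)) \<and>
          (\<forall>p\<in>U. \<forall>X Y \<alpha>. vfield_at N (mtop N) p X \<longrightarrow> vfield_at N (mtop N) p Y \<longrightarrow>
             covd D X (\<lambda>q. J \<alpha> q (Y q)) p - J \<alpha> p (covd D X Y p)
               = \<omega> (\<alpha> + 2) p (X p) *\<^sub>R J (\<alpha> + 1) p (Y p)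
                 - \<omega> (\<alpha> + 1) p (X p) *\<^sub>R J (\<alpha> + 2) p (Y p))))"

text \<open>The endomorphism \<open>A\<^sup>*\<close> with \<open>g(A X, Y) + g(X, A\<^sup>* Y) = 0\<close>.\<close>

definition star_End ::
    "('a, 'e::euclidean_space) smooth_mfd \<Rightarrow> 'a tmetric \<Rightarrow> 'a \<Rightarrow> ('a tvec \<Rightarrow> 'a tvec)
      \<Rightarrow> 'a tvec \<Rightarrow> 'a tvec"
  where "star_End N g p A = (\<lambda>y.
    if y \<in> tangent_space N (mtop N) p
    then THE z. z \<in> tangent_space N (mtop N) p \<and>
           (\<forall>x \<in> tangent_space N (mtop N) p. g p (A x) y + g p x z = 0)
    else 0)"

definition quaternionic_curvature_form ::
    "'a tmetric \<Rightarrow> 'a \<Rightarrow> real \<Rightarrow> (3 \<Rightarrow> 'a tvec \<Rightarrow> 'a tvec)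
      \<Rightarrow> 'a tvec \<Rightarrow> 'a tvec \<Rightarrow> 'a tvec \<Rightarrow> 'a tvec"
  where "quaternionic_curvature_form g p c J x y z = (c / 4) *\<^sub>R
    (g p y z *\<^sub>R x - g p x z *\<^sub>R y
     + (\<Sum>\<alpha>\<in>UNIV. g p z (J \<alpha> y) *\<^sub>R J \<alpha> x - g p z (J \<alpha> x) *\<^sub>R J \<alpha> y)
     + (\<Sum>\<alpha>\<in>UNIV. g p x (J \<alpha> y) *\<^sub>R J \<alpha> z - g p (J \<alpha> x) y *\<^sub>R J \<alpha> z))"

definition has_quaternionic_curvature ::
    "('a, 'e::euclidean_space) smooth_mfd \<Rightarrow> 'a tmetric \<Rightarrow> 'a connection \<Rightarrow> 'a connection
      \<Rightarrow> ('a \<Rightarrow> ('a tvec \<Rightarrow> 'a tvec) set) \<Rightarrow> real \<Rightarrow> bool"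
  where "has_quaternionic_curvature N g D Ds Q c \<longleftrightarrow>
    (\<forall>U J. local_basis N Q U J \<longrightarrow>
       (\<forall>p\<in>U. \<forall>x \<in> tangent_space N (mtop N) p. \<forall>y \<in> tangent_space N (mtop N) p.
        \<forall>z \<in> tangent_space N (mtop N) p.
          curvature N (mtop N) D p x y z
            = quaternionic_curvature_form g p c (\<lambda>\<alpha>. J \<alpha> p) x y z \<and>
          curvature N (mtop N) Ds p x y z
            = quaternionic_curvature_form g p c (\<lambda>\<alpha>. star_End N g p (J \<alpha> p)) x y z))"

definition ambient_ext ::
    "('a, 'e::euclidean_space) smooth_mfd \<Rightarrow> 'a topology \<Rightarrow> 'a \<Rightarrow> 'a vfield \<Rightarrow> 'a vfield"
  where "ambient_ext N S p Y = (SOME Z. vfield_at N (mtop N) p Z \<and> agree_near S p Y Z)"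

definition tangential_part ::
    "('a, 'e::euclidean_space) smooth_mfd \<Rightarrow> 'a topology \<Rightarrow> 'a tmetric \<Rightarrow> 'a \<Rightarrow> 'a tvec \<Rightarrow> 'a tvec"
  where "tangential_part N S g p v =
    (THE w. w \<in> tangent_space N S p \<and> (\<forall>u \<in> tangent_space N S p. g p (v - w) u = 0))"

text \<open>The Gauss formula: the ambient derivative of a field tangent to \<open>S\<close> in a direction tangent to \<open>S\<close>
  (computed with any local ambient extension of the field) splits into a tangential part, the induced
  connection, and a normal part, the second fundamental form.\<close>

definition induced_connection ::
    "('a, 'e::euclidean_space) smooth_mfd \<Rightarrow> 'a topology \<Rightarrow> 'a tmetric \<Rightarrow> 'a connection \<Rightarrow> 'a connection"
  where "induced_connection N S g D p v Y = tangential_part N S g p (D p v (ambient_ext N S p Y))"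

definition second_fundamental_form ::
    "('a, 'e::euclidean_space) smooth_mfd \<Rightarrow> 'a topology \<Rightarrow> 'a tmetric \<Rightarrow> 'a connection
      \<Rightarrow> 'a \<Rightarrow> 'a tvec \<Rightarrow> 'a tvec \<Rightarrow> 'a tvec"
  where "second_fundamental_form N S g D p u v =
    (let w = D p u (ambient_ext N S p (local_ext N S p v)) in w - tangential_part N S g p w)"

definition totally_real ::
    "('a, 'e::euclidean_space) smooth_mfd \<Rightarrow> 'a tmetric \<Rightarrow> ('a \<Rightarrow> ('a tvec \<Rightarrow> 'a tvec) set)
      \<Rightarrow> 'a topology \<Rightarrow> bool"
  where "totally_real N g Q S \<longleftrightarrow>
    (\<forall>U J. local_basis N Q U J \<longrightarrow>
       (\<forall>p \<in> U \<inter> topspace S. \<forall>\<alpha>. \<forall>x \<in> tangent_space N S p. \<forall>y \<in> tangent_space N S p.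
          g p (J \<alpha> p x) y = 0))"

text \<open>For an ambient manifold of dimension \<open>4 m\<close>, the maximal dimension of a totally real submanifold
  is \<open>m\<close>.\<close>

definition lagrangian_submanifold ::
    "('a, 'e::euclidean_space) smooth_mfd \<Rightarrow> 'a tmetric \<Rightarrow> ('a \<Rightarrow> ('a tvec \<Rightarrow> 'a tvec) set)
      \<Rightarrow> nat \<Rightarrow> 'a topology \<Rightarrow> nat \<Rightarrow> bool"
  where "lagrangian_submanifold N g Q m S n \<longleftrightarrow>
    immersed_submanifold N S n \<and> totally_real N g Q S \<and> n = m"

definition orthonormal_basis ::
    "'a tmetric \<Rightarrow> 'a \<Rightarrow> 'a tvec set \<Rightarrow> nat \<Rightarrow> (nat \<Rightarrow> 'a tvec) \<Rightarrow> bool"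
  where "orthonormal_basis g p V n e \<longleftrightarrow>
    (\<forall>i\<in>{1..n}. \<forall>j\<in>{1..n}. g p (e i) (e j) = (if i = j then 1 else 0)) \<and>
    span (e ` {1..n}) = V"

definition some_onb :: "'a tmetric \<Rightarrow> 'a \<Rightarrow> 'a tvec set \<Rightarrow> nat \<Rightarrow> nat \<Rightarrow> 'a tvec"
  where "some_onb g p V n = (SOME e. orthonormal_basis g p V n e)"

definition two_plane ::
    "('a, 'e::euclidean_space) smooth_mfd \<Rightarrow> 'a topology \<Rightarrow> 'a \<Rightarrow> 'a tvec set \<Rightarrow> bool"
  where "two_plane N S p \<pi> \<longleftrightarrow> subspace \<pi> \<and> \<pi> \<subseteq> tangent_space N S p \<and> dim \<pi> = 2"

definition orthogonal_planes :: "'a tmetric \<Rightarrow> 'a \<Rightarrow> 'a tvec set \<Rightarrow> 'a tvec set \<Rightarrow> bool"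
  where "orthogonal_planes g p \<pi>\<^sub>1 \<pi>\<^sub>2 \<longleftrightarrow> (\<forall>u\<in>\<pi>\<^sub>1. \<forall>v\<in>\<pi>\<^sub>2. g p u v = 0)"

text \<open>The quantities below do not depend on the orthonormal basis used.\<close>

definition sectional_curvature ::
    "('a, 'e::euclidean_space) smooth_mfd \<Rightarrow> 'a topology \<Rightarrow> 'a tmetric \<Rightarrow> 'a \<Rightarrow> 'a tvec set \<Rightarrow> real"
  where "sectional_curvature N S g p \<pi> =
    (let e = some_onb g p \<pi> 2; x = e 1; y = e 2
     in g p (curvature N S (levi_civita N S g) p x y y) x)"

definition sectional_K_curvature ::
    "('a, 'e::euclidean_space) smooth_mfd \<Rightarrow> 'a topology \<Rightarrow> 'a tmetric \<Rightarrow> 'a connection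
      \<Rightarrow> 'a connection \<Rightarrow> 'a \<Rightarrow> 'a tvec set \<Rightarrow> real"
  where "sectional_K_curvature N S g D Ds p \<pi> =
    (let e = some_onb g p \<pi> 2; x = e 1; y = e 2
     in (g p (curvature N S D p x y y) x + g p (curvature N S Ds p x y y) x
           - 2 * g p (curvature N S (levi_civita N S g) p x y y) x) / 2)"

text \<open>Sum of a function \<open>K\<close> of 2-planes over the coordinate planes of an orthonormal basis of the tangent
  space of the \<open>n\<close>-dimensional submanifold \<open>S\<close>; \<open>K\<close> may be the ambient sectional curvature.\<close>

definition scalar_sum ::
    "('a, 'e::euclidean_space) smooth_mfd \<Rightarrow> 'a topology \<Rightarrow> 'a tmetric \<Rightarrow> nat
      \<Rightarrow> ('a \<Rightarrow> 'a tvec set \<Rightarrow> real) \<Rightarrow> 'a \<Rightarrow> real"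
  where "scalar_sum N S g n K p =
    (let e = some_onb g p (tangent_space N S p) n
     in \<Sum>i = 1..n. \<Sum>j = i + 1..n. K p (span {e i, e j}))"

definition mean_curvature ::
    "('a, 'e::euclidean_space) smooth_mfd \<Rightarrow> 'a topology \<Rightarrow> 'a tmetric \<Rightarrow> nat \<Rightarrow> 'a connection
      \<Rightarrow> 'a \<Rightarrow> 'a tvec"
  where "mean_curvature N S g n D p =
    (let e = some_onb g p (tangent_space N S p) n
     in (1 / real n) *\<^sub>R (\<Sum>i = 1..n. second_fundamental_form N S g D p (e i) (e i)))"

definition chen_delta22_equality ::
    "('a, 'e::euclidean_space) smooth_mfd \<Rightarrow> 'a tmetric \<Rightarrow> 'a connection \<Rightarrow> 'a connection
      \<Rightarrow> 'a topology \<Rightarrow> nat \<Rightarrow> real \<Rightarrow> 'a \<Rightarrow> 'a tvec set \<Rightarrow> 'a tvec set \<Rightarrow> bool"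
  where "chen_delta22_equality N g D Ds S n c p \<pi>\<^sub>1 \<pi>\<^sub>2 \<longleftrightarrow>
    (let K = sectional_K_curvature N S g (induced_connection N S g D) (induced_connection N S g Ds);
         K0 = sectional_curvature N S g;
         K0hat = sectional_curvature N (mtop N) g;
         \<tau> = scalar_sum N S g n K p;
         \<tau>0 = scalar_sum N S g n K0 p;
         \<tau>0hat = scalar_sum N S g n K0hat p;
         H = mean_curvature N S g n D p;
         Hs = mean_curvature N S g n Ds p
     in (\<tau> - K p \<pi>\<^sub>1 - K p \<pi>\<^sub>2) - (\<tau>0 - K0 p \<pi>\<^sub>1 - K0 p \<pi>\<^sub>2)
        = c / 8 * ((real n)\<^sup>2 - real n - 4)
          - (real n)\<^sup>2 * (real n - 3) / (4 * (real n - 2)) * (g p H H + g p Hs Hs)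
          - 2 * (\<tau>0hat - K0hat p \<pi>\<^sub>1 - K0hat p \<pi>\<^sub>2))"

end

theory Submission
  imports Defs
begin

text \<open>Write \<open>\<sigma>\<close>, \<open>\<sigma>\<^sup>*\<close> for the second fundamental forms of the dual connections.  The Gauss equations of the
  two dual connections and of the Levi-Civita connection turn the Chen equality into the equality case of
  an algebraic inequality that holds separately for \<open>\<sigma>\<close> and \<open>\<sigma>\<^sup>*\<close>: the defect is a sum of squares.  Hence
  there is an orthonormal basis with \<open>\<sigma>(f\<^sub>5, f\<^sub>5) = \<sigma>(f\<^sub>6, f\<^sub>6) = t\<close>, where \<open>t\<close> is a multiple of \<open>H\<close>, and
  \<open>\<sigma>(f\<^sub>5, f\<^sub>k) = 0\<close> for \<open>k \<noteq> 5\<close>, and likewise for \<open>\<sigma>\<^sup>*\<close>.  Differentiating \<open>g(J Y, Z) = 0\<close> along the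
  submanifold gives \<open>g(\<sigma>(x, y), J\<^sup>* z) = g(J y, \<sigma>\<^sup>*(x, z))\<close>.  With \<open>x = y = f\<^sub>5\<close>, or \<open>x = y = f\<^sub>6\<close> if
  \<open>z = f\<^sub>5\<close>, the right-hand side vanishes for every basis vector \<open>z\<close>; here \<open>n \<ge> 6\<close> is needed.  So the normal
  vector \<open>t\<close> is orthogonal to all \<open>J\<^sup>* z\<close>, which span the normal space, and \<open>t = 0\<close>.\<close>

section \<open>Calculus of smooth maps\<close>

text \<open>A plane enters the Chen equality only through K - K0 + 2 K0', with K0' its ambient
  sectional curvature. On orthonormal vectors tangent to a totally real submanifold both ambient
  dual curvatures are c/4, and n(n-1)/2 - 2 planes give the term c/8 (n^2 - n - 4). Removing two
  orthogonal planes groups the n diagonal entries of \<sigma> into n - 2 blocks with sum n H;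
  (n-3)/(n-2) is the Cauchy-Schwarz constant for n - 2 vectors, and the remaining n^2/4 comes from
  |n H|^2 and two factors 1/2. The equality is given only for \<sigma> and its dual form together.
  As each defect is nonnegative in one basis adapted to the planes, both vanish in that same basis;
  a common basis is what the duality identity requires, since it pairs \<sigma> with the dual form.
  The formal obstacle is that extensions of vectors and fields, orthonormal bases and the
  Levi-Civita connection are all picked by \<open>SOME\<close>. Independence of these choices
  (tensoriality, uniqueness, invariance of traces) therefore has to be established before the
  choices can be used in computations.\<close>

lemma Ck_on_subset: "Ck_on k U f \<Longrightarrow> V \<subseteq> U \<Longrightarrow> Ck_on k V f"
proof (induction k arbitrary: f)
  case 0 then show ?case by (auto intro: continuous_on_subset)
next
  case (Suc k) then show ?case by (simp add: subset_iff)
qed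

lemma frechet_derivative_cong_open:
  assumes "open U" "x \<in> U" "\<And>y. y \<in> U \<Longrightarrow> f y = h y"
  shows "frechet_derivative f (at x) = frechet_derivative h (at x)"
    and "f differentiable (at x) \<longleftrightarrow> h differentiable (at x)"
proof -
  have *: "(f has_derivative D) (at x) \<longleftrightarrow> (h has_derivative D) (at x)" for D
    using assms by (metis has_derivative_transform_within_open)
  show "frechet_derivative f (at x) = frechet_derivative h (at x)"
    unfolding frechet_derivative_def * ..
  show "f differentiable (at x) \<longleftrightarrow> h differentiable (at x)"
    unfolding differentiable_def * ..
qed

lemma Ck_on_cong:
  "open U \<Longrightarrow> Ck_on k U f \<Longrightarrow> (\<And>x. x \<in> U \<Longrightarrow> f x = h x) \<Longrightarrow> Ck_on k U h"
proof (induction k arbitrary: f h)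
  case 0 then show ?case using continuous_on_cong by fastforce
next
  case (Suc k)
  have "Ck_on k U (\<lambda>x. frechet_derivative h (at x) v)" for v
  proof (rule Suc.IH)
    show "Ck_on k U (\<lambda>x. frechet_derivative f (at x) v)" using Suc.prems(2) by simp
    show "frechet_derivative f (at x) v = frechet_derivative h (at x) v" if "x \<in> U" for x
      using frechet_derivative_cong_open(1)[of U x f h] Suc.prems that by metis
  qed (rule Suc.prems(1))
  moreover have "h differentiable (at x)" if "x \<in> U" for x
    using frechet_derivative_cong_open(2)[of U x f h] Suc.prems that by (metis Ck_on.simps(2))
  ultimately show ?case by simp
qed

declare Ck_on.simps(2) [simp del]

text \<open>\<open>Ck_on (Suc k)\<close> speaks of \<open>frechet_derivative\<close>. By uniqueness
  of derivatives any explicit family \<open>f'\<close> of directional derivatives may stand in for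
  it, so each closure property below reduces to a rule of differentiation plus the case of order
  \<open>k\<close>.\<close>

lemma Ck_on_SucI:
  assumes "open U" and d: "\<And>x. x \<in> U \<Longrightarrow> (f has_derivative (\<lambda>v. f' v x)) (at x)"
    and "\<And>v. Ck_on k U (f' v)"
  shows "Ck_on (Suc k) U f"
proof -
  have "Ck_on k U (\<lambda>x. frechet_derivative f (at x) v)" for v
  proof (rule Ck_on_cong)
    show "f' v x = frechet_derivative f (at x) v" if "x \<in> U" for x
      using frechet_derivative_at[OF d[OF that]] by metis
  qed (fact assms)+
  moreover have "f differentiable (at x)" if "x \<in> U" for x
    using d[OF that] unfolding differentiable_def by metis
  ultimately show ?thesis unfolding Ck_on.simps(2) by metis
qed

lemma Ck_on_SucE:
  assumes "Ck_on (Suc k) U f"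
  obtains f' where "\<And>x. x \<in> U \<Longrightarrow> (f has_derivative (\<lambda>v. f' v x)) (at x)"
    and "\<And>v. Ck_on k U (f' v)"
proof
  show "(f has_derivative (\<lambda>v. frechet_derivative f (at x) v)) (at x)" if "x \<in> U" for x
    using assms that frechet_derivative_works unfolding Ck_on.simps(2) by metis
  show "Ck_on k U (\<lambda>x. frechet_derivative f (at x) v)" for v
    using assms unfolding Ck_on.simps(2) by metis
qed

lemma Ck_on_SucD: "Ck_on (Suc k) U f \<Longrightarrow> Ck_on k U f"
proof (induction k arbitrary: f)
  case 0
  have "isCont f x" if "x \<in> U" for x
    using 0 that differentiable_imp_continuous_within unfolding Ck_on.simps(2) by blast
  then show ?case by (simp add: continuous_at_imp_continuous_on)
next
  case (Suc k)
  show ?case unfolding Ck_on.simps(2)[of k]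
    using Suc.IH Suc.prems unfolding Ck_on.simps(2)[of "Suc k"] by blast
qed

lemma Ck_on_const [simp]: "open U \<Longrightarrow> Ck_on k U (\<lambda>x. c)"
proof (induction k arbitrary: c)
  case (Suc k)
  show ?case
    by (rule Ck_on_SucI[where f' = "\<lambda>v x. 0"]) (use Suc in auto)
qed simp

lemma Ck_on_ident [simp]: "open U \<Longrightarrow> Ck_on k U (\<lambda>x. x)"
proof (induction k)
  case (Suc k)
  show ?case
    by (rule Ck_on_SucI[where f' = "\<lambda>v x. v"]) (use Suc in auto)
qed simp

lemma Ck_on_bounded_linear_compose:
  assumes h: "bounded_linear h"
  shows "Ck_on k U f \<Longrightarrow> open U \<Longrightarrow> Ck_on k U (\<lambda>x. h (f x))"
proof (induction k arbitrary: f)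
  case 0 then show ?case
    using bounded_linear.continuous_on[OF h] by simp
next
  case (Suc k)
  obtain f' where f': "\<And>x. x \<in> U \<Longrightarrow> (f has_derivative (\<lambda>v. f' v x)) (at x)" "\<And>v. Ck_on k U (f' v)"
    by (rule Ck_on_SucE[OF Suc.prems(1)]) (rule that)
  show ?case
  proof (rule Ck_on_SucI)
    show "((\<lambda>x. h (f x)) has_derivative (\<lambda>v. h (f' v x))) (at x)" if "x \<in> U" for x
      by (rule bounded_linear.has_derivative[OF h f'(1)[OF that]])
    show "Ck_on k U (\<lambda>x. h (f' v x))" for v
      by (rule Suc.IH) (use f' Suc.prems in auto)
  qed (fact Suc.prems)
qed

lemma Ck_on_add:
  "Ck_on k U f \<Longrightarrow> Ck_on k U h \<Longrightarrow> open U \<Longrightarrow> Ck_on k U (\<lambda>x. f x + h x)"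
proof (induction k arbitrary: f h)
  case 0 then show ?case using continuous_on_add by simp
next
  case (Suc k)
  obtain f' where f': "\<And>x. x \<in> U \<Longrightarrow> (f has_derivative (\<lambda>v. f' v x)) (at x)" "\<And>v. Ck_on k U (f' v)"
    by (rule Ck_on_SucE[OF Suc.prems(1)]) (rule that)
  obtain h' where h': "\<And>x. x \<in> U \<Longrightarrow> (h has_derivative (\<lambda>v. h' v x)) (at x)" "\<And>v. Ck_on k U (h' v)"
    by (rule Ck_on_SucE[OF Suc.prems(2)]) (rule that)
  show ?case
  proof (rule Ck_on_SucI)
    show "((\<lambda>x. f x + h x) has_derivative (\<lambda>v. f' v x + h' v x)) (at x)" if "x \<in> U" for x
      by (rule has_derivative_add[OF f'(1)[OF that] h'(1)[OF that]])
    show "Ck_on k U (\<lambda>x. f' v x + h' v x)" for v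
      by (rule Suc.IH) (use f' h' Suc.prems in auto)
  qed (fact Suc.prems)
qed

lemma Ck_on_sum:
  "(\<And>i. i \<in> I \<Longrightarrow> Ck_on k U (f i)) \<Longrightarrow> open U \<Longrightarrow> Ck_on k U (\<lambda>x. \<Sum>i\<in>I. f i x)"
proof (induction I rule: infinite_finite_induct)
  case (insert i I)
  have "Ck_on k U (\<lambda>x. f i x + (\<Sum>i\<in>I. f i x))"
    by (rule Ck_on_add) (use insert in auto)
  then show ?case using insert by simp
qed auto

lemma Ck_on_scaleR:
  fixes f :: "'a::real_normed_vector \<Rightarrow> real"
  shows "Ck_on k U f \<Longrightarrow> Ck_on k U h \<Longrightarrow> open U \<Longrightarrow> Ck_on k U (\<lambda>x. f x *\<^sub>R h x)"
proof (induction k arbitrary: f h)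
  case 0 then show ?case using continuous_on_scaleR by simp
next
  case (Suc k)
  obtain f' where f': "\<And>x. x \<in> U \<Longrightarrow> (f has_derivative (\<lambda>v. f' v x)) (at x)" "\<And>v. Ck_on k U (f' v)"
    by (rule Ck_on_SucE[OF Suc.prems(1)]) (rule that)
  obtain h' where h': "\<And>x. x \<in> U \<Longrightarrow> (h has_derivative (\<lambda>v. h' v x)) (at x)" "\<And>v. Ck_on k U (h' v)"
    by (rule Ck_on_SucE[OF Suc.prems(2)]) (rule that)
  show ?case
  proof (rule Ck_on_SucI)
    show "((\<lambda>x. f x *\<^sub>R h x) has_derivative (\<lambda>v. f x *\<^sub>R h' v x + f' v x *\<^sub>R h x)) (at x)"
      if "x \<in> U" for x
      by (rule has_derivative_scaleR[OF f'(1)[OF that] h'(1)[OF that]])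
    show "Ck_on k U (\<lambda>x. f x *\<^sub>R h' v x + f' v x *\<^sub>R h x)" for v
      by (intro Ck_on_add Suc.IH Ck_on_SucD[OF Suc.prems(1)] Ck_on_SucD[OF Suc.prems(2)] f' h'
          Suc.prems(3))
  qed (fact Suc.prems)
qed

lemma Ck_on_mult:
  fixes f h :: "'a::real_normed_vector \<Rightarrow> real"
  shows "Ck_on k U f \<Longrightarrow> Ck_on k U h \<Longrightarrow> open U \<Longrightarrow> Ck_on k U (\<lambda>x. f x * h x)"
  using Ck_on_scaleR[of k U f h] by simp

text \<open>The derivative of 1/f is -(1/f) f' (1/f), which contains 1/f itself but is required only
  one order lower. The induction hypothesis and the product rule therefore suffice.\<close>

lemma Ck_on_inverse:
  fixes f :: "'a::real_normed_vector \<Rightarrow> real"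
  assumes nz: "\<And>x. x \<in> U \<Longrightarrow> f x \<noteq> 0" and "open U"
  shows "Ck_on k U f \<Longrightarrow> Ck_on k U (\<lambda>x. inverse (f x))"
proof (induction k)
  case 0 then show ?case using nz continuous_on_inverse by auto
next
  case (Suc k)
  obtain f' where f': "\<And>x. x \<in> U \<Longrightarrow> (f has_derivative (\<lambda>v. f' v x)) (at x)" "\<And>v. Ck_on k U (f' v)"
    by (rule Ck_on_SucE[OF Suc.prems(1)]) (rule that)
  have IH: "Ck_on k U (\<lambda>x. inverse (f x))"
    by (rule Suc.IH[OF Ck_on_SucD[OF Suc.prems]])
  show ?case
  proof (rule Ck_on_SucI)
    show "((\<lambda>x. inverse (f x)) has_derivative (\<lambda>v. - (inverse (f x) * f' v x * inverse (f x)))) (at x)"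
      if "x \<in> U" for x
      by (rule Deriv.has_derivative_inverse[OF nz[OF that] f'(1)[OF that]])
    show "Ck_on k U (\<lambda>x. - (inverse (f x) * f' v x * inverse (f x)))" for v
      by (intro Ck_on_bounded_linear_compose[OF bounded_linear_minus[OF bounded_linear_ident]]
          Ck_on_mult IH f' \<open>open U\<close>)
  qed (fact assms)
qed

text \<open>In the chain rule f is differentiated in the direction \<open>h' v x\<close>, which
  varies with x. Expanding this direction in \<open>Basis\<close> leaves a finite sum of derivatives
  of f in fixed directions with scalar coefficients, and the induction hypothesis applies to each of
  them; this is why \<open>h\<close> takes values in a Euclidean space.\<close>

lemma Ck_on_compose:
  fixes h :: "'a::real_normed_vector \<Rightarrow> 'b::euclidean_space"
  shows "Ck_on k V f \<Longrightarrow> Ck_on k U h \<Longrightarrow> open U \<Longrightarrow> open V \<Longrightarrow> h ` U \<subseteq> V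
    \<Longrightarrow> Ck_on k U (\<lambda>x. f (h x))"
proof (induction k arbitrary: f h)
  case 0 then show ?case using continuous_on_compose2 by (metis Ck_on.simps(1))
next
  case (Suc k)
  obtain f' where f': "\<And>x. x \<in> V \<Longrightarrow> (f has_derivative (\<lambda>v. f' v x)) (at x)" "\<And>v. Ck_on k V (f' v)"
    by (rule Ck_on_SucE[OF Suc.prems(1)]) (rule that)
  obtain h' where h': "\<And>x. x \<in> U \<Longrightarrow> (h has_derivative (\<lambda>v. h' v x)) (at x)" "\<And>v. Ck_on k U (h' v)"
    by (rule Ck_on_SucE[OF Suc.prems(2)]) (rule that)
  show ?case
  proof (rule Ck_on_SucI)
    fix x assume x: "x \<in> U"
    have df: "(f has_derivative (\<lambda>v. f' v (h x))) (at (h x))"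
      using f'(1) x Suc.prems(5) by blast
    interpret lf: linear "\<lambda>v. f' v (h x)" by (rule has_derivative_linear[OF df])
    have "f' (h' v x) (h x) = (\<Sum>b\<in>Basis. (h' v x \<bullet> b) *\<^sub>R f' b (h x))" for v
      using lf.sum[of "\<lambda>b. (h' v x \<bullet> b) *\<^sub>R b" Basis]
      by (simp add: euclidean_representation lf.scale)
    then show "((\<lambda>x. f (h x)) has_derivative (\<lambda>v. \<Sum>b\<in>Basis. (h' v x \<bullet> b) *\<^sub>R f' b (h x))) (at x)"
      using has_derivative_compose[OF h'(1)[OF x] df] by simp
  next
    show "Ck_on k U (\<lambda>x. \<Sum>b\<in>Basis. (h' v x \<bullet> b) *\<^sub>R f' b (h x))" for v
      by (intro Ck_on_sum Ck_on_scaleR Suc.IH f' Ck_on_SucD[OF Suc.prems(2)] Suc.prems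
          Ck_on_bounded_linear_compose[OF bounded_linear_inner_left] h')
  qed (fact Suc.prems)
qed

section \<open>Closure properties of infinitely differentiable maps\<close>

lemma smooth_on_subset: "smooth_on U f \<Longrightarrow> V \<subseteq> U \<Longrightarrow> smooth_on V f"
  by (auto simp: smooth_on_def intro: Ck_on_subset)

lemma smooth_on_cong:
  "open U \<Longrightarrow> smooth_on U f \<Longrightarrow> (\<And>x. x \<in> U \<Longrightarrow> f x = h x) \<Longrightarrow> smooth_on U h"
  by (auto simp: smooth_on_def intro: Ck_on_cong)

lemma smooth_on_differentiable: "smooth_on U f \<Longrightarrow> x \<in> U \<Longrightarrow> f differentiable (at x)"
  unfolding smooth_on_def using Ck_on.simps(2)[of 0 U f] by blast

lemma smooth_on_derivative:
  "smooth_on U f \<Longrightarrow> smooth_on U (\<lambda>x. frechet_derivative f (at x) v)"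
  unfolding smooth_on_def using Ck_on.simps(2) by blast

lemma smooth_on_const [simp]: "open U \<Longrightarrow> smooth_on U (\<lambda>x. c)"
  and smooth_on_ident [simp]: "open U \<Longrightarrow> smooth_on U (\<lambda>x. x)"
  by (simp_all add: smooth_on_def)

lemma smooth_on_bounded_linear_compose:
  "bounded_linear h \<Longrightarrow> smooth_on U f \<Longrightarrow> open U \<Longrightarrow> smooth_on U (\<lambda>x. h (f x))"
  by (auto simp: smooth_on_def intro: Ck_on_bounded_linear_compose)

lemma smooth_on_add:
  "smooth_on U f \<Longrightarrow> smooth_on U h \<Longrightarrow> open U \<Longrightarrow> smooth_on U (\<lambda>x. f x + h x)"
  by (auto simp: smooth_on_def intro: Ck_on_add)

lemma smooth_on_mult:
  fixes f h :: "'a::real_normed_vector \<Rightarrow> real"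
  shows "smooth_on U f \<Longrightarrow> smooth_on U h \<Longrightarrow> open U \<Longrightarrow> smooth_on U (\<lambda>x. f x * h x)"
  by (auto simp: smooth_on_def intro: Ck_on_mult)

lemma smooth_on_inverse:
  fixes f :: "'a::real_normed_vector \<Rightarrow> real"
  shows "smooth_on U f \<Longrightarrow> (\<And>x. x \<in> U \<Longrightarrow> f x \<noteq> 0) \<Longrightarrow> open U
    \<Longrightarrow> smooth_on U (\<lambda>x. inverse (f x))"
  by (auto simp: smooth_on_def intro: Ck_on_inverse)

lemma smooth_on_compose:
  fixes h :: "'a::real_normed_vector \<Rightarrow> 'b::euclidean_space"
  shows "smooth_on V f \<Longrightarrow> smooth_on U h \<Longrightarrow> open U \<Longrightarrow> open V \<Longrightarrow> h ` U \<subseteq> V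
    \<Longrightarrow> smooth_on U (\<lambda>x. f (h x))"
  by (auto simp: smooth_on_def intro: Ck_on_compose)

section \<open>Charts and tangent vectors\<close>

lemma chart_openin: "chart N U \<phi> \<Longrightarrow> openin (mtop N) U"
  and chart_open: "chart N U \<phi> \<Longrightarrow> open (\<phi> ` U)"
  by (simp_all add: chart_def)

lemma chart_homeomorphism:
  assumes "chart N U \<phi>"
  shows "inj_on \<phi> U"
    and "continuous_map (subtopology (mtop N) U) euclidean \<phi>"
    and "continuous_map (top_of_set (\<phi> ` U)) (subtopology (mtop N) U) (inv_into U \<phi>)"
proof -
  have U: "topspace (subtopology (mtop N) U) = U"
    using chart_openin[OF assms] by (simp add: openin_subset inf_absorb2)
  have h: "homeomorphic_map (subtopology (mtop N) U) (top_of_set (\<phi> ` U)) \<phi>"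
    using assms by (simp add: chart_def)
  show inj: "inj_on \<phi> U"
    using homeomorphic_imp_injective_map[OF h] U by simp
  obtain \<theta> where \<theta>: "homeomorphic_maps (subtopology (mtop N) U) (top_of_set (\<phi> ` U)) \<phi> \<theta>"
    using h homeomorphic_map_maps by blast
  then show "continuous_map (subtopology (mtop N) U) euclidean \<phi>"
    unfolding homeomorphic_maps_def using continuous_map_in_subtopology by blast
  have "continuous_map (top_of_set (\<phi> ` U)) (subtopology (mtop N) U) \<theta>"
    using \<theta> unfolding homeomorphic_maps_def by blast
  moreover have "\<theta> x = inv_into U \<phi> x" if "x \<in> \<phi> ` U" for x
    using that \<theta> inj U unfolding homeomorphic_maps_def by auto
  ultimately show "continuous_map (top_of_set (\<phi> ` U)) (subtopology (mtop N) U) (inv_into U \<phi>)"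
    using continuous_map_eq by (metis topspace_euclidean_subtopology)
qed

lemma chart_inv [simp]: "chart N U \<phi> \<Longrightarrow> x \<in> U \<Longrightarrow> inv_into U \<phi> (\<phi> x) = x"
  by (simp add: chart_homeomorphism(1))

lemma chart_preimage:
  assumes "chart N U \<phi>" "open T"
  shows "openin (mtop N) {x \<in> U. \<phi> x \<in> T}"
proof -
  have "openin (subtopology (mtop N) U) {x \<in> topspace (subtopology (mtop N) U). \<phi> x \<in> T}"
    using openin_continuous_map_preimage[OF chart_homeomorphism(2)[OF assms(1)]] assms(2)
    by (simp add: open_openin[symmetric])
  moreover have "topspace (subtopology (mtop N) U) = U"
    using chart_openin[OF assms(1)] by (simp add: openin_subset inf_absorb2)
  ultimately show ?thesis
    using openin_trans_full chart_openin[OF assms(1)] by fastforce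
qed

text \<open>The image is the preimage of \<open>T\<close> under the continuous inverse of the
  chart.\<close>

lemma chart_image:
  assumes c: "chart N U \<phi>" and T: "openin (mtop N) T" "T \<subseteq> U"
  shows "open (\<phi> ` T)"
proof -
  have "openin (subtopology (mtop N) U) T"
    using T by (metis inf.absorb_iff2 openin_subtopology_Int2)
  from openin_continuous_map_preimage[OF chart_homeomorphism(3)[OF c] this]
  have "openin (top_of_set (\<phi> ` U)) {x \<in> \<phi> ` U. inv_into U \<phi> x \<in> T}"
    by simp
  then have "open {x \<in> \<phi> ` U. inv_into U \<phi> x \<in> T}"
    using openin_open_trans chart_open[OF c] by blast
  moreover have "{x \<in> \<phi> ` U. inv_into U \<phi> x \<in> T} = \<phi> ` T"
    using T(2) c by auto
  ultimately show ?thesis by simp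
qed

section \<open>Smooth functions on a manifold\<close>

locale manifold =
  fixes N :: "('a, 'e::euclidean_space) smooth_mfd"
  assumes smooth_manifold: "smooth_manifold N"
begin

lemma atlas_chart: "(V, \<psi>) \<in> atlas N \<Longrightarrow> chart N V \<psi>"
  using smooth_manifold by (auto simp: smooth_manifold_def)

lemma atlas_cover:
  assumes "p \<in> topspace (mtop N)"
  obtains V \<psi> where "(V, \<psi>) \<in> atlas N" "p \<in> V" "chart N V \<psi>"
  using assms smooth_manifold unfolding smooth_manifold_def by blast

lemma transition_smooth:
  assumes "chart N U \<phi>" "(V, \<psi>) \<in> atlas N"
  shows "smooth_on (\<phi> ` (U \<inter> V)) (\<lambda>x. \<psi> (inv_into U \<phi> x))"
    and "smooth_on (\<psi> ` (U \<inter> V)) (\<lambda>x. \<phi> (inv_into V \<psi> x))"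
  using assms unfolding chart_def by (auto simp: comp_def)

lemma smooth_at_topspace: "smooth_at N p f \<Longrightarrow> p \<in> topspace (mtop N)"
  unfolding smooth_at_def using openin_subset by blast

lemma smooth_at_nbhd:
  assumes "smooth_at N p f"
  obtains U where "openin (mtop N) U" "p \<in> U" "\<And>q. q \<in> U \<Longrightarrow> smooth_at N q f"
  using assms unfolding smooth_at_def by blast

text \<open>The definition quantifies over all atlas charts. Transition maps are smooth in both
  directions, so one chart of the maximal atlas decides smoothness, and all later computations may
  use whichever chart is convenient, in particular a slice chart.\<close>

lemma smooth_at_chart:
  assumes c: "chart N U \<phi>" and p: "p \<in> U"
  shows "smooth_at N p f \<longleftrightarrow>
    (\<exists>T. open T \<and> \<phi> p \<in> T \<and> T \<subseteq> \<phi> ` U \<and> smooth_on T (\<lambda>x. f (inv_into U \<phi> x)))"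
proof
  assume "smooth_at N p f"
  then obtain G where G: "openin (mtop N) G" "p \<in> G"
    and sm: "\<And>V \<psi>. (V, \<psi>) \<in> atlas N \<Longrightarrow> smooth_on (\<psi> ` (G \<inter> V)) (f \<circ> inv_into V \<psi>)"
    unfolding smooth_at_def by blast
  obtain V \<psi> where V: "(V, \<psi>) \<in> atlas N" "p \<in> V" "chart N V \<psi>"
    using atlas_cover G openin_subset by blast
  let ?T = "\<phi> ` (G \<inter> U \<inter> V)"
  have oG: "openin (mtop N) (G \<inter> U \<inter> V)"
    using G chart_openin[OF c] chart_openin[OF V(3)] by blast
  have oT: "open ?T"
    by (rule chart_image[OF c oG]) auto
  have "smooth_on ?T (\<lambda>x. (f \<circ> inv_into V \<psi>) (\<psi> (inv_into U \<phi> x)))"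
  proof (rule smooth_on_compose[OF sm[OF V(1)] _ oT])
    show "smooth_on ?T (\<lambda>x. \<psi> (inv_into U \<phi> x))"
      by (rule smooth_on_subset[OF transition_smooth(1)[OF c V(1)]]) auto
    show "open (\<psi> ` (G \<inter> V))"
      by (rule chart_image[OF V(3)]) (use G chart_openin[OF V(3)] in auto)
    show "(\<lambda>x. \<psi> (inv_into U \<phi> x)) ` ?T \<subseteq> \<psi> ` (G \<inter> V)"
      using c by auto
  qed
  then have "smooth_on ?T (\<lambda>x. f (inv_into U \<phi> x))"
    by (rule smooth_on_cong[OF oT]) (use c V(3) in auto)
  then show "\<exists>T. open T \<and> \<phi> p \<in> T \<and> T \<subseteq> \<phi> ` U \<and> smooth_on T (\<lambda>x. f (inv_into U \<phi> x))"
    using oT G(2) p V(2) by (intro exI[of _ ?T]) auto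
next
  assume "\<exists>T. open T \<and> \<phi> p \<in> T \<and> T \<subseteq> \<phi> ` U \<and> smooth_on T (\<lambda>x. f (inv_into U \<phi> x))"
  then obtain T where T: "open T" "\<phi> p \<in> T" "T \<subseteq> \<phi> ` U"
    and sm: "smooth_on T (\<lambda>x. f (inv_into U \<phi> x))" by blast
  let ?G = "{x \<in> U. \<phi> x \<in> T}"
  have G: "openin (mtop N) ?G" by (rule chart_preimage[OF c T(1)])
  have "smooth_on (\<psi> ` (?G \<inter> V)) (f \<circ> inv_into V \<psi>)" if V: "(V, \<psi>) \<in> atlas N" for V \<psi>
  proof -
    note cV = atlas_chart[OF V]
    have o: "open (\<psi> ` (?G \<inter> V))"
      by (rule chart_image[OF cV]) (use G chart_openin[OF cV] in auto)
    have "smooth_on (\<psi> ` (?G \<inter> V)) (\<lambda>x. f (inv_into U \<phi> (\<phi> (inv_into V \<psi> x))))"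
    proof (rule smooth_on_compose[OF sm _ o T(1)])
      show "smooth_on (\<psi> ` (?G \<inter> V)) (\<lambda>x. \<phi> (inv_into V \<psi> x))"
        by (rule smooth_on_subset[OF transition_smooth(2)[OF c V]]) auto
      show "(\<lambda>x. \<phi> (inv_into V \<psi> x)) ` \<psi> ` (?G \<inter> V) \<subseteq> T"
        using cV by auto
    qed
    then show ?thesis
      by (rule smooth_on_cong[OF o]) (use c cV in auto)
  qed
  then show "smooth_at N p f"
    unfolding smooth_at_def using G p T(2) by blast
qed

lemma smooth_at_const [simp]: "p \<in> topspace (mtop N) \<Longrightarrow> smooth_at N p (\<lambda>q. k)"
proof -
  assume "p \<in> topspace (mtop N)"
  then obtain U \<phi> where p: "p \<in> U" and c: "chart N U \<phi>"
    using atlas_cover by metis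
  show ?thesis unfolding smooth_at_chart[OF c p]
    using chart_open[OF c] p by (intro exI[of _ "\<phi> ` U"]) simp
qed

lemma smooth_at_two_chart:
  assumes "smooth_at N p f" "smooth_at N p h"
  obtains U \<phi> T where "chart N U \<phi>" "p \<in> U" "open T" "\<phi> p \<in> T" "T \<subseteq> \<phi> ` U"
    "smooth_on T (\<lambda>x. f (inv_into U \<phi> x))" "smooth_on T (\<lambda>x. h (inv_into U \<phi> x))"
proof -
  obtain U \<phi> where p: "p \<in> U" and c: "chart N U \<phi>"
    using atlas_cover smooth_at_topspace[OF assms(1)] by metis
  obtain T1 where T1: "open T1" "\<phi> p \<in> T1" "T1 \<subseteq> \<phi> ` U" "smooth_on T1 (\<lambda>x. f (inv_into U \<phi> x))"
    using assms(1) smooth_at_chart[OF c p] by blast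
  obtain T2 where T2: "open T2" "\<phi> p \<in> T2" "T2 \<subseteq> \<phi> ` U" "smooth_on T2 (\<lambda>x. h (inv_into U \<phi> x))"
    using assms(2) smooth_at_chart[OF c p] by blast
  show thesis
    by (rule that[of U \<phi> "T1 \<inter> T2"]) (use p c T1 T2 in \<open>auto elim: smooth_on_subset\<close>)
qed

lemma smooth_at_add:
  assumes "smooth_at N p f" "smooth_at N p h"
  shows "smooth_at N p (\<lambda>q. f q + h q)"
proof -
  obtain U \<phi> T where c: "chart N U \<phi>" "p \<in> U" and T: "open T" "\<phi> p \<in> T" "T \<subseteq> \<phi> ` U"
    and s: "smooth_on T (\<lambda>x. f (inv_into U \<phi> x))" "smooth_on T (\<lambda>x. h (inv_into U \<phi> x))"
    using smooth_at_two_chart[OF assms] by metis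
  show ?thesis unfolding smooth_at_chart[OF c] using T smooth_on_add[OF s T(1)] by blast
qed

lemma smooth_at_mult:
  assumes "smooth_at N p f" "smooth_at N p h"
  shows "smooth_at N p (\<lambda>q. f q * h q)"
proof -
  obtain U \<phi> T where c: "chart N U \<phi>" "p \<in> U" and T: "open T" "\<phi> p \<in> T" "T \<subseteq> \<phi> ` U"
    and s: "smooth_on T (\<lambda>x. f (inv_into U \<phi> x))" "smooth_on T (\<lambda>x. h (inv_into U \<phi> x))"
    using smooth_at_two_chart[OF assms] by metis
  show ?thesis unfolding smooth_at_chart[OF c] using T smooth_on_mult[OF s T(1)] by blast
qed

lemma smooth_at_inverse:
  assumes "smooth_at N p f" "f p \<noteq> 0"
  shows "smooth_at N p (\<lambda>q. inverse (f q))"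
proof -
  obtain U \<phi> T where c: "chart N U \<phi>" "p \<in> U" and T: "open T" "\<phi> p \<in> T" "T \<subseteq> \<phi> ` U"
    and s: "smooth_on T (\<lambda>x. f (inv_into U \<phi> x))"
    using smooth_at_two_chart[OF assms(1) assms(1)] by metis
  let ?f = "\<lambda>x. f (inv_into U \<phi> x)"
  let ?T = "T \<inter> ?f -` (- {0})"
  have "continuous_on T ?f"
    using s unfolding smooth_on_def by (metis Ck_on.simps(1))
  then have o: "open ?T"
    using continuous_open_preimage[OF _ T(1), of ?f "- {0}"] by auto
  have "smooth_on ?T (\<lambda>x. inverse (?f x))"
    by (rule smooth_on_inverse[OF smooth_on_subset[OF s]]) (use o in auto)
  then show ?thesis
    unfolding smooth_at_chart[OF c] using o T assms(2) c by (intro exI[of _ ?T]) auto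
qed

lemma smooth_at_coordinate:
  assumes c: "chart N U \<phi>" and p: "p \<in> U"
  shows "smooth_at N p (\<lambda>q. \<phi> q \<bullet> b)"
  unfolding smooth_at_chart[OF c p]
proof (intro exI conjI)
  have "smooth_on (\<phi> ` U) (\<lambda>x. x \<bullet> b)"
    by (intro smooth_on_bounded_linear_compose[OF bounded_linear_inner_left] smooth_on_ident
        chart_open[OF c])
  then show "smooth_on (\<phi> ` U) (\<lambda>x. \<phi> (inv_into U \<phi> x) \<bullet> b)"
    by (rule smooth_on_cong[OF chart_open[OF c]]) (use c in auto)
qed (use p chart_open[OF c] in auto)

lemma smooth_at_chart_derivative:
  assumes c: "chart N U \<phi>" and p: "p \<in> U" and f: "smooth_at N p f"
  shows "smooth_at N p (\<lambda>q. frechet_derivative (\<lambda>x. f (inv_into U \<phi> x)) (at (\<phi> q)) a)"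
proof -
  obtain T where T: "open T" "\<phi> p \<in> T" "T \<subseteq> \<phi> ` U" "smooth_on T (\<lambda>x. f (inv_into U \<phi> x))"
    using f smooth_at_chart[OF c p] by blast
  have "smooth_on T (\<lambda>x. frechet_derivative (\<lambda>x. f (inv_into U \<phi> x)) (at (\<phi> (inv_into U \<phi> x))) a)"
    by (rule smooth_on_cong[OF T(1) smooth_on_derivative[OF T(4)]]) (use T(3) c in auto)
  then show ?thesis unfolding smooth_at_chart[OF c p] using T by blast
qed

lemma smooth_at_has_derivative:
  assumes c: "chart N U \<phi>" and p: "p \<in> U" and f: "smooth_at N p f"
  shows "((\<lambda>x. f (inv_into U \<phi> x)) has_derivative
    frechet_derivative (\<lambda>x. f (inv_into U \<phi> x)) (at (\<phi> p))) (at (\<phi> p))"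
  using f smooth_on_differentiable frechet_derivative_works unfolding smooth_at_chart[OF c p] by blast

end

section \<open>Coordinate vectors and slice charts\<close>

definition tanvec ::
    "('a, 'e::euclidean_space) smooth_mfd \<Rightarrow> 'a set \<Rightarrow> ('a \<Rightarrow> 'e) \<Rightarrow> 'a \<Rightarrow> 'e \<Rightarrow> 'a tvec"
  where "tanvec N U \<phi> q a = (\<lambda>f. if smooth_at N q f
    then frechet_derivative (\<lambda>x. f (inv_into U \<phi> x)) (at (\<phi> q)) a else 0)"

text \<open>Packages the local data in the definition of an immersed submanifold: \<open>W\<close>
  is a plaque, open in the topology of \<open>S\<close>, and \<open>L\<close> is the coordinate
  subspace on which the chart flattens it.\<close>

definition slice ::
    "('a, 'e::euclidean_space) smooth_mfd \<Rightarrow> 'a topology \<Rightarrow> 'a set \<Rightarrow> 'a set \<Rightarrow> ('a \<Rightarrow> 'e) \<Rightarrow> 'e set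
      \<Rightarrow> bool"
  where "slice N S W U \<phi> L \<longleftrightarrow> openin S W \<and> chart N U \<phi> \<and> W \<subseteq> U \<and>
    subtopology S W = subtopology (mtop N) W \<and> subspace L \<and> \<phi> ` W = \<phi> ` U \<inter> L"

lemma sliceD:
  assumes "slice N S W U \<phi> L"
  shows "openin S W" "chart N U \<phi>" "W \<subseteq> U" "subtopology S W = subtopology (mtop N) W"
    "subspace L" "\<phi> ` W = \<phi> ` U \<inter> L"
  using assms by (simp_all add: slice_def)

lemma immersed_submanifold_slice:
  assumes "immersed_submanifold N S n" "p \<in> topspace S"
  obtains W U \<phi> L where "slice N S W U \<phi> L" "p \<in> W" "dim L = n"
  using assms unfolding immersed_submanifold_def slice_def by metis

text \<open>On \<open>W\<close> the topology of \<open>S\<close> and the ambient one agree, which is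
  the only link between the two for an immersed submanifold.\<close>

lemma slice_openin:
  assumes s: "slice N S W U \<phi> L" and T: "openin (mtop N) T"
  shows "openin S (W \<inter> T)"
proof -
  have "openin (subtopology S W) (W \<inter> T)"
    unfolding sliceD(4)[OF s] using openin_subtopology_Int2[OF T] by metis
  then show ?thesis using openin_trans_full sliceD(1)[OF s] by blast
qed

context manifold
begin

lemma tanvec_linear: "chart N U \<phi> \<Longrightarrow> q \<in> U \<Longrightarrow>
    tanvec N U \<phi> q (r *\<^sub>R a + s *\<^sub>R b) = r *\<^sub>R tanvec N U \<phi> q a + s *\<^sub>R tanvec N U \<phi> q b"
proof (rule ext)
  fix f assume c: "chart N U \<phi>" "q \<in> U"
  show "tanvec N U \<phi> q (r *\<^sub>R a + s *\<^sub>R b) f = (r *\<^sub>R tanvec N U \<phi> q a + s *\<^sub>R tanvec N U \<phi> q b) f"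
  proof (cases "smooth_at N q f")
    case True
    interpret linear "frechet_derivative (\<lambda>x. f (inv_into U \<phi> x)) (at (\<phi> q))"
      by (rule has_derivative_linear[OF smooth_at_has_derivative[OF c True]])
    show ?thesis using True by (simp add: tanvec_def scaleR_fun_def plus_fun_def add scale)
  qed (simp add: tanvec_def scaleR_fun_def plus_fun_def)
qed

lemma tanvec_linear_map: "chart N U \<phi> \<Longrightarrow> q \<in> U \<Longrightarrow> linear (tanvec N U \<phi> q)"
  using tanvec_linear[of U \<phi> q 1 _ 1] tanvec_linear[of U \<phi> q _ _ 0]
  by (intro linearI) simp_all

text \<open>The coordinate functions read off the components of a tangent vector; hence the
  components are determined by the operator.\<close>

lemma tanvec_coordinate:
  assumes c: "chart N U \<phi>" and q: "q \<in> U"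
  shows "tanvec N U \<phi> q a (\<lambda>r. \<phi> r \<bullet> b) = a \<bullet> b"
proof -
  have "((\<lambda>x. \<phi> (inv_into U \<phi> x) \<bullet> b) has_derivative (\<lambda>x. x \<bullet> b)) (at (\<phi> q))"
  proof (rule has_derivative_transform_within_open[OF _ chart_open[OF c]])
    show "((\<lambda>x. x \<bullet> b) has_derivative (\<lambda>x. x \<bullet> b)) (at (\<phi> q))"
      by (auto intro!: derivative_eq_intros)
  qed (use c q in auto)
  from frechet_derivative_at[OF this, symmetric] show ?thesis
    using smooth_at_coordinate[OF c q]
    by (simp add: tanvec_def)
qed

lemma tanvec_inj:
  assumes c: "chart N U \<phi>" and q: "q \<in> U"
  shows "inj (tanvec N U \<phi> q)"
proof (rule injI)
  fix a b assume "tanvec N U \<phi> q a = tanvec N U \<phi> q b"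
  then have "a \<bullet> z = b \<bullet> z" for z
    using tanvec_coordinate[OF assms] by metis
  then show "a = b" by (metis vector_eq_rdot)
qed

lemma velocity_tanvec:
  assumes c: "chart N U \<phi>" and q: "q \<in> U" "\<gamma> 0 = q"
    and I: "open I" "0 \<in> I" "\<gamma> ` I \<subseteq> U"
    and d: "((\<lambda>t. \<phi> (\<gamma> t)) has_vector_derivative a) (at 0)"
  shows "velocity N \<gamma> = tanvec N U \<phi> q a"
proof (rule ext)
  fix f
  show "velocity N \<gamma> f = tanvec N U \<phi> q a f"
  proof (cases "smooth_at N q f")
    case True
    let ?D = "frechet_derivative (\<lambda>x. f (inv_into U \<phi> x)) (at (\<phi> q))"
    note D = smooth_at_has_derivative[OF c q(1) True]
    have "((\<lambda>t. f (inv_into U \<phi> (\<phi> (\<gamma> t)))) has_derivative (\<lambda>h. ?D (h *\<^sub>R a))) (at 0)"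
      using has_derivative_compose[OF d[unfolded has_vector_derivative_def], of _ ?D] D q(2) by simp
    then have "((f \<circ> \<gamma>) has_derivative (\<lambda>h. ?D (h *\<^sub>R a))) (at 0)"
      by (rule has_derivative_transform_within_open[OF _ I(1,2)]) (use I(3) c in auto)
    moreover have "(\<lambda>h. ?D (h *\<^sub>R a)) = (*) (?D a)"
      using linear_scale[OF has_derivative_linear[OF D]] by (auto simp: fun_eq_iff)
    ultimately have "((f \<circ> \<gamma>) has_field_derivative ?D a) (at 0)"
      unfolding has_field_derivative_def by simp
    then show ?thesis using True q(2) by (simp add: velocity_def tanvec_def DERIV_imp_deriv)
  qed (use q(2) in \<open>simp add: velocity_def tanvec_def\<close>)
qed

lemma curve_nbhd:
  assumes "continuous_map (top_of_set {-e<..<e::real}) S \<gamma>" "e > 0" "openin S W" "\<gamma> 0 \<in> W"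
  obtains I where "open I" "0 \<in> I" "I \<subseteq> {-e<..<e}" "\<gamma> ` I \<subseteq> W"
proof
  let ?I = "{t \<in> {-e<..<e}. \<gamma> t \<in> W}"
  have "openin (top_of_set {-e<..<e}) ?I"
    using openin_continuous_map_preimage[OF assms(1,3)] by simp
  then show "open ?I" by (simp add: openin_open_eq)
qed (use assms(2,4) in auto)

lemma slice_topspace: "slice N S W U \<phi> L \<Longrightarrow> q \<in> W \<Longrightarrow> q \<in> U \<and> q \<in> topspace S \<and> q \<in> topspace (mtop N)"
  using sliceD(1,3) chart_openin[OF sliceD(2)] openin_subset by (metis subsetD)

text \<open>Curves in \<open>S\<close> stay in \<open>L\<close> when seen in the chart, so their
  velocities lie in \<open>L\<close>; conversely a short straight segment in \<open>L\<close> is the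
  image of a curve in \<open>S\<close>. This turns the tangent space, defined through curves, into a
  linear image of \<open>L\<close>.\<close>

lemma tangent_space_slice:
  assumes s: "slice N S W U \<phi> L" and q: "q \<in> W"
  shows "tangent_space N S q = tanvec N U \<phi> q ` L"
proof
  note c = sliceD(2)[OF s]
  have qU: "q \<in> U" and qN: "q \<in> topspace (mtop N)" using slice_topspace[OF s q] by auto
  have \<phi>L: "\<phi> r \<in> L" if "r \<in> W" for r using sliceD(6)[OF s] that by blast
  show "tangent_space N S q \<subseteq> tanvec N U \<phi> q ` L"
  proof
    fix v assume "v \<in> tangent_space N S q"
    then obtain \<gamma> where v: "v = velocity N \<gamma>" and g: "smooth_curve N S q \<gamma>"
      by (auto simp: tangent_space_def)
    obtain e where e: "e > 0" "continuous_map (top_of_set {-e<..<e}) S \<gamma>" and \<gamma>0: "\<gamma> 0 = q"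
      and sm: "\<And>V \<psi>. (V, \<psi>) \<in> atlas N \<Longrightarrow> smooth_on {t \<in> {-e<..<e}. \<gamma> t \<in> V} (\<psi> \<circ> \<gamma>)"
      using g unfolding smooth_curve_def by blast
    obtain V \<psi> where V: "(V, \<psi>) \<in> atlas N" "q \<in> V" "chart N V \<psi>"
      using atlas_cover[OF qN] by blast
    obtain I where I: "open I" "0 \<in> I" "I \<subseteq> {-e<..<e}" "\<gamma> ` I \<subseteq> W \<inter> V"
      using curve_nbhd[OF e(2,1) slice_openin[OF s chart_openin[OF V(3)]]] \<gamma>0 q V(2) by blast
    have WU: "W \<subseteq> U" by (rule sliceD(3)[OF s])
    \<comment> \<open>Smoothness of the curve is given only in atlas charts, so the slice chart is
      reached through a transition map.\<close>
    have "smooth_on I (\<lambda>t. \<phi> (inv_into V \<psi> ((\<psi> \<circ> \<gamma>) t)))"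
    proof (rule smooth_on_compose[OF transition_smooth(2)[OF c V(1)] _ I(1)])
      show "smooth_on I (\<psi> \<circ> \<gamma>)" by (rule smooth_on_subset[OF sm[OF V(1)]]) (use I in auto)
      show "open (\<psi> ` (U \<inter> V))"
        by (rule chart_image[OF V(3)]) (use c V(3) chart_openin in auto)
      show "(\<psi> \<circ> \<gamma>) ` I \<subseteq> \<psi> ` (U \<inter> V)" using I(4) WU by (auto intro!: imageI)
    qed
    then have "smooth_on I (\<lambda>t. \<phi> (\<gamma> t))"
      by (rule smooth_on_cong[OF I(1)]) (use I(4) V(3) in auto)
    then have "(\<lambda>t. \<phi> (\<gamma> t)) differentiable (at 0)" using smooth_on_differentiable I(2) by blast
    then obtain a where a: "((\<lambda>t. \<phi> (\<gamma> t)) has_vector_derivative a) (at 0)"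
      using vector_derivative_works by blast
    have "v = tanvec N U \<phi> q a"
      unfolding v using velocity_tanvec[OF c qU \<gamma>0 I(1,2) _ a] I(4) WU by blast
    moreover have "a \<in> L"
    proof -
      \<comment> \<open>Here \<open>z\<close> is the component of the velocity orthogonal to
        \<open>L\<close>. Pairing the curve with \<open>z\<close> gives the constant 0, whose
        derivative is the inner product of \<open>a\<close> and \<open>z\<close>.\<close>
      obtain y z where yz: "y \<in> span L" "\<And>w. w \<in> span L \<Longrightarrow> orthogonal z w" "a = y + z"
        using orthogonal_subspace_decomp_exists by metis
      have sL: "span L = L" using sliceD(5)[OF s] by (simp add: span_eq_iff)
      have "((\<lambda>t. \<phi> (\<gamma> t) \<bullet> z) has_vector_derivative a \<bullet> z) (at 0)"
        by (rule bounded_linear.has_vector_derivative[OF bounded_linear_inner_left a])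
      moreover have "((\<lambda>t. \<phi> (\<gamma> t) \<bullet> z) has_vector_derivative 0) (at 0)"
      proof (rule has_vector_derivative_transform_within_open[OF _ I(1,2)])
        fix t assume "t \<in> I"
        then have "\<phi> (\<gamma> t) \<in> span L" unfolding sL using I(4) \<phi>L by auto
        from yz(2)[OF this] show "0 = \<phi> (\<gamma> t) \<bullet> z"
          by (simp add: orthogonal_def inner_commute)
      qed simp
      ultimately have "a \<bullet> z = 0" using vector_derivative_unique_at by blast
      then have "z = 0"
        using yz(2)[OF yz(1)] unfolding yz(3) by (simp add: inner_add_left inner_add_right orthogonal_def inner_commute)
      then show ?thesis using yz sL by simp
    qed
    ultimately show "v \<in> tanvec N U \<phi> q ` L" by blast
  qed
  show "tanvec N U \<phi> q ` L \<subseteq> tangent_space N S q"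
  proof
    fix v assume "v \<in> tanvec N U \<phi> q ` L"
    then obtain a where a: "a \<in> L" and v: "v = tanvec N U \<phi> q a" by blast
    \<comment> \<open>The witness curve is the straight line with velocity \<open>a\<close> in the
      chart, restricted to times for which it stays in the chart image.\<close>
    let ?l = "\<lambda>t::real. \<phi> q + t *\<^sub>R a"
    let ?\<gamma> = "\<lambda>t. inv_into U \<phi> (?l t)"
    have "open (?l -` \<phi> ` U)"
      by (rule open_vimage[OF chart_open[OF c]]) (auto intro!: continuous_intros)
    then obtain e where e: "e > 0" "ball 0 e \<subseteq> ?l -` \<phi> ` U"
      using qU open_contains_ball_eq[of "?l -` \<phi> ` U" 0] by auto
    have lU: "?l t \<in> \<phi> ` U" if "t \<in> {-e<..<e}" for t
      using e(2) that by (auto simp: subset_iff dist_real_def)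
    have lW: "?l t \<in> \<phi> ` W" if "t \<in> {-e<..<e}" for t
      unfolding sliceD(6)[OF s]
      using lU[OF that] \<phi>L[OF q] a sliceD(5)[OF s] by (simp add: subspace_add subspace_scale)
    have \<gamma>W: "?\<gamma> t \<in> W" and \<phi>\<gamma>: "\<phi> (?\<gamma> t) = ?l t" if "t \<in> {-e<..<e}" for t
      using lW[OF that] c sliceD(3)[OF s] by auto
    have "continuous_map (top_of_set {-e<..<e}) (top_of_set (\<phi> ` U)) ?l"
      using lU by (auto simp: continuous_map_in_subtopology intro!: continuous_intros)
    from continuous_map_compose[OF this chart_homeomorphism(3)[OF c]]
    have "continuous_map (top_of_set {-e<..<e}) (subtopology (mtop N) W) ?\<gamma>"
      using \<gamma>W by (auto simp: continuous_map_in_subtopology comp_def)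
    then have cont: "continuous_map (top_of_set {-e<..<e}) S ?\<gamma>"
      unfolding sliceD(4)[OF s, symmetric] by (simp add: continuous_map_in_subtopology)
    have "smooth_on {t \<in> {-e<..<e}. ?\<gamma> t \<in> V} (\<psi> \<circ> ?\<gamma>)" if V: "(V, \<psi>) \<in> atlas N" for V \<psi>
    proof -
      note cV = atlas_chart[OF V]
      have "openin (mtop N) (U \<inter> V)" using c cV chart_openin by blast
      from openin_continuous_map_preimage[OF cont slice_openin[OF s this]]
      have "openin (top_of_set {-e<..<e}) {t \<in> {-e<..<e}. ?\<gamma> t \<in> V}"
      proof (rule back_subst[of "openin (top_of_set {-e<..<e})"])
        show "{t \<in> topspace (top_of_set {-e<..<e}). ?\<gamma> t \<in> W \<inter> (U \<inter> V)} = {t \<in> {-e<..<e}. ?\<gamma> t \<in> V}"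
          using \<gamma>W sliceD(3)[OF s] by auto
      qed
      then have o: "open {t \<in> {-e<..<e}. ?\<gamma> t \<in> V}" by (simp add: openin_open_eq)
      have "smooth_on {t \<in> {-e<..<e}. ?\<gamma> t \<in> V} (\<lambda>t. \<psi> (inv_into U \<phi> (?l t)))"
      proof (rule smooth_on_compose[OF transition_smooth(1)[OF c V] _ o])
        show "smooth_on {t \<in> {-e<..<e}. ?\<gamma> t \<in> V} ?l"
          by (intro smooth_on_add smooth_on_bounded_linear_compose[OF bounded_linear_scaleR_left]
              smooth_on_const smooth_on_ident o)
        show "open (\<phi> ` (U \<inter> V))"
          by (rule chart_image[OF c]) (use c cV chart_openin in auto)
        show "?l ` {t \<in> {-e<..<e}. ?\<gamma> t \<in> V} \<subseteq> \<phi> ` (U \<inter> V)"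
        proof (clarsimp simp del: greaterThanLessThan_iff)
          fix t assume t: "t \<in> {-e<..<e}" "?\<gamma> t \<in> V"
          then have "?\<gamma> t \<in> U \<inter> V" using \<gamma>W sliceD(3)[OF s] by blast
          then show "?l t \<in> \<phi> ` (U \<inter> V)" using \<phi>\<gamma>[OF t(1)] by (metis image_eqI)
        qed
      qed
      then show ?thesis by (simp add: comp_def)
    qed
    then have "smooth_curve N S q ?\<gamma>"
      unfolding smooth_curve_def using e(1) cont c qU by auto
    moreover have "velocity N ?\<gamma> = tanvec N U \<phi> q a"
    proof (rule velocity_tanvec[OF c qU])
      show "((\<lambda>t. \<phi> (?\<gamma> t)) has_vector_derivative a) (at 0)"
      proof (rule has_vector_derivative_transform_within_open)
        show "(?l has_vector_derivative a) (at 0)"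
          by (auto intro!: derivative_eq_intros)
      qed (use e(1) \<phi>\<gamma> in \<open>auto intro!: open_greaterThanLessThan[of "-e" e]\<close>)
      show "?\<gamma> ` {-e<..<e} \<subseteq> U" using \<gamma>W sliceD(3)[OF s] by blast
    qed (use e(1) qU c in auto)
    ultimately show "v \<in> tangent_space N S q"
      unfolding v tangent_space_def by force
  qed
qed

end

section \<open>Functions and vector fields on a submanifold\<close>

lemma scaleR_fun_apply [simp]: "(r *\<^sub>R f) x = r *\<^sub>R f x"
  by (simp add: scaleR_fun_def)

text \<open>Functions and fields are handled as germs through the filter \<open>nhdsin\<close>. An
  identity of germs at p is also one at every nearby point, which is what allows it to be
  differentiated again.\<close>

lemma eventually_nhdsin_open:
  "eventually P (nhdsin S p) \<Longrightarrow> eventually (\<lambda>q. eventually P (nhdsin S q)) (nhdsin S p)"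
  unfolding eventually_nhdsin by blast

lemma agree_near_eventually:
  "p \<in> topspace S \<Longrightarrow> agree_near S p f h \<longleftrightarrow> eventually (\<lambda>q. f q = h q) (nhdsin S p)"
  unfolding agree_near_def eventually_nhdsin by blast

lemma eventually_nhdsin_self: "eventually P (nhdsin S p) \<Longrightarrow> p \<in> topspace S \<Longrightarrow> P p"
  unfolding eventually_nhdsin by blast

lemma eventually_nhdsin_topspace: "eventually (\<lambda>q. q \<in> topspace S) (nhdsin S p)"
  unfolding eventually_nhdsin by (metis openin_topspace)

lemma agree_near_topspace: "agree_near S p f h \<Longrightarrow> p \<in> topspace S"
  unfolding agree_near_def using openin_subset by blast

lemma smooth_fun_at_topspace: "smooth_fun_at N S p f \<Longrightarrow> p \<in> topspace S"
  unfolding smooth_fun_at_def using agree_near_topspace by metis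

lemma vfield_at_topspace: "vfield_at N S p X \<Longrightarrow> p \<in> topspace S"
  unfolding vfield_at_def using openin_subset by blast

lemma vfield_at_eventually:
  "p \<in> topspace S \<Longrightarrow> vfield_at N S p X \<longleftrightarrow>
    eventually (\<lambda>q. X q \<in> tangent_space N S q \<and>
      (\<forall>F. smooth_at N q F \<longrightarrow> smooth_fun_at N S q (\<lambda>r. X r F))) (nhdsin S p)"
  unfolding vfield_at_def eventually_nhdsin by blast

lemma vfield_at_nbhd:
  assumes "vfield_at N S p X"
  shows "eventually (\<lambda>q. vfield_at N S q X) (nhdsin S p)"
proof -
  obtain W where W: "openin S W" "p \<in> W" "\<forall>q\<in>W. X q \<in> tangent_space N S q \<and>
      (\<forall>F. smooth_at N q F \<longrightarrow> smooth_fun_at N S q (\<lambda>r. X r F))"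
    using assms unfolding vfield_at_def by blast
  then have "\<forall>q\<in>W. vfield_at N S q X" unfolding vfield_at_def by blast
  then show ?thesis unfolding eventually_nhdsin using W by blast
qed

lemma vfield_at_tangent: "vfield_at N S p X \<Longrightarrow> X p \<in> tangent_space N S p"
  and vfield_at_smooth: "vfield_at N S p X \<Longrightarrow> smooth_at N p F \<Longrightarrow> smooth_fun_at N S p (\<lambda>r. X r F)"
  unfolding vfield_at_def by blast+

locale submanifold = manifold N for N :: "('a, 'e::euclidean_space) smooth_mfd" +
  fixes S :: "'a topology" and n :: nat
  assumes immersed: "immersed_submanifold N S n"

lemma (in manifold) ambient_slice:
  assumes "chart N U \<phi>"
  shows "slice N (mtop N) U U \<phi> UNIV"
  using assms by (auto simp: slice_def dest: chart_openin)

text \<open>Chart domains are slices of themselves, with L the whole coordinate space. Every fact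
  proved for a submanifold thus becomes one about the ambient manifold, available under the prefix
  \<open>amb\<close>.\<close>

lemma (in manifold) immersed_ambient: "immersed_submanifold N (mtop N) (DIM('e))"
  unfolding immersed_submanifold_def
proof (intro conjI ballI)
  show "second_countable (mtop N)" using smooth_manifold by (simp add: smooth_manifold_def)
  fix p assume "p \<in> topspace (mtop N)"
  then obtain V \<psi> where "(V, \<psi>) \<in> atlas N" "p \<in> V" and c: "chart N V \<psi>"
    using atlas_cover by blast
  then show "\<exists>W U \<phi> L. openin (mtop N) W \<and> p \<in> W \<and> chart N U \<phi> \<and> W \<subseteq> U \<and>
       subtopology (mtop N) W = subtopology (mtop N) W \<and>
       subspace L \<and> dim L = DIM('e) \<and> \<phi> ` W = \<phi> ` U \<inter> L"
    using chart_openin[OF c] by (intro exI[of _ V] exI[of _ \<psi>] exI[of _ UNIV]) auto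
qed simp

sublocale manifold \<subseteq> amb: submanifold N "mtop N" "DIM('e)"
  by unfold_locales (rule immersed_ambient)

lemma (in manifold) tangent_tanvec:
  assumes "chart N U \<phi>" "p \<in> U"
  shows "tangent_space N (mtop N) p = range (tanvec N U \<phi> p)"
  using tangent_space_slice[OF ambient_slice] assms by blast

context manifold
begin

lemma tangent_apply:
  assumes "v \<in> tangent_space N (mtop N) p"
  shows tangent_add: "smooth_at N p f \<Longrightarrow> smooth_at N p h \<Longrightarrow> v (\<lambda>q. f q + h q) = v f + v h"
    and tangent_mult: "smooth_at N p f \<Longrightarrow> smooth_at N p h \<Longrightarrow>
      v (\<lambda>q. f q * h q) = v f * h p + f p * v h"
    and tangent_const: "v (\<lambda>q. k) = 0"
    and tangent_nonsmooth: "\<not> smooth_at N p f \<Longrightarrow> v f = 0"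
proof -
  obtain \<gamma> where g: "smooth_curve N (mtop N) p \<gamma>" and v: "v = velocity N \<gamma>"
    using assms by (auto simp: tangent_space_def)
  obtain e where "\<gamma> 0 = p" "e > 0" "continuous_map (top_of_set {-e<..<e::real}) (mtop N) \<gamma>"
    using g unfolding smooth_curve_def by blast
  then have p: "p \<in> topspace (mtop N)"
    using continuous_map_image_subset_topspace[of "top_of_set {-e<..<e}" "mtop N" \<gamma>] by force
  obtain U \<phi> where c: "chart N U \<phi>" "p \<in> U" using atlas_cover[OF p] by metis
  obtain a where a: "v = tanvec N U \<phi> p a" using assms tangent_tanvec[OF c] by blast
  note D = smooth_at_has_derivative[OF c]
  show "v (\<lambda>q. f q + h q) = v f + v h" if "smooth_at N p f" "smooth_at N p h"
    using frechet_derivative_at[OF has_derivative_add[OF D[OF that(1)] D[OF that(2)]], symmetric]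
      that smooth_at_add[OF that] by (simp add: a tanvec_def)
  show "v (\<lambda>q. f q * h q) = v f * h p + f p * v h" if "smooth_at N p f" "smooth_at N p h"
    using frechet_derivative_at[OF has_derivative_mult[OF D[OF that(1)] D[OF that(2)]], symmetric]
      that smooth_at_mult[OF that] c by (simp add: a tanvec_def)
  show "v (\<lambda>q. k) = 0" by (simp add: a tanvec_def)
  show "v f = 0" if "\<not> smooth_at N p f" using that by (simp add: a tanvec_def)
qed

lemma smooth_at_eventually: "smooth_at N p f \<Longrightarrow> eventually (\<lambda>q. smooth_at N q f) (nhdsin (mtop N) p)"
  unfolding eventually_nhdsin using smooth_at_nbhd by metis

end

context submanifold
begin

abbreviation T :: "'a \<Rightarrow> 'a tvec set" where "T \<equiv> tangent_space N S"

lemma topspace_subset: "topspace S \<subseteq> topspace (mtop N)"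
  using immersed by (simp add: immersed_submanifold_def)

text \<open>The topology of \<open>S\<close> is at least as fine as the ambient one, so ambient
  germs restrict to \<open>S\<close>.\<close>

lemma nhdsin_ambient:
  assumes "eventually P (nhdsin (mtop N) p)"
  shows "eventually P (nhdsin S p)"
proof (cases "p \<in> topspace S")
  case True
  then obtain G where G: "openin (mtop N) G" "p \<in> G" "\<forall>q\<in>G. P q"
    using assms topspace_subset unfolding eventually_nhdsin by blast
  obtain W U \<phi> L where W: "slice N S W U \<phi> L" "p \<in> W"
    using immersed_submanifold_slice[OF immersed True] by metis
  show ?thesis unfolding eventually_nhdsin using slice_openin[OF W(1) G(1)] W(2) G by blast
qed (simp add: eventually_nhdsin)

lemma tangent_subset: "T p \<subseteq> tangent_space N (mtop N) p"
proof (cases "p \<in> topspace S")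
  case True
  then obtain W U \<phi> L where s: "slice N S W U \<phi> L" "p \<in> W"
    using immersed_submanifold_slice[OF immersed True] by metis
  show ?thesis unfolding tangent_space_slice[OF s]
    using tangent_tanvec[OF sliceD(2)[OF s(1)]] slice_topspace[OF s] by blast
next
  case False
  have "\<gamma> 0 \<in> topspace S" if "smooth_curve N S p \<gamma>" for \<gamma>
    using that continuous_map_image_subset_topspace[of "top_of_set {-e<..<e}" S \<gamma> for e]
    unfolding smooth_curve_def by force
  then show ?thesis using False by (auto simp: tangent_space_def smooth_curve_def)
qed

lemma tangent_space_basis:
  assumes "p \<in> topspace S"
  obtains B where "finite B" "card B = n" "independent B" "span B = T p"
proof -
  obtain W U \<phi> L where s: "slice N S W U \<phi> L" "p \<in> W" and d: "dim L = n"
    using immersed_submanifold_slice[OF immersed assms] by metis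
  obtain B where B: "B \<subseteq> L" "independent B" "L \<subseteq> span B" "card B = n"
    using basis_exists[of L] d by metis
  have L: "span B = L"
    using B sliceD(5)[OF s(1)] by (meson span_minimal subset_antisym)
  have c: "chart N U \<phi>" "p \<in> U" using slice_topspace[OF s] sliceD(2)[OF s(1)] by auto
  note l = tanvec_linear_map[OF c] and i = tanvec_inj[OF c]
  show thesis
  proof
    show "finite (tanvec N U \<phi> p ` B)" using independent_imp_finite[OF B(2)] by simp
    show "card (tanvec N U \<phi> p ` B) = n" using card_image[of "tanvec N U \<phi> p" B] i B(4)
      by (metis inj_on_subset subset_UNIV)
    show "independent (tanvec N U \<phi> p ` B)"
      by (rule linear_independent_injective_image[OF l B(2)]) (metis i inj_on_subset subset_UNIV)
    show "span (tanvec N U \<phi> p ` B) = T p"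
      unfolding linear_span_image[OF l] L tangent_space_slice[OF s] ..
  qed
qed

lemma subspace_tangent: "p \<in> topspace S \<Longrightarrow> subspace (T p)"
  by (metis tangent_space_basis subspace_span)

text \<open>A vector tangent to \<open>S\<close> is the velocity of a curve inside \<open>S\<close>,
  along which the two functions coincide for small times.\<close>

lemma tangent_agree:
  assumes v: "v \<in> T p" and f: "smooth_at N p f" "smooth_at N p h" "agree_near S p f h"
  shows "v f = v h"
proof -
  obtain \<gamma> where g: "smooth_curve N S p \<gamma>" and v: "v = velocity N \<gamma>"
    using v by (auto simp: tangent_space_def)
  obtain e where e: "\<gamma> 0 = p" "e > 0" "continuous_map (top_of_set {-e<..<e::real}) S \<gamma>"
    using g unfolding smooth_curve_def by blast
  obtain W where W: "openin S W" "p \<in> W" "\<forall>q\<in>W. f q = h q"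
    using f(3) unfolding agree_near_def by blast
  obtain I where I: "open I" "0 \<in> I" "\<gamma> ` I \<subseteq> W"
    using curve_nbhd[OF e(3,2) W(1)] e(1) W(2) by metis
  have "eventually (\<lambda>t. (f \<circ> \<gamma>) t = (h \<circ> \<gamma>) t) (nhds 0)"
    unfolding eventually_nhds using I W(3) by (metis comp_apply image_subset_iff)
  then have "deriv (f \<circ> \<gamma>) 0 = deriv (h \<circ> \<gamma>) 0" by (rule deriv_cong_ev) simp
  then show ?thesis using f e(1) by (simp add: v velocity_def)
qed

lemma smooth_fun_atI:
  assumes "p \<in> topspace S" "smooth_at N p F" "eventually (\<lambda>q. f q = F q) (nhdsin S p)"
  shows "smooth_fun_at N S p f"
  unfolding smooth_fun_at_def agree_near_eventually[OF assms(1)] using assms by metis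

lemma smooth_fun_atE:
  assumes "smooth_fun_at N S p f"
  obtains F where "smooth_at N p F" "eventually (\<lambda>q. f q = F q) (nhdsin S p)"
  using assms unfolding smooth_fun_at_def agree_near_eventually[OF smooth_fun_at_topspace[OF assms]]
  by metis

lemma smooth_fun_at_restrict: "p \<in> topspace S \<Longrightarrow> smooth_at N p F \<Longrightarrow> smooth_fun_at N S p F"
  by (rule smooth_fun_atI) auto

lemma smooth_fun_at_cong:
  assumes "smooth_fun_at N S p f" "eventually (\<lambda>q. f q = h q) (nhdsin S p)"
  shows "smooth_fun_at N S p h"
proof -
  obtain F where F: "smooth_at N p F" "eventually (\<lambda>q. f q = F q) (nhdsin S p)"
    by (rule smooth_fun_atE[OF assms(1)])
  show ?thesis
    by (rule smooth_fun_atI[OF smooth_fun_at_topspace[OF assms(1)] F(1)])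
      (use F(2) assms(2) in eventually_elim, simp)
qed

lemma smooth_fun_at_nbhd:
  assumes "smooth_fun_at N S p f"
  shows "eventually (\<lambda>q. smooth_fun_at N S q f) (nhdsin S p)"
proof -
  obtain F where F: "smooth_at N p F" "eventually (\<lambda>q. f q = F q) (nhdsin S p)"
    by (rule smooth_fun_atE[OF assms(1)])
  show ?thesis
    using nhdsin_ambient[OF smooth_at_eventually[OF F(1)]] eventually_nhdsin_open[OF F(2)]
      eventually_nhdsin_topspace
    by eventually_elim (rule smooth_fun_atI)
qed

text \<open>Removes the choice in \<open>dir_deriv\<close>: any smooth local extension computes the
  derivative.\<close>

lemma dir_deriv_eq:
  assumes "v \<in> T p" "smooth_at N p F" "eventually (\<lambda>q. f q = F q) (nhdsin S p)" "p \<in> topspace S"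
  shows "dir_deriv N S p v f = v F"
proof -
  let ?G = "SOME F. smooth_at N p F \<and> agree_near S p f F"
  have G: "smooth_at N p ?G \<and> agree_near S p f ?G"
    by (rule someI[of _ F]) (use assms agree_near_eventually[OF assms(4)] in auto)
  have "agree_near S p ?G F"
    using G assms(3) unfolding agree_near_eventually[OF assms(4)]
    by (auto elim: eventually_elim2)
  then show ?thesis
    unfolding dir_deriv_def using tangent_agree[OF assms(1) _ assms(2)] G by blast
qed

lemma smooth_fun_at_ops:
  assumes f: "smooth_fun_at N S p f" and h: "smooth_fun_at N S p h" and v: "v \<in> T p"
  shows smooth_fun_at_add': "smooth_fun_at N S p (\<lambda>q. f q + h q)"
    and dir_deriv_add: "dir_deriv N S p v (\<lambda>q. f q + h q) = dir_deriv N S p v f + dir_deriv N S p v h"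
    and smooth_fun_at_mult': "smooth_fun_at N S p (\<lambda>q. f q * h q)"
    and dir_deriv_mult: "dir_deriv N S p v (\<lambda>q. f q * h q)
      = dir_deriv N S p v f * h p + f p * dir_deriv N S p v h"
proof -
  note p = smooth_fun_at_topspace[OF f]
  obtain F where F: "smooth_at N p F" "eventually (\<lambda>q. f q = F q) (nhdsin S p)"
    by (rule smooth_fun_atE[OF f])
  obtain H where H: "smooth_at N p H" "eventually (\<lambda>q. h q = H q) (nhdsin S p)"
    by (rule smooth_fun_atE[OF h])
  have v': "v \<in> tangent_space N (mtop N) p" using v tangent_subset by blast
  have a: "eventually (\<lambda>q. f q + h q = F q + H q) (nhdsin S p)"
    and m: "eventually (\<lambda>q. f q * h q = F q * H q) (nhdsin S p)"
    using F(2) H(2) by (eventually_elim, simp)+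
  show "smooth_fun_at N S p (\<lambda>q. f q + h q)"
    by (rule smooth_fun_atI[OF p smooth_at_add[OF F(1) H(1)] a])
  show "smooth_fun_at N S p (\<lambda>q. f q * h q)"
    by (rule smooth_fun_atI[OF p smooth_at_mult[OF F(1) H(1)] m])
  note df = dir_deriv_eq[OF v F p] and dh = dir_deriv_eq[OF v H p]
  show "dir_deriv N S p v (\<lambda>q. f q + h q) = dir_deriv N S p v f + dir_deriv N S p v h"
    unfolding df dh dir_deriv_eq[OF v smooth_at_add[OF F(1) H(1)] a p]
    by (rule tangent_add[OF v' F(1) H(1)])
  show "dir_deriv N S p v (\<lambda>q. f q * h q)
      = dir_deriv N S p v f * h p + f p * dir_deriv N S p v h"
    unfolding df dh dir_deriv_eq[OF v smooth_at_mult[OF F(1) H(1)] m p]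
      eventually_nhdsin_self[OF F(2) p] eventually_nhdsin_self[OF H(2) p]
    by (rule tangent_mult[OF v' F(1) H(1)])
qed

lemma zero_tangent: "p \<in> topspace S \<Longrightarrow> 0 \<in> T p"
  by (rule subspace_0[OF subspace_tangent])

lemma smooth_fun_at_add:
    "smooth_fun_at N S p f \<Longrightarrow> smooth_fun_at N S p h \<Longrightarrow> smooth_fun_at N S p (\<lambda>q. f q + h q)"
  and smooth_fun_at_mult:
    "smooth_fun_at N S p f \<Longrightarrow> smooth_fun_at N S p h \<Longrightarrow> smooth_fun_at N S p (\<lambda>q. f q * h q)"
  using smooth_fun_at_ops(1,3)[OF _ _ zero_tangent] smooth_fun_at_topspace by metis+

lemma smooth_fun_at_const: "p \<in> topspace S \<Longrightarrow> smooth_fun_at N S p (\<lambda>q. k)"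
  using smooth_fun_at_restrict smooth_at_const topspace_subset by blast

lemma smooth_fun_at_inverse:
  assumes "smooth_fun_at N S p f" "f p \<noteq> 0"
  shows "smooth_fun_at N S p (\<lambda>q. inverse (f q))"
proof -
  note p = smooth_fun_at_topspace[OF assms(1)]
  obtain F where F: "smooth_at N p F" "eventually (\<lambda>q. f q = F q) (nhdsin S p)"
    by (rule smooth_fun_atE[OF assms(1)])
  have "F p \<noteq> 0" using assms(2) eventually_nhdsin_self[OF F(2) p] by simp
  then show ?thesis
    by (intro smooth_fun_atI[OF p smooth_at_inverse[OF F(1)]])
      (use F(2) in \<open>auto elim: eventually_mono\<close>)
qed

lemma dir_deriv_const: "v \<in> T p \<Longrightarrow> p \<in> topspace S \<Longrightarrow> dir_deriv N S p v (\<lambda>q. k) = 0"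
  using dir_deriv_eq[of v p "\<lambda>q. k"] tangent_const tangent_subset smooth_at_const topspace_subset
  by fastforce

lemma dir_deriv_cong:
  assumes "v \<in> T p" "smooth_fun_at N S p f" "eventually (\<lambda>q. f q = h q) (nhdsin S p)"
  shows "dir_deriv N S p v f = dir_deriv N S p v h"
proof -
  note p = smooth_fun_at_topspace[OF assms(2)]
  obtain F where F: "smooth_at N p F" "eventually (\<lambda>q. f q = F q) (nhdsin S p)"
    by (rule smooth_fun_atE[OF assms(2)])
  have "eventually (\<lambda>q. h q = F q) (nhdsin S p)"
    using F(2) assms(3) by eventually_elim simp
  then show ?thesis using dir_deriv_eq[OF assms(1) F p] dir_deriv_eq[OF assms(1) F(1) _ p] by simp
qed

lemma dir_deriv_linear:
  assumes "u \<in> T p" "v \<in> T p" "smooth_fun_at N S p f"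
  shows "dir_deriv N S p (a *\<^sub>R u + b *\<^sub>R v) f = a * dir_deriv N S p u f + b * dir_deriv N S p v f"
proof -
  note p = smooth_fun_at_topspace[OF assms(3)]
  obtain F where F: "smooth_at N p F" "eventually (\<lambda>q. f q = F q) (nhdsin S p)"
    by (rule smooth_fun_atE[OF assms(3)])
  have "a *\<^sub>R u + b *\<^sub>R v \<in> T p"
    using subspace_tangent[OF p] assms by (simp add: subspace_add subspace_scale)
  from dir_deriv_eq[OF this F p] show ?thesis
    using assms(1,2)[THEN dir_deriv_eq[OF _ F p]] by simp
qed

lemma vfield_at_cong:
  assumes "vfield_at N S p X" "eventually (\<lambda>q. X q = Y q) (nhdsin S p)"
  shows "vfield_at N S p Y"
  unfolding vfield_at_eventually[OF vfield_at_topspace[OF assms(1)]]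
  using vfield_at_nbhd[OF assms(1)] eventually_nhdsin_open[OF assms(2)] eventually_nhdsin_topspace
proof eventually_elim
  case (elim q)
  show ?case
  proof (intro conjI allI impI)
    show "Y q \<in> T q"
      using vfield_at_tangent[OF elim(1)] eventually_nhdsin_self[OF elim(2,3)] by simp
    show "smooth_fun_at N S q (\<lambda>r. Y r F)" if "smooth_at N q F" for F
      by (rule smooth_fun_at_cong[OF vfield_at_smooth[OF elim(1) that]])
        (use elim(2) in \<open>auto elim: eventually_mono\<close>)
  qed
qed

lemma vfield_at_add:
  assumes "vfield_at N S p X" "vfield_at N S p Y"
  shows "vfield_at N S p (X + Y)"
  unfolding vfield_at_eventually[OF vfield_at_topspace[OF assms(1)]]
  using vfield_at_nbhd[OF assms(1)] vfield_at_nbhd[OF assms(2)] eventually_nhdsin_topspace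
proof eventually_elim
  case (elim q)
  then show ?case
    by (auto intro!: smooth_fun_at_add subspace_add[OF subspace_tangent]
        dest: vfield_at_tangent intro: vfield_at_smooth)
qed

lemma vfield_at_scale:
  assumes "smooth_fun_at N S p f" "vfield_at N S p X"
  shows "vfield_at N S p (\<lambda>q. f q *\<^sub>R X q)"
  unfolding vfield_at_eventually[OF vfield_at_topspace[OF assms(2)]]
  using vfield_at_nbhd[OF assms(2)] smooth_fun_at_nbhd[OF assms(1)] eventually_nhdsin_topspace
proof eventually_elim
  case (elim q)
  then show ?case
    by (auto intro!: smooth_fun_at_mult subspace_scale[OF subspace_tangent]
        dest: vfield_at_tangent intro: vfield_at_smooth)
qed

lemma vfield_at_cmult: "vfield_at N S p X \<Longrightarrow> vfield_at N S p (\<lambda>q. k *\<^sub>R X q)"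
  by (rule vfield_at_scale[OF smooth_fun_at_const]) (auto dest: vfield_at_topspace)

lemma vfield_at_diff:
  assumes "vfield_at N S p X" "vfield_at N S p Y"
  shows "vfield_at N S p (X - Y)"
proof -
  have "X - Y = X + (\<lambda>q. (-1) *\<^sub>R Y q)" by (auto simp: fun_eq_iff)
  then show ?thesis using vfield_at_add[OF assms(1) vfield_at_cmult[OF assms(2)]] by metis
qed

lemma vfield_at_zero: "p \<in> topspace S \<Longrightarrow> vfield_at N S p (\<lambda>q. 0)"
  unfolding vfield_at_eventually
  by (rule eventually_mono[OF eventually_nhdsin_topspace])
    (auto intro: zero_tangent smooth_fun_at_const)

lemma vfield_at_sum:
  "p \<in> topspace S \<Longrightarrow> (\<And>i. i \<in> I \<Longrightarrow> vfield_at N S p (X i)) \<Longrightarrow>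
    vfield_at N S p (\<lambda>q. \<Sum>i\<in>I. X i q)"
proof (induction I rule: infinite_finite_induct)
  case (insert i I)
  have "vfield_at N S p (X i + (\<lambda>q. \<Sum>i\<in>I. X i q))" by (rule vfield_at_add) (use insert in auto)
  then show ?case using insert.hyps by (simp add: plus_fun_def cong del: sum.cong)
qed (simp_all add: vfield_at_zero)

text \<open>Applied to \<open>F\<close>, the coordinate field is a directional derivative of
  \<open>F\<close> in the chart. The default value 0 of \<open>tanvec\<close> does not interfere,
  because \<open>F\<close> is smooth at all nearby points as well.\<close>

lemma vfield_at_tanvec:
  assumes s: "slice N S W U \<phi> L" and p: "p \<in> W" and a: "a \<in> L"
  shows "vfield_at N S p (\<lambda>q. tanvec N U \<phi> q a)"
  unfolding vfield_at_def
proof (intro exI[of _ W] conjI ballI allI impI)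
  show "openin S W" by (rule sliceD(1)[OF s])
  fix q assume q: "q \<in> W"
  note c = sliceD(2)[OF s]
  have qU: "q \<in> U" "q \<in> topspace S" using slice_topspace[OF s q] by auto
  show "tanvec N U \<phi> q a \<in> T q" unfolding tangent_space_slice[OF s q] using a by blast
  fix F assume F: "smooth_at N q F"
  show "smooth_fun_at N S q (\<lambda>r. tanvec N U \<phi> r a F)"
    by (rule smooth_fun_atI[OF qU(2) smooth_at_chart_derivative[OF c qU(1) F, of a]])
      (use nhdsin_ambient[OF smooth_at_eventually[OF F]] in \<open>auto simp: tanvec_def elim: eventually_mono\<close>)
qed (fact p)

end

section \<open>Coordinate frames, extension of fields, tensoriality\<close>

context submanifold
begin

text \<open>\<open>E\<close> is a coordinate frame and \<open>\<kappa> b\<close> the coordinate function belonging to \<open>E b\<close>.\<close>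

lemma coordinate_frame:
  assumes p: "p \<in> topspace S"
  obtains B :: "'e set" and E :: "'e \<Rightarrow> 'a vfield" and \<kappa> :: "'e \<Rightarrow> 'a \<Rightarrow> real"
  where "finite B" "\<And>b. b \<in> B \<Longrightarrow> vfield_at N S p (E b)"
    "\<And>b. b \<in> B \<Longrightarrow> vfield_at N (mtop N) p (E b)" "\<And>b. b \<in> B \<Longrightarrow> smooth_at N p (\<kappa> b)"
    "eventually (\<lambda>q. \<forall>v \<in> T q. v = (\<Sum>b\<in>B. v (\<kappa> b) *\<^sub>R E b q)) (nhdsin S p)"
    "eventually (\<lambda>q. \<forall>b\<in>B. \<forall>b'\<in>B. E b q (\<kappa> b') = (if b = b' then 1 else 0)) (nhdsin S p)"
proof -
  obtain W U \<phi> L where s: "slice N S W U \<phi> L" "p \<in> W"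
    using immersed_submanifold_slice[OF immersed p] by metis
  note c = sliceD(2)[OF s(1)] and WU = sliceD(3)[OF s(1)]
  obtain B where B: "B \<subseteq> L" "pairwise orthogonal B" "\<And>x. x \<in> B \<Longrightarrow> norm x = 1"
      "independent B" "span B = L"
    using orthonormal_basis_subspace[OF sliceD(5)[OF s(1)]] by metis
  have fB: "finite B" using B(4) independent_imp_finite by blast
  have evW: "eventually (\<lambda>q. q \<in> W) (nhdsin S p)"
    unfolding eventually_nhdsin using s(2) sliceD(1)[OF s(1)] by blast
  show thesis
  proof (rule that[of B "\<lambda>b q. tanvec N U \<phi> q b" "\<lambda>b q. \<phi> q \<bullet> b"])
    fix b assume b: "b \<in> B"
    show "vfield_at N S p (\<lambda>q. tanvec N U \<phi> q b)"
      by (rule vfield_at_tanvec[OF s]) (use b B in blast)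
    show "vfield_at N (mtop N) p (\<lambda>q. tanvec N U \<phi> q b)"
      by (rule amb.vfield_at_tanvec[OF ambient_slice[OF c]]) (use s(2) WU in auto)
    show "smooth_at N p (\<lambda>q. \<phi> q \<bullet> b)"
      by (rule smooth_at_coordinate[OF c]) (use s(2) WU in auto)
  next
    show "\<forall>\<^sub>F q in nhdsin S p. \<forall>v\<in>T q. v = (\<Sum>b\<in>B. v (\<lambda>q. \<phi> q \<bullet> b) *\<^sub>R tanvec N U \<phi> q b)"
      using evW
    proof (eventually_elim, intro ballI)
      fix q v assume q: "q \<in> W" and "v \<in> T q"
      then obtain a where a: "a \<in> L" "v = tanvec N U \<phi> q a"
        unfolding tangent_space_slice[OF s(1) q] by blast
      have cq: "chart N U \<phi>" "q \<in> U" using c q WU by auto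
      interpret l: linear "tanvec N U \<phi> q" by (rule tanvec_linear_map[OF cq])
      have "a = (\<Sum>b\<in>B. (a \<bullet> b) *\<^sub>R b)"
        using orthonormal_basis_expand[OF B(2,3) _ fB, of a] a(1) B(5) by simp
      then have "v = (\<Sum>b\<in>B. (a \<bullet> b) *\<^sub>R tanvec N U \<phi> q b)"
        unfolding a(2) using l.sum[of "\<lambda>b. (a \<bullet> b) *\<^sub>R b" B] l.scale by simp
      moreover have "v (\<lambda>q. \<phi> q \<bullet> b) = a \<bullet> b" for b
        unfolding a(2) by (rule tanvec_coordinate[OF cq])
      ultimately show "v = (\<Sum>b\<in>B. v (\<lambda>q. \<phi> q \<bullet> b) *\<^sub>R tanvec N U \<phi> q b)" by simp
    qed
    show "\<forall>\<^sub>F q in nhdsin S p. \<forall>b\<in>B. \<forall>b'\<in>B.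
        tanvec N U \<phi> q b (\<lambda>q. \<phi> q \<bullet> b') = (if b = b' then 1 else 0)"
      using evW
    proof (eventually_elim, intro ballI)
      fix q b b' assume q: "q \<in> W" and b: "b \<in> B" "b' \<in> B"
      have "tanvec N U \<phi> q b (\<lambda>q. \<phi> q \<bullet> b') = b \<bullet> b'"
        by (rule tanvec_coordinate[OF c]) (use q WU in auto)
      also have "\<dots> = (if b = b' then 1 else 0)"
        using B(2) B(3)[OF b(2)] b unfolding norm_eq_1 by (auto simp: pairwise_def orthogonal_def)
      finally show "tanvec N U \<phi> q b (\<lambda>q. \<phi> q \<bullet> b') = (if b = b' then 1 else 0)" .
    qed
  qed (fact fB)
qed

lemma local_ext:
  assumes p: "p \<in> topspace S" and v: "v \<in> T p"
  shows "vfield_at N S p (local_ext N S p v)" "local_ext N S p v p = v"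
proof -
  obtain W U \<phi> L where s: "slice N S W U \<phi> L" "p \<in> W"
    using immersed_submanifold_slice[OF immersed p] by metis
  obtain a where a: "a \<in> L" "v = tanvec N U \<phi> p a" using v tangent_space_slice[OF s] by blast
  have "\<exists>X. vfield_at N S p X \<and> X p = v"
    using vfield_at_tanvec[OF s a(1)] a(2) by blast
  from someI_ex[OF this]
  show "vfield_at N S p (local_ext N S p v)" "local_ext N S p v p = v"
    unfolding local_ext_def by auto
qed

text \<open>Near p the field is a combination of coordinate fields, which are also ambient fields.
  Extending its finitely many coefficient functions extends the field.\<close>

lemma ambient_ext:
  assumes X: "vfield_at N S p X"
  shows "vfield_at N (mtop N) p (ambient_ext N S p X)"
    and "eventually (\<lambda>q. X q = ambient_ext N S p X q) (nhdsin S p)"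
proof -
  note p = vfield_at_topspace[OF X]
  obtain B :: "'e set" and E \<kappa> where fB: "finite B"
    and E: "\<And>b. b \<in> B \<Longrightarrow> vfield_at N (mtop N) p (E b)" and \<kappa>: "\<And>b. b \<in> B \<Longrightarrow> smooth_at N p (\<kappa> b)"
    and ex: "eventually (\<lambda>q. \<forall>v \<in> T q. v = (\<Sum>b\<in>B. v (\<kappa> b) *\<^sub>R E b q)) (nhdsin S p)"
    by (rule coordinate_frame[OF p]) (rule that)
  have "\<exists>F. smooth_at N p F \<and> eventually (\<lambda>q. X q (\<kappa> b) = F q) (nhdsin S p)" if "b \<in> B" for b
    by (rule smooth_fun_atE[OF vfield_at_smooth[OF X \<kappa>[OF that]]]) blast
  then obtain F where F: "\<And>b. b \<in> B \<Longrightarrow> smooth_at N p (F b)"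
      "\<And>b. b \<in> B \<Longrightarrow> eventually (\<lambda>q. X q (\<kappa> b) = F b q) (nhdsin S p)" by metis
  have pN: "p \<in> topspace (mtop N)" using p topspace_subset by blast
  have "vfield_at N (mtop N) p (\<lambda>q. \<Sum>b\<in>B. F b q *\<^sub>R E b q)"
    by (intro amb.vfield_at_sum amb.vfield_at_scale amb.smooth_fun_at_restrict F E pN)
  moreover have "eventually (\<lambda>q. X q = (\<Sum>b\<in>B. F b q *\<^sub>R E b q)) (nhdsin S p)"
  proof -
    have "eventually (\<lambda>q. \<forall>b\<in>B. X q (\<kappa> b) = F b q) (nhdsin S p)"
      using F(2) fB by (simp add: eventually_ball_finite)
    then show ?thesis
      using ex vfield_at_nbhd[OF X]
    proof eventually_elim
      case (elim q)
      have "X q = (\<Sum>b\<in>B. X q (\<kappa> b) *\<^sub>R E b q)" using elim(2) vfield_at_tangent[OF elim(3)] by blast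
      also have "\<dots> = (\<Sum>b\<in>B. F b q *\<^sub>R E b q)" using elim(1) by (intro sum.cong) auto
      finally show ?case .
    qed
  qed
  ultimately have "\<exists>Z. vfield_at N (mtop N) p Z \<and> agree_near S p X Z"
    using agree_near_eventually[OF p] by blast
  from someI_ex[OF this]
  show "vfield_at N (mtop N) p (ambient_ext N S p X)"
    and "eventually (\<lambda>q. X q = ambient_ext N S p X q) (nhdsin S p)"
    unfolding ambient_ext_def agree_near_eventually[OF p] by auto
qed

text \<open>Expand the field in a coordinate frame: linearity over functions leaves only the values
  of the coefficients at p. Since \<Phi> depends on germs only, the local frame needs no cut-off
  functions.\<close>

lemma tensorial:
  fixes \<Phi> :: "'a vfield \<Rightarrow> 'v::real_vector"
  assumes add: "\<And>X Y. vfield_at N S p X \<Longrightarrow> vfield_at N S p Y \<Longrightarrow> \<Phi> (X + Y) = \<Phi> X + \<Phi> Y"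
    and scale: "\<And>f X. smooth_fun_at N S p f \<Longrightarrow> vfield_at N S p X \<Longrightarrow>
      \<Phi> (\<lambda>q. f q *\<^sub>R X q) = f p *\<^sub>R \<Phi> X"
    and local: "\<And>X Y. vfield_at N S p X \<Longrightarrow> vfield_at N S p Y \<Longrightarrow>
      eventually (\<lambda>q. X q = Y q) (nhdsin S p) \<Longrightarrow> \<Phi> X = \<Phi> Y"
    and X: "vfield_at N S p X" and Y: "vfield_at N S p Y" and eq: "X p = Y p"
  shows "\<Phi> X = \<Phi> Y"
proof -
  note p = vfield_at_topspace[OF X]
  obtain B :: "'e set" and E \<kappa> where fB: "finite B"
    and E: "\<And>b. b \<in> B \<Longrightarrow> vfield_at N S p (E b)" and \<kappa>: "\<And>b. b \<in> B \<Longrightarrow> smooth_at N p (\<kappa> b)"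
    and ex: "eventually (\<lambda>q. \<forall>v \<in> T q. v = (\<Sum>b\<in>B. v (\<kappa> b) *\<^sub>R E b q)) (nhdsin S p)"
    by (rule coordinate_frame[OF p]) (rule that)
  have zero: "\<Phi> (\<lambda>q. 0) = 0"
    using scale[OF smooth_fun_at_const[OF p, of 0] X] by simp
  have sm: "\<Phi> (\<lambda>q. \<Sum>b\<in>A. f b q *\<^sub>R E b q) = (\<Sum>b\<in>A. f b p *\<^sub>R \<Phi> (E b))"
    if "finite A" "A \<subseteq> B" "\<And>b. b \<in> A \<Longrightarrow> smooth_fun_at N S p (f b)" for A and f :: "'e \<Rightarrow> 'a \<Rightarrow> real"
    using that
  proof (induction A)
    case (insert b A)
    have "\<Phi> (\<lambda>q. \<Sum>b\<in>insert b A. f b q *\<^sub>R E b q)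
      = \<Phi> ((\<lambda>q. f b q *\<^sub>R E b q) + (\<lambda>q. \<Sum>b\<in>A. f b q *\<^sub>R E b q))"
      using insert by (simp add: plus_fun_def[of "\<lambda>q. f b q *\<^sub>R E b q"])
    also have "\<dots> = \<Phi> (\<lambda>q. f b q *\<^sub>R E b q) + \<Phi> (\<lambda>q. \<Sum>b\<in>A. f b q *\<^sub>R E b q)"
      by (intro add vfield_at_sum vfield_at_scale p E) (use insert.prems in auto)
    also have "\<Phi> (\<lambda>q. f b q *\<^sub>R E b q) = f b p *\<^sub>R \<Phi> (E b)"
      by (intro scale E) (use insert.prems in auto)
    finally show ?case using insert by simp
  qed (simp add: zero)
  have main: "\<Phi> Z = (\<Sum>b\<in>B. Z p (\<kappa> b) *\<^sub>R \<Phi> (E b))" if Z: "vfield_at N S p Z" for Z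
  proof -
    have s: "smooth_fun_at N S p (\<lambda>q. Z q (\<kappa> b))" if "b \<in> B" for b
      by (rule vfield_at_smooth[OF Z \<kappa>[OF that]])
    have "\<Phi> Z = \<Phi> (\<lambda>q. \<Sum>b\<in>B. Z q (\<kappa> b) *\<^sub>R E b q)"
    proof (rule local[OF Z])
      show "vfield_at N S p (\<lambda>q. \<Sum>b\<in>B. Z q (\<kappa> b) *\<^sub>R E b q)"
        by (intro vfield_at_sum vfield_at_scale p E s)
      show "\<forall>\<^sub>F q in nhdsin S p. Z q = (\<Sum>b\<in>B. Z q (\<kappa> b) *\<^sub>R E b q)"
        using ex vfield_at_nbhd[OF Z] by eventually_elim (meson vfield_at_tangent)
    qed
    also have "\<dots> = (\<Sum>b\<in>B. Z p (\<kappa> b) *\<^sub>R \<Phi> (E b))" by (intro sm fB s) auto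
    finally show ?thesis .
  qed
  show ?thesis unfolding main[OF X] main[OF Y] eq ..
qed

end

section \<open>Linear algebra of inner products on subspaces\<close>

lemma linear_on_subspaceD:
  assumes "linear_on_subspace V A" "u \<in> V" "v \<in> V"
  shows "A (a *\<^sub>R u + b *\<^sub>R v) = a *\<^sub>R A u + b *\<^sub>R A v"
    and "A (u + v) = A u + A v" and "A (u - v) = A u - A v" and "A (a *\<^sub>R u) = a *\<^sub>R A u"
    and "A (- u) = - A u" and "A 0 = 0"
proof -
  show *: "A (a *\<^sub>R u + b *\<^sub>R v) = a *\<^sub>R A u + b *\<^sub>R A v" for a b
    using assms unfolding linear_on_subspace_def by blast
  show "A (u + v) = A u + A v" "A (u - v) = A u - A v" "A (a *\<^sub>R u) = a *\<^sub>R A u"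
    "A (- u) = - A u" "A 0 = 0"
    using *[of 1 1] *[of 1 "-1"] *[of a 0] *[of "-1" 0] *[of 0 0] by simp_all
qed

lemma linear_on_subspace_sum:
  assumes "subspace V" "linear_on_subspace V A" "\<And>i. i \<in> I \<Longrightarrow> x i \<in> V"
  shows "A (\<Sum>i\<in>I. c i *\<^sub>R x i) = (\<Sum>i\<in>I. c i *\<^sub>R A (x i))"
  using assms(3)
proof (induction I rule: infinite_finite_induct)
  case (insert i I)
  have "(\<Sum>i\<in>I. c i *\<^sub>R x i) \<in> V"
    by (intro subspace_sum subspace_scale assms(1)) (use insert.prems in auto)
  then show ?case
    using insert linear_on_subspaceD(1)[OF assms(2), of "x i" _ "c i" 1] by simp
qed (use linear_on_subspaceD(6)[OF assms(2) subspace_0 subspace_0] assms(1) in simp_all)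

definition bilinear_on :: "'v::real_vector set \<Rightarrow> ('v \<Rightarrow> 'v \<Rightarrow> 'w::real_vector) \<Rightarrow> bool"
  where "bilinear_on V B \<longleftrightarrow>
    (\<forall>u\<in>V. linear_on_subspace V (B u) \<and> linear_on_subspace V (\<lambda>v. B v u))"

lemma bilinear_on_sum:
  assumes V: "subspace V" "bilinear_on V B" and x: "\<And>i. i \<in> I \<Longrightarrow> x i \<in> V" "\<And>j. j \<in> J \<Longrightarrow> y j \<in> V"
  shows "B (\<Sum>i\<in>I. c i *\<^sub>R x i) (\<Sum>j\<in>J. d j *\<^sub>R y j) = (\<Sum>i\<in>I. \<Sum>j\<in>J. (c i * d j) *\<^sub>R B (x i) (y j))"
proof -
  have y: "(\<Sum>j\<in>J. d j *\<^sub>R y j) \<in> V"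
    by (intro subspace_sum subspace_scale V x)
  have "B (\<Sum>i\<in>I. c i *\<^sub>R x i) (\<Sum>j\<in>J. d j *\<^sub>R y j) = (\<Sum>i\<in>I. c i *\<^sub>R B (x i) (\<Sum>j\<in>J. d j *\<^sub>R y j))"
    using V(2) y linear_on_subspace_sum[OF V(1), of "\<lambda>v. B v (\<Sum>j\<in>J. d j *\<^sub>R y j)" I x c] x
    unfolding bilinear_on_def by blast
  also have "\<dots> = (\<Sum>i\<in>I. c i *\<^sub>R (\<Sum>j\<in>J. d j *\<^sub>R B (x i) (y j)))"
    using V(2) x linear_on_subspace_sum[OF V(1)] unfolding bilinear_on_def
    by (intro sum.cong refl) (simp add: linear_on_subspace_sum[OF V(1)])
  finally show ?thesis by (simp add: scaleR_sum_right)
qed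

text \<open>Models a tangent space with its metric: \<open>V\<close> sits in a large space of
  operators, and \<open>G\<close> is constrained on \<open>V\<close> alone. Finite dimension enters
  through finite spanning sets in the individual lemmas, so the same \<open>G\<close> serves planes,
  tangent spaces of \<open>S\<close> and ambient tangent spaces.\<close>

locale inner_space =
  fixes V :: "'v::real_vector set" and G :: "'v \<Rightarrow> 'v \<Rightarrow> real"
  assumes subspace_V: "subspace V"
    and linear_G: "u \<in> V \<Longrightarrow> linear_on_subspace V (G u)"
    and sym: "u \<in> V \<Longrightarrow> v \<in> V \<Longrightarrow> G u v = G v u"
    and pos: "u \<in> V \<Longrightarrow> u \<noteq> 0 \<Longrightarrow> G u u > 0"
begin

lemma linear_G_left: "u \<in> V \<Longrightarrow> linear_on_subspace V (\<lambda>v. G v u)"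
  using linear_G[of u] subspace_V unfolding linear_on_subspace_def
  by (simp add: sym[of _ u] subspace_add subspace_scale)

lemma G_add: "u \<in> V \<Longrightarrow> v \<in> V \<Longrightarrow> w \<in> V \<Longrightarrow> G u (v + w) = G u v + G u w"
    "u \<in> V \<Longrightarrow> v \<in> V \<Longrightarrow> w \<in> V \<Longrightarrow> G (u + v) w = G u w + G v w"
  and G_diff: "u \<in> V \<Longrightarrow> v \<in> V \<Longrightarrow> w \<in> V \<Longrightarrow> G u (v - w) = G u v - G u w"
    "u \<in> V \<Longrightarrow> v \<in> V \<Longrightarrow> w \<in> V \<Longrightarrow> G (u - v) w = G u w - G v w"
  and G_scale: "u \<in> V \<Longrightarrow> v \<in> V \<Longrightarrow> G u (a *\<^sub>R v) = a * G u v"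
    "u \<in> V \<Longrightarrow> v \<in> V \<Longrightarrow> G (a *\<^sub>R u) v = a * G u v"
  and G_minus: "u \<in> V \<Longrightarrow> v \<in> V \<Longrightarrow> G u (- v) = - G u v"
    "u \<in> V \<Longrightarrow> v \<in> V \<Longrightarrow> G (- u) v = - G u v"
  and G_zero: "u \<in> V \<Longrightarrow> G u 0 = 0" "u \<in> V \<Longrightarrow> G 0 u = 0"
  using linear_on_subspaceD[OF linear_G] linear_on_subspaceD[OF linear_G_left] by simp_all

lemma G_sum:
  assumes "u \<in> V" "\<And>i. i \<in> I \<Longrightarrow> x i \<in> V"
  shows "G u (\<Sum>i\<in>I. c i *\<^sub>R x i) = (\<Sum>i\<in>I. c i * G u (x i))"
    and "G (\<Sum>i\<in>I. c i *\<^sub>R x i) u = (\<Sum>i\<in>I. c i * G (x i) u)"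
  using linear_on_subspace_sum[OF subspace_V linear_G[OF assms(1)], of I x c]
    linear_on_subspace_sum[OF subspace_V linear_G_left[OF assms(1)], of I x c] assms(2) by simp_all

lemma G_sum1:
  assumes "u \<in> V" "\<And>i. i \<in> I \<Longrightarrow> x i \<in> V"
  shows "G u (\<Sum>i\<in>I. x i) = (\<Sum>i\<in>I. G u (x i))"
    and "G (\<Sum>i\<in>I. x i) u = (\<Sum>i\<in>I. G (x i) u)"
  using G_sum[OF assms, where c = "\<lambda>_. 1"] by simp_all

lemma G_nonneg: "u \<in> V \<Longrightarrow> G u u \<ge> 0"
  using pos[of u] G_zero(1)[of 0] subspace_0[OF subspace_V] by (cases "u = 0") force+

lemma G_eq_0: "u \<in> V \<Longrightarrow> G u u = 0 \<longleftrightarrow> u = 0"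
  using pos[of u] G_zero(1)[of 0] subspace_0[OF subspace_V] by force

lemma G_eqI:
  assumes "u \<in> V" "v \<in> V" "\<And>w. w \<in> V \<Longrightarrow> G u w = G v w"
  shows "u = v"
proof -
  have "G (u - v) (u - v) = 0"
    using assms by (simp add: G_diff subspace_diff[OF subspace_V])
  then show ?thesis using assms G_eq_0[of "u - v"] by (simp add: subspace_diff[OF subspace_V])
qed

definition orthonormal :: "'i set \<Rightarrow> ('i \<Rightarrow> 'v) \<Rightarrow> bool"
  where "orthonormal I e \<longleftrightarrow> e ` I \<subseteq> V \<and> (\<forall>i\<in>I. \<forall>j\<in>I. G (e i) (e j) = (if i = j then 1 else 0))"

lemma orthonormalD:
  assumes "orthonormal I e"
  shows "i \<in> I \<Longrightarrow> e i \<in> V" "i \<in> I \<Longrightarrow> j \<in> I \<Longrightarrow> G (e i) (e j) = (if i = j then 1 else 0)"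
  using assms by (auto simp: orthonormal_def)

lemma orthonormal_expand:
  assumes e: "orthonormal I e" "finite I" and x: "x \<in> span (e ` I)"
  shows "x = (\<Sum>i\<in>I. G x (e i) *\<^sub>R e i)"
proof -
  \<comment> \<open>Membership in \<open>V\<close> is carried through the induction because
    \<open>G\<close> is linear only there.\<close>
  have "x \<in> V \<and> x = (\<Sum>i\<in>I. G x (e i) *\<^sub>R e i)"
    using x
  proof (rule span_induct)
    have *: "(\<Sum>i\<in>I. G (u + v) (e i) *\<^sub>R e i)
        = (\<Sum>i\<in>I. G u (e i) *\<^sub>R e i) + (\<Sum>i\<in>I. G v (e i) *\<^sub>R e i)" if "u \<in> V" "v \<in> V" for u v
      unfolding sum.distrib[symmetric]
      by (intro sum.cong refl) (use that orthonormalD(1)[OF e(1)] in \<open>simp add: G_add scaleR_left_distrib\<close>)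
    have **: "(\<Sum>i\<in>I. G (c *\<^sub>R u) (e i) *\<^sub>R e i) = c *\<^sub>R (\<Sum>i\<in>I. G u (e i) *\<^sub>R e i)"
      if "u \<in> V" for u c
      unfolding scaleR_sum_right
      by (intro sum.cong refl) (use that orthonormalD(1)[OF e(1)] in \<open>simp add: G_scale\<close>)
    show "subspace {x. x \<in> V \<and> x = (\<Sum>i\<in>I. G x (e i) *\<^sub>R e i)}"
      unfolding subspace_def mem_Collect_eq
    proof (intro conjI ballI allI)
      show "0 \<in> V" by (rule subspace_0[OF subspace_V])
      show "0 = (\<Sum>i\<in>I. G 0 (e i) *\<^sub>R e i)"
        using orthonormalD(1)[OF e(1)] by (simp add: G_zero)
    qed (use * ** in \<open>simp_all add: subspace_add[OF subspace_V] subspace_scale[OF subspace_V]\<close>)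
  next
    fix x assume "x \<in> e ` I"
    then obtain k where k: "k \<in> I" "x = e k" by blast
    have "(\<Sum>i\<in>I. G x (e i) *\<^sub>R e i) = (\<Sum>i\<in>I. if i = k then e i else 0)"
      unfolding k(2) by (intro sum.cong refl) (use orthonormalD(2)[OF e(1) k(1)] in simp)
    also have "\<dots> = x" using k e(2) by simp
    finally show "x \<in> V \<and> x = (\<Sum>i\<in>I. G x (e i) *\<^sub>R e i)"
      using k orthonormalD(1)[OF e(1)] by simp
  qed
  then show ?thesis by blast
qed

lemma orthonormal_project:
  assumes e: "orthonormal I e" "finite I" and v: "v \<in> V" and u: "u \<in> span (e ` I)"
  shows "G (v - (\<Sum>i\<in>I. G v (e i) *\<^sub>R e i)) u = 0"
proof -
  let ?w = "\<Sum>i\<in>I. G v (e i) *\<^sub>R e i"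
  have w: "?w \<in> V"
    by (intro subspace_sum subspace_scale subspace_V) (use orthonormalD(1)[OF e(1)] in auto)
  have k: "G (v - ?w) (e k) = 0" if "k \<in> I" for k
  proof -
    have "G ?w (e k) = (\<Sum>i\<in>I. G v (e i) * G (e i) (e k))"
      by (rule G_sum) (use orthonormalD(1)[OF e(1)] that in auto)
    also have "\<dots> = (\<Sum>i\<in>I. if i = k then G v (e k) else 0)"
      by (intro sum.cong refl) (use orthonormalD(2)[OF e(1) _ that] in simp)
    finally show ?thesis using that e v w orthonormalD(1)[OF e(1)] by (simp add: G_diff)
  qed
  have "u = (\<Sum>i\<in>I. G u (e i) *\<^sub>R e i)" by (rule orthonormal_expand[OF e u])
  moreover have "G (v - ?w) (\<Sum>i\<in>I. G u (e i) *\<^sub>R e i) = (\<Sum>i\<in>I. G u (e i) * G (v - ?w) (e i))"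
    by (rule G_sum) (use orthonormalD(1)[OF e(1)] v w subspace_diff[OF subspace_V] in auto)
  ultimately show ?thesis using k by simp
qed

lemma orthonormal_independent:
  assumes e: "orthonormal I e" "finite I"
  shows "inj_on e I" "independent (e ` I)"
proof -
  show inj: "inj_on e I"
  proof (rule inj_onI)
    fix i j assume "i \<in> I" "j \<in> I" "e i = e j"
    then show "i = j" using orthonormalD(2)[OF e(1), of i j] orthonormalD(2)[OF e(1), of i i]
      by (auto split: if_splits)
  qed
  show "independent (e ` I)"
  proof
    assume "dependent (e ` I)"
    then obtain k where k: "k \<in> I" "e k \<in> span (e ` I - {e k})" unfolding dependent_def by blast
    have J: "e ` I - {e k} = e ` (I - {k})"
      using inj k(1) by (auto simp: inj_on_def)
    have "e k = (\<Sum>i\<in>I - {k}. G (e k) (e i) *\<^sub>R e i)"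
      using k(2) orthonormalD[OF e(1)] e(2) unfolding J
      by (intro orthonormal_expand) (auto simp: orthonormal_def)
    also have "\<dots> = 0"
      by (intro sum.neutral) (use orthonormalD(2)[OF e(1) k(1)] in auto)
    finally show False
      using orthonormalD(2)[OF e(1) k(1) k(1)] G_zero subspace_0[OF subspace_V] by simp
  qed
qed

lemma span_subset_V: "X \<subseteq> V \<Longrightarrow> span X \<subseteq> V"
  by (rule span_minimal[OF _ subspace_V])

text \<open>Each round adds the normalised part of a missing vector orthogonal to the family.
  Orthonormal families are independent, so at most \<open>card B\<close> vectors occur and
  \<open>card B - k\<close> decreases.\<close>

lemma orthonormal_extend:
  assumes "orthonormal {1..k::nat} e" "finite B" "U = span B" "U \<subseteq> V" "e ` {1..k} \<subseteq> U"
  shows "\<exists>f m. orthonormal {1..m} f \<and> span (f ` {1..m}) = U \<and> (\<forall>i\<in>{1..k}. f i = e i) \<and> k \<le> m"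
  using assms
proof (induction "card B - k" arbitrary: k e rule: less_induct)
  case less
  have sub: "span (e ` {1..k}) \<subseteq> U"
    unfolding less.prems(3) by (rule span_minimal) (use less.prems in auto)
  show ?case
  proof (cases "span (e ` {1..k}) = U")
    case True
    then show ?thesis using less.prems by (intro exI[of _ e] exI[of _ k]) auto
  next
    case False
    then obtain v where v: "v \<in> U" "v \<notin> span (e ` {1..k})" using sub by blast
    define w where "w = v - (\<Sum>i\<in>{1..k}. G v (e i) *\<^sub>R e i)"
    have s: "(\<Sum>i\<in>{1..k}. G v (e i) *\<^sub>R e i) \<in> span (e ` {1..k})"
      by (intro span_sum span_scale span_base) auto
    have wU: "w \<in> U" using v s sub unfolding w_def less.prems(3) by (blast intro: span_diff)
    then have wV: "w \<in> V" using less.prems(4) by blast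
    have w0: "w \<noteq> 0" using v s unfolding w_def by auto
    have we: "G w (e i) = 0" if "i \<in> {1..k}" for i
      unfolding w_def
      by (rule orthonormal_project[OF less.prems(1)]) (use v less.prems that in \<open>auto intro: span_base\<close>)
    define u where "u = (1 / sqrt (G w w)) *\<^sub>R w"
    have u: "u \<in> U" "u \<in> V"
      using wU wV unfolding u_def less.prems(3)
      by (simp_all add: span_scale subspace_scale[OF subspace_V])
    have uu: "G u u = 1"
      using pos[OF wV w0] wV unfolding u_def
      by (simp add: G_scale subspace_scale[OF subspace_V] field_simps)
    have eV: "e i \<in> V" if "i \<in> {1..k}" for i using orthonormalD(1)[OF less.prems(1) that] .
    have ue: "G u (e i) = 0" "G (e i) u = 0" if "i \<in> {1..k}" for i
      using we[OF that] sym[OF u(2) eV[OF that]] wV eV[OF that] unfolding u_def by (simp_all add: G_scale)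
    let ?f = "e(Suc k := u)"
    have o: "orthonormal {1..Suc k} ?f"
      using less.prems(1) u uu ue unfolding orthonormal_def atLeastAtMostSuc_conv[of 1 k, simplified]
      by auto
    have fU: "?f ` {1..Suc k} \<subseteq> U" using less.prems(5) u by (auto simp: le_Suc_eq)
    have "card (?f ` {1..Suc k}) \<le> card B"
      using independent_span_bound[OF less.prems(2) orthonormal_independent(2)[OF o]] fU less.prems(3)
      by simp
    then have "Suc k \<le> card B"
      using card_image[OF orthonormal_independent(1)[OF o]] by simp
    then have "card B - Suc k < card B - k" by simp
    from less.hyps[OF this o less.prems(2-4) fU]
    obtain f m where fm: "orthonormal {1..m} f" "span (f ` {1..m}) = U"
      "\<forall>i\<in>{1..Suc k}. f i = ?f i" "Suc k \<le> m" by blast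
    then show ?thesis by (intro exI[of _ f] exI[of _ m]) auto
  qed
qed

lemma orthonormal_extend_dim:
  assumes "orthonormal {1..k::nat} e" "finite B" "independent B" "U = span B" "U \<subseteq> V" "e ` {1..k} \<subseteq> U"
  obtains f where "orthonormal {1..card B} f" "span (f ` {1..card B}) = U" "\<forall>i\<in>{1..k}. f i = e i"
proof -
  obtain f m where f: "orthonormal {1..m} f" "span (f ` {1..m}) = U" "\<forall>i\<in>{1..k}. f i = e i" "k \<le> m"
    using orthonormal_extend[OF assms(1,2,4-6)] by blast
  note i = orthonormal_independent[OF f(1)]
  have "card (f ` {1..m}) = card B"
    using dim_eq_card_independent[OF i(2)] dim_eq_card_independent[OF assms(3)] f(2) assms(4)
      dim_span by (metis finite_atLeastAtMost)
  then have "m = card B" using card_image[OF i(1)] by simp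
  then show thesis using f that by blast
qed

lemma orthonormal_basis_ex:
  assumes "U = span B" "finite B" "U \<subseteq> V"
  obtains f and m :: nat where "orthonormal {1..m} f" "span (f ` {1..m}) = U"
proof -
  have "orthonormal {1..0::nat} (\<lambda>_. 0)" by (simp add: orthonormal_def)
  from orthonormal_extend[OF this assms(2,1,3)] show thesis using that by auto
qed

text \<open>Expanding each e_i in the f_j produces the coefficients sum_i G(e_i, f_j) G(e_i, f_k),
  which equal G(f_j, f_k) by Parseval. Values in an arbitrary vector space are allowed, so that the
  lemma covers the trace of \<sigma> itself as well as real-valued forms built from it.\<close>

lemma trace_invariant:
  assumes e: "orthonormal I e" "finite I" and f: "orthonormal J f" "finite J"
    and U: "span (e ` I) = U" "span (f ` J) = U" and B: "bilinear_on U B"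
  shows "(\<Sum>i\<in>I. B (e i) (e i)) = (\<Sum>j\<in>J. B (f j) (f j))"
proof -
  have sU: "subspace U" using U(1) subspace_span by blast
  have eU: "e i \<in> U" if "i \<in> I" for i unfolding U(1)[symmetric] using that by (simp add: span_base)
  have fU: "f j \<in> U" if "j \<in> J" for j unfolding U(2)[symmetric] using that by (simp add: span_base)
  have "B (e i) (e i) = (\<Sum>j\<in>J. \<Sum>k\<in>J. (G (e i) (f j) * G (e i) (f k)) *\<^sub>R B (f j) (f k))"
    if "i \<in> I" for i
  proof -
    have "e i = (\<Sum>j\<in>J. G (e i) (f j) *\<^sub>R f j)"
      by (rule orthonormal_expand[OF f]) (use eU that U in simp)
    then have "B (e i) (e i) = B (\<Sum>j\<in>J. G (e i) (f j) *\<^sub>R f j) (\<Sum>j\<in>J. G (e i) (f j) *\<^sub>R f j)"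
      by simp
    then show ?thesis using bilinear_on_sum[OF sU B fU fU] by simp
  qed
  then have "(\<Sum>i\<in>I. B (e i) (e i))
      = (\<Sum>i\<in>I. \<Sum>j\<in>J. \<Sum>k\<in>J. (G (e i) (f j) * G (e i) (f k)) *\<^sub>R B (f j) (f k))"
    by simp
  also have "\<dots> = (\<Sum>j\<in>J. \<Sum>i\<in>I. \<Sum>k\<in>J. (G (e i) (f j) * G (e i) (f k)) *\<^sub>R B (f j) (f k))"
    by (rule sum.swap)
  also have "\<dots> = (\<Sum>j\<in>J. \<Sum>k\<in>J. \<Sum>i\<in>I. (G (e i) (f j) * G (e i) (f k)) *\<^sub>R B (f j) (f k))"
    by (intro sum.cong refl sum.swap)
  also have "\<dots> = (\<Sum>j\<in>J. \<Sum>k\<in>J. G (f j) (f k) *\<^sub>R B (f j) (f k))"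
  proof (intro sum.cong refl)
    fix j k assume jk: "j \<in> J" "k \<in> J"
    note V = orthonormalD(1)[OF f(1)] orthonormalD(1)[OF e(1)]
    have "f k = (\<Sum>i\<in>I. G (f k) (e i) *\<^sub>R e i)"
      by (rule orthonormal_expand[OF e]) (use fU jk U in simp)
    then have "G (f j) (f k) = G (f j) (\<Sum>i\<in>I. G (f k) (e i) *\<^sub>R e i)" by simp
    also have "\<dots> = (\<Sum>i\<in>I. G (f k) (e i) * G (f j) (e i))"
      by (rule G_sum) (use V jk in auto)
    also have "\<dots> = (\<Sum>i\<in>I. G (e i) (f j) * G (e i) (f k))"
      by (intro sum.cong refl) (use V jk sym in \<open>simp add: mult.commute\<close>)
    finally show "(\<Sum>i\<in>I. (G (e i) (f j) * G (e i) (f k)) *\<^sub>R B (f j) (f k)) = G (f j) (f k) *\<^sub>R B (f j) (f k)"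
      by (simp add: scaleR_sum_left)
  qed
  also have "\<dots> = (\<Sum>j\<in>J. \<Sum>k\<in>J. if k = j then B (f j) (f j) else 0)"
    by (intro sum.cong refl) (use orthonormalD(2)[OF f(1)] in auto)
  also have "\<dots> = (\<Sum>j\<in>J. B (f j) (f j))" using f(2) by simp
  finally show ?thesis .
qed

text \<open>Provides the unique existence behind the \<open>THE\<close> in
  \<open>tangential_part\<close>.\<close>

lemma projection_ex1:
  assumes U: "U = span B" "finite B" "U \<subseteq> V" and v: "v \<in> V"
  shows "\<exists>!w. w \<in> U \<and> (\<forall>u\<in>U. G (v - w) u = 0)"
proof -
  obtain f m where f: "orthonormal {1..m::nat} f" "span (f ` {1..m}) = U"
    by (rule orthonormal_basis_ex[OF U])
  let ?w = "\<Sum>i\<in>{1..m}. G v (f i) *\<^sub>R f i"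
  have w: "?w \<in> U" unfolding f(2)[symmetric] by (intro span_sum span_scale span_base) auto
  show ?thesis
  proof (rule ex1I[of _ ?w])
    show "?w \<in> U \<and> (\<forall>u\<in>U. G (v - ?w) u = 0)"
      using w orthonormal_project[OF f(1) _ v] f(2) by auto
  next
    fix w' assume w': "w' \<in> U \<and> (\<forall>u\<in>U. G (v - w') u = 0)"
    have dU: "?w - w' \<in> U" using w w' unfolding U(1) by (blast intro: span_diff)
    have wV: "?w \<in> V" "w' \<in> V" "?w - w' \<in> V" using w w' dU U(3) by auto
    have "G (v - w') (?w - w') = 0" "G (v - ?w) (?w - w') = 0"
      using w' dU orthonormal_project[OF f(1) _ v] f(2) by auto
    then have "G (?w - w') (?w - w') = 0"
      using wV v by (simp add: G_diff(2))
    then show "w' = ?w" using G_eq_0 wV by simp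
  qed
qed

text \<open>Provides the unique existence behind the \<open>THE\<close> in
  \<open>star_End\<close>.\<close>

lemma riesz_ex1:
  assumes V: "V = span B" "finite B" and l: "linear_on_subspace V (l :: 'v \<Rightarrow> real)"
  shows "\<exists>!z. z \<in> V \<and> (\<forall>x\<in>V. l x = G x z)"
proof -
  obtain f m where f: "orthonormal {1..m::nat} f" "span (f ` {1..m}) = V"
    by (rule orthonormal_basis_ex[OF V subset_refl])
  let ?z = "\<Sum>i\<in>{1..m}. l (f i) *\<^sub>R f i"
  note fV = orthonormalD(1)[OF f(1)]
  have z: "?z \<in> V" by (intro subspace_sum subspace_scale subspace_V fV)
  have lz: "l x = G x ?z" if "x \<in> V" for x
  proof -
    have "x = (\<Sum>i\<in>{1..m}. G x (f i) *\<^sub>R f i)"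
      by (rule orthonormal_expand[OF f(1)]) (use that f(2) in auto)
    then have "l x = l (\<Sum>i\<in>{1..m}. G x (f i) *\<^sub>R f i)" by simp
    also have "\<dots> = (\<Sum>i\<in>{1..m}. G x (f i) * l (f i))"
      using linear_on_subspace_sum[OF subspace_V l, of "{1..m}" f "\<lambda>i. G x (f i)"] fV by simp
    also have "\<dots> = G x ?z" using G_sum(1)[OF that, of "{1..m}" f "\<lambda>i. l (f i)"] fV by (simp add: mult.commute)
    finally show ?thesis .
  qed
  show ?thesis
  proof (rule ex1I[of _ ?z])
    show "?z \<in> V \<and> (\<forall>x\<in>V. l x = G x ?z)" using z lz by blast
  next
    fix z' assume z': "z' \<in> V \<and> (\<forall>x\<in>V. l x = G x z')"
    show "z' = ?z" by (rule G_eqI) (use z z' lz sym in metis)+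
  qed
qed

end

section \<open>Connections and curvature\<close>

context submanifold
begin

context
  fixes D :: "'a connection"
  assumes A: "affine_connection N S D"
begin

lemmas conn_axioms = A[unfolded affine_connection_def, THEN bspec]

lemma conn_linear: "vfield_at N S p Y \<Longrightarrow> linear_on_subspace (T p) (\<lambda>v. D p v Y)"
  by (rule conn_axioms[THEN conjunct1, rule_format, OF vfield_at_topspace])

lemma conn_tangent: "v \<in> T p \<Longrightarrow> vfield_at N S p Y \<Longrightarrow> D p v Y \<in> T p"
  by (rule conn_axioms[THEN conjunct2, THEN conjunct1, rule_format, OF vfield_at_topspace])

lemma conn_add: "v \<in> T p \<Longrightarrow> vfield_at N S p Y \<Longrightarrow> vfield_at N S p Z \<Longrightarrow>
    D p v (Y + Z) = D p v Y + D p v Z"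
  by (rule conn_axioms[THEN conjunct2, THEN conjunct2, THEN conjunct1, rule_format,
        OF vfield_at_topspace])

lemma conn_scale: "v \<in> T p \<Longrightarrow> smooth_fun_at N S p f \<Longrightarrow> vfield_at N S p Y \<Longrightarrow>
    D p v (\<lambda>q. f q *\<^sub>R Y q) = dir_deriv N S p v f *\<^sub>R Y p + f p *\<^sub>R D p v Y"
  by (rule conn_axioms[THEN conjunct2, THEN conjunct2, THEN conjunct2, THEN conjunct1, rule_format,
        OF vfield_at_topspace])

lemma conn_cong:
  assumes "v \<in> T p" "vfield_at N S p Y" "eventually (\<lambda>q. Y q = Z q) (nhdsin S p)"
  shows "D p v Y = D p v Z"
proof -
  have p: "p \<in> topspace S" by (rule vfield_at_topspace[OF assms(2)])
  have "agree_near S p Y Z" unfolding agree_near_eventually[OF p] by (rule assms(3))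
  then show ?thesis
    by (rule conn_axioms[THEN conjunct2, THEN conjunct2, THEN conjunct2, THEN conjunct2,
          THEN conjunct1, rule_format, OF p assms(1,2)])
qed

lemma covd_vfield: "vfield_at N S p X \<Longrightarrow> vfield_at N S p Y \<Longrightarrow> vfield_at N S p (covd D X Y)"
  by (rule conn_axioms[THEN conjunct2, THEN conjunct2, THEN conjunct2, THEN conjunct2,
        THEN conjunct2, rule_format, OF vfield_at_topspace])

lemma conn_cmult:
  assumes "v \<in> T p" "vfield_at N S p Y"
  shows "D p v (\<lambda>q. k *\<^sub>R Y q) = k *\<^sub>R D p v Y"
proof -
  have p: "p \<in> topspace S" by (rule vfield_at_topspace[OF assms(2)])
  show ?thesis
    using conn_scale[OF assms(1) smooth_fun_at_const[OF p, of k] assms(2)] dir_deriv_const[OF assms(1) p]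
    by simp
qed

lemma conn_diff:
  assumes "v \<in> T p" "vfield_at N S p Y" "vfield_at N S p Z"
  shows "D p v (Y - Z) = D p v Y - D p v Z"
proof -
  have "Y - Z = Y + (\<lambda>q. (-1) *\<^sub>R Z q)" by (auto simp: fun_eq_iff)
  then have "D p v (Y - Z) = D p v (Y + (\<lambda>q. (-1) *\<^sub>R Z q))" by (simp only:)
  also have "\<dots> = D p v Y + D p v (\<lambda>q. (-1) *\<^sub>R Z q)"
    by (rule conn_add[OF assms(1,2) vfield_at_cmult[OF assms(3)]])
  also have "D p v (\<lambda>q. (-1) *\<^sub>R Z q) = (-1) *\<^sub>R D p v Z" by (rule conn_cmult[OF assms(1,3)])
  finally show ?thesis by (simp only: scaleR_minus1_left add_uminus_conv_diff)
qed

end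

section \<open>Lie brackets of local fields\<close>

lemma lie_bracket_apply:
  "smooth_at N p F \<Longrightarrow> lie_bracket N S X Y p F =
    dir_deriv N S p (X p) (\<lambda>q. Y q F) - dir_deriv N S p (Y p) (\<lambda>q. X q F)"
  by (simp add: lie_bracket_def)

lemma lie_bracket_nonsmooth: "\<not> smooth_at N p F \<Longrightarrow> lie_bracket N S X Y p F = 0"
  by (simp add: lie_bracket_def)

lemma lie_bracket_swap: "lie_bracket N S Y X p = - lie_bracket N S X Y p"
proof (rule ext)
  fix F show "lie_bracket N S Y X p F = (- lie_bracket N S X Y p) F"
    by (cases "smooth_at N p F") (simp_all add: lie_bracket_def)
qed

lemma lie_bracket_add:
  assumes X: "vfield_at N S p X" "vfield_at N S p X'" and Y: "vfield_at N S p Y"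
  shows "lie_bracket N S (X + X') Y p = lie_bracket N S X Y p + lie_bracket N S X' Y p"
proof (rule ext)
  note p = vfield_at_topspace[OF Y]
  fix F show "lie_bracket N S (X + X') Y p F = (lie_bracket N S X Y p + lie_bracket N S X' Y p) F"
  proof (cases "smooth_at N p F")
    case True
    note s = vfield_at_smooth[OF _ True]
    have 1: "dir_deriv N S p (X p + X' p) (\<lambda>q. Y q F)
        = dir_deriv N S p (X p) (\<lambda>q. Y q F) + dir_deriv N S p (X' p) (\<lambda>q. Y q F)"
      using dir_deriv_linear[OF vfield_at_tangent[OF X(1)] vfield_at_tangent[OF X(2)] s[OF Y], of 1 1]
      by simp
    have 2: "dir_deriv N S p (Y p) (\<lambda>q. X q F + X' q F)
        = dir_deriv N S p (Y p) (\<lambda>q. X q F) + dir_deriv N S p (Y p) (\<lambda>q. X' q F)"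
      by (rule dir_deriv_add[OF s[OF X(1)] s[OF X(2)] vfield_at_tangent[OF Y]])
    show ?thesis using True 1 2 by (simp add: lie_bracket_apply)
  qed (simp add: lie_bracket_nonsmooth)
qed

lemma lie_bracket_scale:
  assumes f: "smooth_fun_at N S p f" and X: "vfield_at N S p X" and Y: "vfield_at N S p Y"
  shows "lie_bracket N S (\<lambda>q. f q *\<^sub>R X q) Y p
    = f p *\<^sub>R lie_bracket N S X Y p - dir_deriv N S p (Y p) f *\<^sub>R X p"
proof (rule ext)
  note p = vfield_at_topspace[OF Y]
  fix F show "lie_bracket N S (\<lambda>q. f q *\<^sub>R X q) Y p F
    = (f p *\<^sub>R lie_bracket N S X Y p - dir_deriv N S p (Y p) f *\<^sub>R X p) F"
  proof (cases "smooth_at N p F")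
    case True
    note s = vfield_at_smooth[OF _ True]
    have 1: "dir_deriv N S p (f p *\<^sub>R X p) (\<lambda>q. Y q F) = f p * dir_deriv N S p (X p) (\<lambda>q. Y q F)"
      using dir_deriv_linear[OF vfield_at_tangent[OF X] vfield_at_tangent[OF X] s[OF Y], of "f p" 0]
      by simp
    have 2: "dir_deriv N S p (Y p) (\<lambda>q. f q * X q F)
        = dir_deriv N S p (Y p) f * X p F + f p * dir_deriv N S p (Y p) (\<lambda>q. X q F)"
      by (rule dir_deriv_mult[OF f s[OF X] vfield_at_tangent[OF Y]])
    show ?thesis using True 1 2 by (simp add: lie_bracket_apply algebra_simps)
  next
    case False
    \<comment> \<open>On a function that is not smooth all operators involved, including the tangent
      vector \<open>X p\<close>, take the default value 0.\<close>
    then show ?thesis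
      using tangent_nonsmooth[of "X p" p F] vfield_at_tangent[OF X] tangent_subset
      by (auto simp: lie_bracket_nonsmooth)
  qed
qed

lemma lie_bracket_cong:
  assumes X: "vfield_at N S p X" "eventually (\<lambda>q. X q = X' q) (nhdsin S p)"
    and Y: "vfield_at N S p Y" "eventually (\<lambda>q. Y q = Y' q) (nhdsin S p)"
  shows "lie_bracket N S X Y p = lie_bracket N S X' Y' p"
proof (rule ext)
  note p = vfield_at_topspace[OF X(1)]
  fix F show "lie_bracket N S X Y p F = lie_bracket N S X' Y' p F"
  proof (cases "smooth_at N p F")
    case True
    note s = vfield_at_smooth[OF _ True]
    have "dir_deriv N S p (X p) (\<lambda>q. Y q F) = dir_deriv N S p (X p) (\<lambda>q. Y' q F)"
      by (rule dir_deriv_cong[OF vfield_at_tangent[OF X(1)] s[OF Y(1)]])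
        (use Y(2) in \<open>auto elim: eventually_mono\<close>)
    moreover have "dir_deriv N S p (Y p) (\<lambda>q. X q F) = dir_deriv N S p (Y p) (\<lambda>q. X' q F)"
      by (rule dir_deriv_cong[OF vfield_at_tangent[OF Y(1)] s[OF X(1)]])
        (use X(2) in \<open>auto elim: eventually_mono\<close>)
    ultimately show ?thesis
      using True eventually_nhdsin_self[OF X(2) p] eventually_nhdsin_self[OF Y(2) p]
      by (simp add: lie_bracket_apply)
  qed (simp add: lie_bracket_nonsmooth)
qed

lemma torsion_freeD:
  "torsion_free N S D \<Longrightarrow> vfield_at N S p X \<Longrightarrow> vfield_at N S p Y \<Longrightarrow>
    lie_bracket N S X Y p = D p (X p) Y - D p (Y p) X"
  using vfield_at_topspace[of N S p X] unfolding torsion_free_def covd_def by metis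

lemma curvature_field_apply:
  "curvature_field N S D X Y Z p = D p (X p) (covd D Y Z) - D p (Y p) (covd D X Z)
    - D p (lie_bracket N S X Y p) Z"
  by (simp add: curvature_field_def covd_def)

context
  fixes D :: "'a connection"
  assumes A: "affine_connection N S D" and tf: "torsion_free N S D"
begin

text \<open>Torsion-freeness writes the bracket as a difference of covariant derivatives, and these
  are tangent.\<close>

lemma lie_bracket_tangent:
  assumes X: "vfield_at N S p X" and Y: "vfield_at N S p Y"
  shows "lie_bracket N S X Y p \<in> T p"
  unfolding torsion_freeD[OF tf X Y]
  by (intro subspace_diff subspace_tangent conn_tangent[OF A] vfield_at_tangent X Y
      vfield_at_topspace[OF X])

lemma curvature_field_swap:
  assumes X: "vfield_at N S p X" and Y: "vfield_at N S p Y" and Z: "vfield_at N S p Z"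
  shows "curvature_field N S D Y X Z p = - curvature_field N S D X Y Z p"
  using linear_on_subspaceD(5)[OF conn_linear[OF A Z] lie_bracket_tangent[OF X Y]
      lie_bracket_tangent[OF X Y]]
  by (simp add: curvature_field_apply lie_bracket_swap[of Y X])

lemma covd_cong_left:
  "eventually (\<lambda>q. X q = X' q) (nhdsin S p) \<Longrightarrow>
    eventually (\<lambda>q. covd D X Z q = covd D X' Z q) (nhdsin S p)"
  by (erule eventually_mono) (simp add: covd_def)

lemma covd_cong_right:
  assumes X: "vfield_at N S p X" and Z: "vfield_at N S p Z"
    and e: "eventually (\<lambda>q. Z q = Z' q) (nhdsin S p)"
  shows "eventually (\<lambda>q. covd D X Z q = covd D X Z' q) (nhdsin S p)"
  using vfield_at_nbhd[OF X] vfield_at_nbhd[OF Z] eventually_nhdsin_open[OF e]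
  unfolding covd_def by eventually_elim (rule conn_cong[OF A vfield_at_tangent])

text \<open>For fX the term (Y f) D_X Z from D_Y (f D_X Z) cancels against the same term from
  [fX, Y] = f [X, Y] - (Y f) X.\<close>

lemma curvature_field_tensor_left:
  assumes X: "vfield_at N S p X" "vfield_at N S p X'" "X p = X' p"
    and Y: "vfield_at N S p Y" and Z: "vfield_at N S p Z"
  shows "curvature_field N S D X Y Z p = curvature_field N S D X' Y Z p"
proof (rule tensorial[where \<Phi> = "\<lambda>X. curvature_field N S D X Y Z p", OF _ _ _ X])
  note cv = covd_vfield[OF A] and tg = vfield_at_tangent
  fix X X' assume X: "vfield_at N S p X" and X': "vfield_at N S p X'"
  note l = linear_on_subspaceD(2)[OF conn_linear[OF A]]
  have "eventually (\<lambda>q. covd D (X + X') Z q = (covd D X Z + covd D X' Z) q) (nhdsin S p)"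
    using vfield_at_nbhd[OF X] vfield_at_nbhd[OF X'] vfield_at_nbhd[OF Z]
  proof eventually_elim
    case (elim q)
    show ?case using l[OF elim(3) tg[OF elim(1)] tg[OF elim(2)]] by (simp add: covd_def)
  qed
  then have "D p (Y p) (covd D (X + X') Z) = D p (Y p) (covd D X Z + covd D X' Z)"
    by (intro conn_cong[OF A tg[OF Y]] cv vfield_at_add X X' Z)
  also have "\<dots> = D p (Y p) (covd D X Z) + D p (Y p) (covd D X' Z)"
    by (intro conn_add[OF A] tg Y cv X X' Z)
  finally show "curvature_field N S D (X + X') Y Z p
      = curvature_field N S D X Y Z p + curvature_field N S D X' Y Z p"
    using l[OF cv[OF Y Z] tg[OF X] tg[OF X']]
      l[OF Z lie_bracket_tangent[OF X Y] lie_bracket_tangent[OF X' Y]]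
    by (simp add: curvature_field_apply lie_bracket_add[OF X X' Y])
next
  note cv = covd_vfield[OF A] and tg = vfield_at_tangent
  fix f X assume f: "smooth_fun_at N S p f" and X: "vfield_at N S p X"
  note l = linear_on_subspaceD[OF conn_linear[OF A]]
  have "eventually (\<lambda>q. covd D (\<lambda>q. f q *\<^sub>R X q) Z q = f q *\<^sub>R covd D X Z q) (nhdsin S p)"
    using vfield_at_nbhd[OF X] vfield_at_nbhd[OF Z]
  proof eventually_elim
    case (elim q)
    show ?case using l(4)[OF elim(2) tg[OF elim(1)] tg[OF elim(1)]] by (simp add: covd_def)
  qed
  then have "D p (Y p) (covd D (\<lambda>q. f q *\<^sub>R X q) Z) = D p (Y p) (\<lambda>q. f q *\<^sub>R covd D X Z q)"
    by (intro conn_cong[OF A tg[OF Y]] cv vfield_at_scale X f Z)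
  also have "\<dots> = dir_deriv N S p (Y p) f *\<^sub>R covd D X Z p + f p *\<^sub>R D p (Y p) (covd D X Z)"
    by (intro conn_scale[OF A] tg Y cv X f Z)
  moreover have "D p (f p *\<^sub>R lie_bracket N S X Y p - dir_deriv N S p (Y p) f *\<^sub>R X p) Z
      = f p *\<^sub>R D p (lie_bracket N S X Y p) Z - dir_deriv N S p (Y p) f *\<^sub>R D p (X p) Z"
    using l(1)[OF Z lie_bracket_tangent[OF X Y] tg[OF X], of "f p" "- dir_deriv N S p (Y p) f"] by simp
  moreover have "D p (f p *\<^sub>R X p) (covd D Y Z) = f p *\<^sub>R D p (X p) (covd D Y Z)"
    by (rule l(4)[OF cv[OF Y Z] tg[OF X] tg[OF X]])
  ultimately show "curvature_field N S D (\<lambda>q. f q *\<^sub>R X q) Y Z p = f p *\<^sub>R curvature_field N S D X Y Z p"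
    unfolding curvature_field_apply lie_bracket_scale[OF f X Y]
    by (simp add: scaleR_right_diff_distrib covd_def[of D X Z])
next
  note cv = covd_vfield[OF A] and tg = vfield_at_tangent
  fix X X' assume X: "vfield_at N S p X" and X': "vfield_at N S p X'"
    and e: "eventually (\<lambda>q. X q = X' q) (nhdsin S p)"
  have "D p (Y p) (covd D X Z) = D p (Y p) (covd D X' Z)"
    by (rule conn_cong[OF A tg[OF Y] cv[OF X Z] covd_cong_left[OF e]])
  moreover have "lie_bracket N S X Y p = lie_bracket N S X' Y p"
    by (rule lie_bracket_cong[OF X e Y]) simp
  ultimately show "curvature_field N S D X Y Z p = curvature_field N S D X' Y Z p"
    using eventually_nhdsin_self[OF e vfield_at_topspace[OF X]] by (simp add: curvature_field_apply)
qed

text \<open>Derivatives of \<open>f\<close> along \<open>Y\<close> are taken at all points near p;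
  one ambient extension \<open>F\<close> serves them all, so Y f is near p the smooth function
  \<open>Y q F\<close>. This is what makes a second differentiation possible.\<close>

lemma covd_scale:
  assumes f: "smooth_fun_at N S p f" and Y: "vfield_at N S p Y" and Z: "vfield_at N S p Z"
  shows "smooth_fun_at N S p (\<lambda>q. dir_deriv N S q (Y q) f)"
    and "eventually (\<lambda>q. covd D Y (\<lambda>q. f q *\<^sub>R Z q) q
      = dir_deriv N S q (Y q) f *\<^sub>R Z q + f q *\<^sub>R covd D Y Z q) (nhdsin S p)"
    and "smooth_at N p F \<Longrightarrow> eventually (\<lambda>q. f q = F q) (nhdsin S p) \<Longrightarrow>
      eventually (\<lambda>q. dir_deriv N S q (Y q) f = Y q F) (nhdsin S p)"
proof -
  note tg = vfield_at_tangent and p = vfield_at_topspace[OF Y]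
  let ?h = "\<lambda>q. dir_deriv N S q (Y q) f"
  have *: "eventually (\<lambda>q. ?h q = Y q F) (nhdsin S p)"
    if F: "smooth_at N p F" "eventually (\<lambda>q. f q = F q) (nhdsin S p)" for F
    using vfield_at_nbhd[OF Y] nhdsin_ambient[OF smooth_at_eventually[OF F(1)]]
      eventually_nhdsin_open[OF F(2)] eventually_nhdsin_topspace
    by eventually_elim (rule dir_deriv_eq[OF tg])
  then show "smooth_at N p F \<Longrightarrow> eventually (\<lambda>q. f q = F q) (nhdsin S p) \<Longrightarrow>
      eventually (\<lambda>q. ?h q = Y q F) (nhdsin S p)" .
  obtain F where F: "smooth_at N p F" "eventually (\<lambda>q. f q = F q) (nhdsin S p)"
    by (rule smooth_fun_atE[OF f])
  show "smooth_fun_at N S p ?h"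
    by (rule smooth_fun_at_cong[OF vfield_at_smooth[OF Y F(1)]])
      (use *[OF F] in \<open>auto elim: eventually_mono\<close>)
  show "eventually (\<lambda>q. covd D Y (\<lambda>q. f q *\<^sub>R Z q) q = ?h q *\<^sub>R Z q + f q *\<^sub>R covd D Y Z q) (nhdsin S p)"
    using vfield_at_nbhd[OF Y] vfield_at_nbhd[OF Z] smooth_fun_at_nbhd[OF f]
    by eventually_elim (simp add: covd_def conn_scale[OF A tg])
qed

text \<open>In D_U D_W (f Z) the first-order terms (W f) D_U Z + (U f) D_W Z are symmetric in U and
  W and cancel. The second-order terms leave (X Y f - Y X f - [X, Y] f) Z, which vanishes by the
  definition of the bracket.\<close>

lemma curvature_field_tensor_right:
  assumes Z: "vfield_at N S p Z" "vfield_at N S p Z'" "Z p = Z' p"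
    and X: "vfield_at N S p X" and Y: "vfield_at N S p Y"
  shows "curvature_field N S D X Y Z p = curvature_field N S D X Y Z' p"
proof (rule tensorial[where \<Phi> = "\<lambda>Z. curvature_field N S D X Y Z p", OF _ _ _ Z])
  note cv = covd_vfield[OF A] and tg = vfield_at_tangent
  fix Z Z' assume Z: "vfield_at N S p Z" "vfield_at N S p Z'"
  have *: "D p (U p) (covd D W (Z + Z')) = D p (U p) (covd D W Z) + D p (U p) (covd D W Z')"
    if U: "vfield_at N S p U" and W: "vfield_at N S p W" for U W
  proof -
    have "eventually (\<lambda>q. covd D W (Z + Z') q = (covd D W Z + covd D W Z') q) (nhdsin S p)"
      using vfield_at_nbhd[OF W] vfield_at_nbhd[OF Z(1)] vfield_at_nbhd[OF Z(2)]
      by eventually_elim (simp add: covd_def conn_add[OF A tg])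
    then have "D p (U p) (covd D W (Z + Z')) = D p (U p) (covd D W Z + covd D W Z')"
      by (intro conn_cong[OF A tg[OF U]] cv vfield_at_add Z W)
    then show ?thesis using conn_add[OF A tg[OF U] cv[OF W Z(1)] cv[OF W Z(2)]] by simp
  qed
  show "curvature_field N S D X Y (Z + Z') p
      = curvature_field N S D X Y Z p + curvature_field N S D X Y Z' p"
    using *[OF X Y] *[OF Y X] conn_add[OF A lie_bracket_tangent[OF X Y] Z]
    by (simp add: curvature_field_apply)
next
  note cv = covd_vfield[OF A] and tg = vfield_at_tangent
  fix f Z assume f: "smooth_fun_at N S p f" and Z: "vfield_at N S p Z"
  note p = vfield_at_topspace[OF Z]
  obtain F where F: "smooth_at N p F" "eventually (\<lambda>q. f q = F q) (nhdsin S p)"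
    by (rule smooth_fun_atE[OF f])
  have *: "D p (U p) (covd D W (\<lambda>q. f q *\<^sub>R Z q)) = dir_deriv N S p (U p) (\<lambda>q. W q F) *\<^sub>R Z p
      + dir_deriv N S p (W p) f *\<^sub>R D p (U p) Z + dir_deriv N S p (U p) f *\<^sub>R D p (W p) Z
      + f p *\<^sub>R D p (U p) (covd D W Z)"
    if U: "vfield_at N S p U" and W: "vfield_at N S p W" for U W
  proof -
    define h where "h = (\<lambda>q. dir_deriv N S q (W q) f)"
    have h: "smooth_fun_at N S p h"
      "eventually (\<lambda>q. covd D W (\<lambda>q. f q *\<^sub>R Z q) q = h q *\<^sub>R Z q + f q *\<^sub>R covd D W Z q) (nhdsin S p)"
      "eventually (\<lambda>q. h q = W q F) (nhdsin S p)"
      unfolding h_def by (rule covd_scale[OF f W Z] covd_scale(3)[OF f W Z F])+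
    have v: "vfield_at N S p (\<lambda>q. h q *\<^sub>R Z q)" "vfield_at N S p (\<lambda>q. f q *\<^sub>R covd D W Z q)"
      by (intro vfield_at_scale h(1) f Z cv W)+
    have "D p (U p) (covd D W (\<lambda>q. f q *\<^sub>R Z q))
        = D p (U p) ((\<lambda>q. h q *\<^sub>R Z q) + (\<lambda>q. f q *\<^sub>R covd D W Z q))"
      by (rule conn_cong[OF A tg[OF U] cv[OF W vfield_at_scale[OF f Z]]])
        (use h(2) in \<open>auto elim: eventually_mono\<close>)
    also have "\<dots> = D p (U p) (\<lambda>q. h q *\<^sub>R Z q) + D p (U p) (\<lambda>q. f q *\<^sub>R covd D W Z q)"
      by (rule conn_add[OF A tg[OF U] v])
    also have "D p (U p) (\<lambda>q. h q *\<^sub>R Z q) = dir_deriv N S p (U p) h *\<^sub>R Z p + h p *\<^sub>R D p (U p) Z"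
      by (rule conn_scale[OF A tg[OF U] h(1) Z])
    also have "D p (U p) (\<lambda>q. f q *\<^sub>R covd D W Z q)
        = dir_deriv N S p (U p) f *\<^sub>R covd D W Z p + f p *\<^sub>R D p (U p) (covd D W Z)"
      by (rule conn_scale[OF A tg[OF U] f cv[OF W Z]])
    also have "dir_deriv N S p (U p) h = dir_deriv N S p (U p) (\<lambda>q. W q F)"
      by (rule dir_deriv_cong[OF tg[OF U] h(1,3)])
    also have "h p = dir_deriv N S p (W p) f" by (simp add: h_def)
    finally show ?thesis by (simp only: covd_def add.assoc)
  qed
  have "dir_deriv N S p (lie_bracket N S X Y p) f = lie_bracket N S X Y p F"
    by (rule dir_deriv_eq[OF lie_bracket_tangent[OF X Y] F p])
  also have "\<dots> = dir_deriv N S p (X p) (\<lambda>q. Y q F) - dir_deriv N S p (Y p) (\<lambda>q. X q F)"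
    by (rule lie_bracket_apply[OF F(1)])
  finally show "curvature_field N S D X Y (\<lambda>q. f q *\<^sub>R Z q) p = f p *\<^sub>R curvature_field N S D X Y Z p"
    using conn_scale[OF A lie_bracket_tangent[OF X Y] f Z]
    by (simp add: curvature_field_apply *[OF X Y] *[OF Y X] scaleR_right_diff_distrib scaleR_left_diff_distrib)
next
  note cv = covd_vfield[OF A] and tg = vfield_at_tangent
  fix Z Z' assume Z: "vfield_at N S p Z" "vfield_at N S p Z'"
    and e: "eventually (\<lambda>q. Z q = Z' q) (nhdsin S p)"
  have "D p (U p) (covd D W Z) = D p (U p) (covd D W Z')"
    if U: "vfield_at N S p U" and W: "vfield_at N S p W" for U W
    by (rule conn_cong[OF A tg[OF U] cv[OF W Z(1)] covd_cong_right[OF W Z(1) e]])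
  then show "curvature_field N S D X Y Z p = curvature_field N S D X Y Z' p"
    using conn_cong[OF A lie_bracket_tangent[OF X Y] Z(1) e] X Y by (simp add: curvature_field_apply)
qed

text \<open>The tensor \<open>curvature\<close> is defined by chosen local extensions; here they are
  replaced one argument at a time. Skew-symmetry moves the second argument into the first slot, so
  tensoriality there serves both.\<close>

lemma curvature_eq:
  assumes X: "vfield_at N S p X" and Y: "vfield_at N S p Y" and Z: "vfield_at N S p Z"
  shows "curvature N S D p (X p) (Y p) (Z p) = curvature_field N S D X Y Z p"
proof -
  note p = vfield_at_topspace[OF X]
  note e = local_ext[OF p]
  let ?X = "local_ext N S p (X p)" and ?Y = "local_ext N S p (Y p)" and ?Z = "local_ext N S p (Z p)"
  note tX = vfield_at_tangent[OF X] and tY = vfield_at_tangent[OF Y] and tZ = vfield_at_tangent[OF Z]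
  have "curvature_field N S D X Y Z p = curvature_field N S D ?X Y Z p"
    by (rule curvature_field_tensor_left[OF X e(1)[OF tX] _ Y Z]) (simp add: e(2)[OF tX])
  also have "\<dots> = - curvature_field N S D Y ?X Z p"
    using curvature_field_swap[OF e(1)[OF tX] Y Z] by simp
  also have "curvature_field N S D Y ?X Z p = curvature_field N S D ?Y ?X Z p"
    by (rule curvature_field_tensor_left[OF Y e(1)[OF tY] _ e(1)[OF tX] Z]) (simp add: e(2)[OF tY])
  also have "- curvature_field N S D ?Y ?X Z p = curvature_field N S D ?X ?Y Z p"
    using curvature_field_swap[OF e(1)[OF tX] e(1)[OF tY] Z] by simp
  also have "\<dots> = curvature_field N S D ?X ?Y ?Z p"
    by (rule curvature_field_tensor_right[OF Z e(1)[OF tZ] _ e(1)[OF tX] e(1)[OF tY]])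
      (simp add: e(2)[OF tZ])
  finally show ?thesis by (simp add: curvature_def)
qed

end

section \<open>Metrics, duality and uniqueness of the Levi-Civita connection\<close>

lemma metric_inner_space:
  "riemannian_metric N S g \<Longrightarrow> p \<in> topspace S \<Longrightarrow> inner_space (T p) (g p)"
  unfolding riemannian_metric_def inner_space_def using subspace_tangent[of p] by simp

lemma metric_smooth:
  "riemannian_metric N S g \<Longrightarrow> vfield_at N S p X \<Longrightarrow> vfield_at N S p Y \<Longrightarrow>
    smooth_fun_at N S p (\<lambda>q. g q (X q) (Y q))"
  using vfield_at_topspace[of N S p X] unfolding riemannian_metric_def by meson

lemma dual_connectionsD:
  "dual_connections N S g D Ds \<Longrightarrow> vfield_at N S p X \<Longrightarrow> vfield_at N S p Y \<Longrightarrow> vfield_at N S p Z \<Longrightarrow>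
    dir_deriv N S p (X p) (\<lambda>q. g q (Y q) (Z q)) = g p (D p (X p) Y) (Z p) + g p (Y p) (Ds p (X p) Z)"
  using vfield_at_topspace[of N S p X] unfolding dual_connections_def covd_def by meson

lemma dual_conn:
  assumes "dual_connections N S g D Ds" "x \<in> T p" "vfield_at N S p Y" "vfield_at N S p Z"
  shows "dir_deriv N S p x (\<lambda>q. g q (Y q) (Z q)) = g p (D p x Y) (Z p) + g p (Y p) (Ds p x Z)"
  using dual_connectionsD[OF assms(1) local_ext(1)[OF vfield_at_topspace[OF assms(3)] assms(2)] assms(3,4)]
  by (simp add: local_ext(2)[OF vfield_at_topspace[OF assms(3)] assms(2)])

text \<open>The difference of two such connections is symmetric in X, Y because both are
  torsion-free, and skew in Y, Z because both are metric. A trilinear form with these two symmetries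
  is zero.\<close>

lemma levi_civita_unique:
  assumes g: "riemannian_metric N S g"
    and D1: "is_levi_civita N S g D1" and D2: "is_levi_civita N S g D2"
    and X: "vfield_at N S p X" and Y: "vfield_at N S p Y"
  shows "D1 p (X p) Y = D2 p (X p) Y"
proof -
  note p = vfield_at_topspace[OF X]
  interpret inner_space "T p" "g p" by (rule metric_inner_space[OF g p])
  have A: "affine_connection N S D1" "affine_connection N S D2"
    and tf: "torsion_free N S D1" "torsion_free N S D2"
    and du: "dual_connections N S g D1 D1" "dual_connections N S g D2 D2"
    using D1 D2 by (auto simp: is_levi_civita_def)
  let ?C = "\<lambda>X Y. D1 p (X p) Y - D2 p (X p) Y"
  have cT: "D1 p (X p) Y \<in> T p" "D2 p (X p) Y \<in> T p" "?C X Y \<in> T p"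
    if "vfield_at N S p X" "vfield_at N S p Y" for X Y
    using conn_tangent[OF A(1) vfield_at_tangent[OF that(1)] that(2)]
      conn_tangent[OF A(2) vfield_at_tangent[OF that(1)] that(2)]
    by (simp_all add: subspace_diff[OF subspace_V])
  have s: "?C X Y = ?C Y X" if "vfield_at N S p X" "vfield_at N S p Y" for X Y
    using torsion_freeD[OF tf(1) that] torsion_freeD[OF tf(2) that] by (simp add: algebra_simps)
  have a: "g p (?C X Y) (Z p) = - g p (?C X Z) (Y p)"
    if "vfield_at N S p X" "vfield_at N S p Y" "vfield_at N S p Z" for X Y Z
    using dual_connectionsD[OF du(1) that] dual_connectionsD[OF du(2) that]
      cT[OF that(1,2)] cT[OF that(1,3)] vfield_at_tangent[OF that(2)] vfield_at_tangent[OF that(3)]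
      sym[of "Y p"] by (simp add: G_diff)
  \<comment> \<open>Alternating the skew and the symmetric exchange around the three arguments
    returns the form to itself with the opposite sign.\<close>
  have z: "g p (?C X Y) (Z p) = 0"
    if "vfield_at N S p X" "vfield_at N S p Y" "vfield_at N S p Z" for X Y Z
    using a[of X Y Z] a[of Z X Y] a[of Y Z X] s[of X Y] s[of Y Z] s[of X Z] that by simp
  have "?C X Y = 0"
  proof -
    have "g p (?C X Y) (?C X Y) = 0"
      using z[OF X Y local_ext(1)[OF p cT(3)[OF X Y]]] local_ext(2)[OF p cT(3)[OF X Y]] by simp
    then show ?thesis using G_eq_0[OF cT(3)[OF X Y]] by simp
  qed
  then show ?thesis by simp
qed

text \<open>Transfers the curvature between connections that agree on local fields; this is the
  sense in which the chosen Levi-Civita connection is unique.\<close>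

lemma curvature_field_cong:
  assumes A: "affine_connection N S D1" "torsion_free N S D1"
    and A2: "affine_connection N S D2"
    and e: "\<And>q X Y. vfield_at N S q X \<Longrightarrow> vfield_at N S q Y \<Longrightarrow> D1 q (X q) Y = D2 q (X q) Y"
    and X: "vfield_at N S p X" and Y: "vfield_at N S p Y" and Z: "vfield_at N S p Z"
  shows "curvature_field N S D1 X Y Z p = curvature_field N S D2 X Y Z p"
proof -
  have e': "D1 q x Y = D2 q x Y" if "x \<in> T q" "vfield_at N S q Y" for q x Y
    using e[OF local_ext(1)[OF vfield_at_topspace[OF that(2)] that(1)] that(2)]
    by (simp add: local_ext(2)[OF vfield_at_topspace[OF that(2)] that(1)])
  have "D1 p (U p) (covd D1 W Z) = D2 p (U p) (covd D2 W Z)"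
    if U: "vfield_at N S p U" and W: "vfield_at N S p W" for U W
  proof -
    have ev: "eventually (\<lambda>q. covd D1 W Z q = covd D2 W Z q) (nhdsin S p)"
      using vfield_at_nbhd[OF W] vfield_at_nbhd[OF Z]
      unfolding covd_def by eventually_elim (rule e)
    have "D1 p (U p) (covd D1 W Z) = D2 p (U p) (covd D1 W Z)"
      by (rule e[OF U covd_vfield[OF A(1) W Z]])
    also have "\<dots> = D2 p (U p) (covd D2 W Z)"
      by (rule conn_cong[OF A2 vfield_at_tangent[OF U] covd_vfield[OF A(1) W Z] ev])
    finally show ?thesis .
  qed
  then show ?thesis
    using X Y e'[OF lie_bracket_tangent[OF A X Y] Z] by (simp add: curvature_field_apply)
qed

end

section \<open>Induced connections\<close>

locale riemannian_submanifold = submanifold N S n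
  for N :: "('a, 'e::euclidean_space) smooth_mfd" and S n +
  fixes g :: "'a tmetric"
  assumes metric: "riemannian_metric N (mtop N) g"
begin

abbreviation TN :: "'a \<Rightarrow> 'a tvec set" where "TN \<equiv> tangent_space N (mtop N)"

abbreviation tanp :: "'a \<Rightarrow> 'a tvec \<Rightarrow> 'a tvec" where "tanp \<equiv> tangential_part N S g"

lemma topspace_ambient: "p \<in> topspace S \<Longrightarrow> p \<in> topspace (mtop N)"
  using topspace_subset by blast

lemma inner_ambient: "p \<in> topspace S \<Longrightarrow> inner_space (TN p) (g p)"
  by (rule amb.metric_inner_space[OF metric topspace_ambient])

lemma smooth_fun_at_of_ambient:
  "p \<in> topspace S \<Longrightarrow> smooth_fun_at N (mtop N) p f \<Longrightarrow> smooth_fun_at N S p f"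
  by (erule amb.smooth_fun_atE) (rule smooth_fun_atI[OF _ _ nhdsin_ambient])

lemma dir_deriv_ambient:
  assumes p: "p \<in> topspace S" and v: "v \<in> T p" and f: "smooth_fun_at N (mtop N) p f"
  shows "dir_deriv N (mtop N) p v f = dir_deriv N S p v f"
proof -
  obtain F where F: "smooth_at N p F" "eventually (\<lambda>q. f q = F q) (nhdsin (mtop N) p)"
    by (rule amb.smooth_fun_atE[OF f])
  have "v \<in> TN p" using v tangent_subset by blast
  from amb.dir_deriv_eq[OF this F topspace_ambient[OF p]] show ?thesis
    using dir_deriv_eq[OF v F(1) nhdsin_ambient[OF F(2)] p] by simp
qed

lemma metric_S: "riemannian_metric N S g"
  unfolding riemannian_metric_def
proof (intro ballI conjI allI impI)
  fix p assume p: "p \<in> topspace S"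
  interpret inner_space "TN p" "g p" by (rule inner_ambient[OF p])
  note sub = subsetD[OF tangent_subset[of p]]
  show "linear_on_subspace (T p) (g p u)" if "u \<in> T p" for u
    using linear_G[OF sub[OF that]] sub unfolding linear_on_subspace_def by metis
  show "g p u v = g p v u" if "u \<in> T p" "v \<in> T p" for u v by (rule sym[OF that[THEN sub]])
  show "g p u u > 0" if "u \<in> T p" "u \<noteq> 0" for u by (rule pos[OF sub[OF that(1)] that(2)])
  fix X Y assume X: "vfield_at N S p X" and Y: "vfield_at N S p Y"
  show "smooth_fun_at N S p (\<lambda>q. g q (X q) (Y q))"
  proof (rule smooth_fun_at_cong)
    show "smooth_fun_at N S p (\<lambda>q. g q (ambient_ext N S p X q) (ambient_ext N S p Y q))"
      by (intro smooth_fun_at_of_ambient p amb.metric_smooth[OF metric] ambient_ext X Y)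
    show "eventually (\<lambda>q. g q (ambient_ext N S p X q) (ambient_ext N S p Y q) = g q (X q) (Y q)) (nhdsin S p)"
      using ambient_ext(2)[OF X] ambient_ext(2)[OF Y] by eventually_elim simp
  qed
qed

lemma metric_smooth_mixed:
  assumes V: "vfield_at N (mtop N) p V" and X: "vfield_at N S p X"
  shows "smooth_fun_at N S p (\<lambda>q. g q (V q) (X q))"
proof (rule smooth_fun_at_cong)
  show "smooth_fun_at N S p (\<lambda>q. g q (V q) (ambient_ext N S p X q))"
    by (intro smooth_fun_at_of_ambient vfield_at_topspace[OF X] amb.metric_smooth[OF metric]
        ambient_ext V X)
  show "eventually (\<lambda>q. g q (V q) (ambient_ext N S p X q) = g q (V q) (X q)) (nhdsin S p)"
    using ambient_ext(2)[OF X] by eventually_elim simp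
qed

section \<open>Orthogonal projection to the tangent spaces of the submanifold\<close>

lemma tanp_ex1:
  assumes p: "p \<in> topspace S" and v: "v \<in> TN p"
  shows "\<exists>!w. w \<in> T p \<and> (\<forall>u \<in> T p. g p (v - w) u = 0)"
proof -
  interpret inner_space "TN p" "g p" by (rule inner_ambient[OF p])
  obtain B where B: "finite B" "span B = T p" using tangent_space_basis[OF p] by metis
  show ?thesis by (rule projection_ex1[OF B(2)[symmetric] B(1) tangent_subset v])
qed

lemma tanp:
  assumes p: "p \<in> topspace S" and v: "v \<in> TN p"
  shows "tanp p v \<in> T p" and "u \<in> T p \<Longrightarrow> g p (v - tanp p v) u = 0"
  using theI'[OF tanp_ex1[OF assms]] unfolding tangential_part_def by auto

lemma tanp_unique:
  assumes "p \<in> topspace S" "v \<in> TN p" "w \<in> T p" "\<And>u. u \<in> T p \<Longrightarrow> g p (v - w) u = 0"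
  shows "tanp p v = w"
  unfolding tangential_part_def by (rule the1_equality[OF tanp_ex1[OF assms(1,2)]]) (use assms in blast)

lemma tanp_tangent: "p \<in> topspace S \<Longrightarrow> v \<in> T p \<Longrightarrow> tanp p v = v"
proof (rule tanp_unique)
  assume p: "p \<in> topspace S"
  interpret inner_space "TN p" "g p" by (rule inner_ambient[OF p])
  show "g p (v - v) u = 0" if "u \<in> T p" for u using that G_zero tangent_subset[of p] by auto
qed (use tangent_subset in auto)

lemma tanp_inner:
  assumes p: "p \<in> topspace S" and v: "v \<in> TN p" and u: "u \<in> T p"
  shows "g p (tanp p v) u = g p v u"
proof -
  interpret inner_space "TN p" "g p" by (rule inner_ambient[OF p])
  show ?thesis
    using tanp(2)[OF p v u] G_diff(2)[OF v subsetD[OF tangent_subset tanp(1)[OF p v]]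
        subsetD[OF tangent_subset u]] by simp
qed

lemma tanp_linear: "p \<in> topspace S \<Longrightarrow> linear_on_subspace (TN p) (tanp p)"
  unfolding linear_on_subspace_def
proof (intro ballI allI)
  fix u v a b assume p: "p \<in> topspace S" and u: "u \<in> TN p" and v: "v \<in> TN p"
  interpret inner_space "TN p" "g p" by (rule inner_ambient[OF p])
  note sub = subsetD[OF tangent_subset[of p]]
  note t = tanp(1)[OF p u] tanp(1)[OF p v]
  have c: "x \<in> TN p \<Longrightarrow> y \<in> TN p \<Longrightarrow> a *\<^sub>R x + b *\<^sub>R y \<in> TN p" for x y
    by (intro subspace_add subspace_scale subspace_V)
  show "tanp p (a *\<^sub>R u + b *\<^sub>R v) = a *\<^sub>R tanp p u + b *\<^sub>R tanp p v"
  proof (rule tanp_unique[OF p])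
    show "a *\<^sub>R u + b *\<^sub>R v \<in> TN p" using c u v by simp
    show "a *\<^sub>R tanp p u + b *\<^sub>R tanp p v \<in> T p"
      by (intro subspace_add subspace_scale subspace_tangent p t)
    fix w assume w: "w \<in> T p"
    have *: "g p (a *\<^sub>R x + b *\<^sub>R y) w = a * g p x w + b * g p y w" if "x \<in> TN p" "y \<in> TN p" for x y
      using linear_on_subspaceD(1)[OF linear_G_left[OF sub[OF w]] that] by simp
    show "g p (a *\<^sub>R u + b *\<^sub>R v - (a *\<^sub>R tanp p u + b *\<^sub>R tanp p v)) w = 0"
      using G_diff(2)[OF c[OF u v] c[OF sub[OF t(1)] sub[OF t(2)]] sub[OF w]]
      by (simp add: *[OF u v] *[OF sub[OF t(1)] sub[OF t(2)]] tanp_inner[OF p u w] tanp_inner[OF p v w])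
  qed
qed

text \<open>Gram--Schmidt applied to a coordinate frame, without normalisation: this way only quotients of
  smooth functions occur.\<close>

lemma orthogonal_frame:
  assumes p: "p \<in> topspace S"
  obtains B :: "'e set" and F :: "'e \<Rightarrow> 'a vfield"
  where "finite B" "\<And>b. b \<in> B \<Longrightarrow> vfield_at N S p (F b)"
    "eventually (\<lambda>q. (\<forall>b\<in>B. \<forall>b'\<in>B. b \<noteq> b' \<longrightarrow> g q (F b q) (F b' q) = 0) \<and>
      (\<forall>b\<in>B. g q (F b q) (F b q) \<noteq> 0) \<and> T q \<subseteq> span ((\<lambda>b. F b q) ` B)) (nhdsin S p)"
proof -
  obtain B :: "'e set" and E \<kappa> where fB: "finite B"
    and E: "\<And>b. b \<in> B \<Longrightarrow> vfield_at N S p (E b)"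
    and ex: "eventually (\<lambda>q. \<forall>v \<in> T q. v = (\<Sum>b\<in>B. v (\<kappa> b) *\<^sub>R E b q)) (nhdsin S p)"
    and dl: "eventually (\<lambda>q. \<forall>b\<in>B. \<forall>b'\<in>B. E b q (\<kappa> b') = (if b = b' then 1 else 0)) (nhdsin S p)"
    by (rule coordinate_frame[OF p]) (rule that)
  have "\<exists>F. (\<forall>b\<in>A. vfield_at N S p (F b)) \<and>
    eventually (\<lambda>q. (\<forall>b\<in>A. \<forall>b'\<in>A. b \<noteq> b' \<longrightarrow> g q (F b q) (F b' q) = 0) \<and>
      (\<forall>b\<in>A. g q (F b q) (F b q) \<noteq> 0) \<and>
      span ((\<lambda>b. F b q) ` A) = span ((\<lambda>b. E b q) ` A)) (nhdsin S p)"
    if "finite A" "A \<subseteq> B" for A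
    using that
  proof (induction A)
    case empty
    show ?case by simp
  next
    case (insert c A)
    then obtain F where F: "\<And>b. b \<in> A \<Longrightarrow> vfield_at N S p (F b)"
      and ev: "eventually (\<lambda>q. (\<forall>b\<in>A. \<forall>b'\<in>A. b \<noteq> b' \<longrightarrow> g q (F b q) (F b' q) = 0) \<and>
        (\<forall>b\<in>A. g q (F b q) (F b q) \<noteq> 0) \<and>
        span ((\<lambda>b. F b q) ` A) = span ((\<lambda>b. E b q) ` A)) (nhdsin S p)" by auto
    have Ec: "vfield_at N S p (E c)" using E insert.prems by blast
    let ?k = "\<lambda>b q. g q (E c q) (F b q) * inverse (g q (F b q) (F b q))"
    let ?H = "E c - (\<lambda>q. \<Sum>b\<in>A. ?k b q *\<^sub>R F b q)"
    have H: "vfield_at N S p ?H"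
    proof (intro vfield_at_diff Ec vfield_at_sum p vfield_at_scale smooth_fun_at_mult
        smooth_fun_at_inverse metric_smooth[OF metric_S])
      show "g p (F b p) (F b p) \<noteq> 0" if "b \<in> A" for b
        using eventually_nhdsin_self[OF ev p] that by blast
    qed (use F in auto)
    let ?F = "F(c := ?H)"
    have "eventually (\<lambda>q. (\<forall>b\<in>insert c A. \<forall>b'\<in>insert c A. b \<noteq> b' \<longrightarrow> g q (?F b q) (?F b' q) = 0) \<and>
        (\<forall>b\<in>insert c A. g q (?F b q) (?F b q) \<noteq> 0) \<and>
        span ((\<lambda>b. ?F b q) ` insert c A) = span ((\<lambda>b. E b q) ` insert c A)) (nhdsin S p)"
    proof -
      have "eventually (\<lambda>q. \<forall>b\<in>A. vfield_at N S q (F b)) (nhdsin S p)"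
        using vfield_at_nbhd[OF F] insert.hyps(1) by (simp add: eventually_ball_finite)
      then show ?thesis
        using ev dl vfield_at_nbhd[OF Ec] eventually_nhdsin_topspace
      proof eventually_elim
        case (elim q)
        interpret inner_space "T q" "g q" by (rule metric_inner_space[OF metric_S elim(5)])
        have FT: "F b q \<in> T q" if "b \<in> A" for b using elim(1) that vfield_at_tangent by metis
        have ET: "E c q \<in> T q" by (rule vfield_at_tangent[OF elim(4)])
        define s where "s = (\<Sum>b\<in>A. ?k b q *\<^sub>R F b q)"
        have Hq: "?H q = E c q - s" by (simp add: s_def)
        have sT: "s \<in> T q" unfolding s_def by (intro subspace_sum subspace_scale subspace_V FT)
        have HT: "?H q \<in> T q" unfolding Hq by (rule subspace_diff[OF subspace_V ET sT])
        have o: "g q (?H q) (F b q) = 0" if b: "b \<in> A" for b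
        proof -
          have "g q s (F b q) = (\<Sum>b'\<in>A. ?k b' q * g q (F b' q) (F b q))"
            unfolding s_def by (rule G_sum) (use FT b in auto)
          also have "\<dots> = (\<Sum>b'\<in>A. if b' = b then ?k b q * g q (F b q) (F b q) else 0)"
            by (intro sum.cong refl) (use elim(2) b in auto)
          also have "\<dots> = g q (E c q) (F b q)" using insert.hyps(1) b elim(2) by simp
          finally show ?thesis unfolding Hq using G_diff(2)[OF ET sT FT[OF b]] by simp
        qed
        have cA: "b \<noteq> c" if "b \<in> A" for b using that insert.hyps by blast
        have sspan: "s \<in> span ((\<lambda>b. E b q) ` A)"
        proof -
          have "s \<in> span ((\<lambda>b. F b q) ` A)"
            unfolding s_def by (intro span_sum span_scale span_base) auto
          then show ?thesis using elim(2) by simp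
        qed
        \<comment> \<open>The coordinate function \<open>\<kappa> c\<close> is killed by the earlier
          frame vectors and has value 1 on \<open>E c q\<close>. Hence the new vector is nonzero at
          every nearby point, not only at p.\<close>
        have "span ((\<lambda>b. E b q) ` A) \<subseteq> {v. v (\<kappa> c) = 0}"
        proof (rule span_minimal)
          show "(\<lambda>b. E b q) ` A \<subseteq> {v. v (\<kappa> c) = 0}"
            using elim(3) insert.prems cA by auto
          show "subspace {v. v (\<kappa> c) = 0}" by (auto simp: subspace_def)
        qed
        moreover have "E c q (\<kappa> c) = 1" using elim(3) insert.prems by auto
        ultimately have "E c q \<notin> span ((\<lambda>b. E b q) ` A)" by auto
        then have "?H q \<noteq> 0" using sspan unfolding Hq by auto
        then have nz: "g q (?H q) (?H q) \<noteq> 0" using G_eq_0[OF HT] by simp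
        have FA: "(\<lambda>b. ?F b q) ` A = (\<lambda>b. F b q) ` A"
          using cA by (intro image_cong) auto
        have sp: "span (insert (?H q) ((\<lambda>b. F b q) ` A)) = span (insert (E c q) ((\<lambda>b. E b q) ` A))"
        proof -
          have FE: "span ((\<lambda>b. F b q) ` A) = span ((\<lambda>b. E b q) ` A)" using elim(2) by blast
          have "span (insert (?H q) ((\<lambda>b. F b q) ` A)) = span (insert (?H q) ((\<lambda>b. E b q) ` A))"
            unfolding span_insert FE ..
          also have "\<dots> = span (insert (E c q) ((\<lambda>b. E b q) ` A))"
            unfolding span_eq
          proof (intro conjI)
            have s1: "s \<in> span (insert x ((\<lambda>b. E b q) ` A))" for x
              using sspan span_mono[OF subset_insertI] by blast
            show "insert (?H q) ((\<lambda>b. E b q) ` A) \<subseteq> span (insert (E c q) ((\<lambda>b. E b q) ` A))"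
              unfolding Hq by (auto intro: span_base span_diff s1)
            have "E c q = (E c q - s) + s" by simp
            then have "E c q \<in> span (insert (E c q - s) ((\<lambda>b. E b q) ` A))"
              using span_add[OF span_base s1, of "E c q - s"] by (metis insertI1)
            then show "insert (E c q) ((\<lambda>b. E b q) ` A) \<subseteq> span (insert (?H q) ((\<lambda>b. E b q) ` A))"
              unfolding Hq by (auto intro: span_base)
          qed
          finally show ?thesis .
        qed
        show ?case
        proof (intro conjI ballI impI)
          fix b b' assume "b \<in> insert c A" "b' \<in> insert c A" "b \<noteq> b'"
          then show "g q (?F b q) (?F b' q) = 0"
            using elim(2) o sym[OF HT FT] by auto
        next
          fix b assume "b \<in> insert c A"
          then show "g q (?F b q) (?F b q) \<noteq> 0" using elim(2) nz by auto
        next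
          show "span ((\<lambda>b. ?F b q) ` insert c A) = span ((\<lambda>b. E b q) ` insert c A)"
            using sp FA by simp
        qed
      qed
    qed
    moreover have "\<forall>b\<in>insert c A. vfield_at N S p (?F b)" using F H by auto
    ultimately show ?case by blast
  qed
  from this[OF fB subset_refl] obtain F where F: "\<And>b. b \<in> B \<Longrightarrow> vfield_at N S p (F b)"
      and ev: "eventually (\<lambda>q. (\<forall>b\<in>B. \<forall>b'\<in>B. b \<noteq> b' \<longrightarrow> g q (F b q) (F b' q) = 0) \<and>
        (\<forall>b\<in>B. g q (F b q) (F b q) \<noteq> 0) \<and>
        span ((\<lambda>b. F b q) ` B) = span ((\<lambda>b. E b q) ` B)) (nhdsin S p)" by auto
  show thesis
  proof (rule that[OF fB F])
    show "eventually (\<lambda>q. (\<forall>b\<in>B. \<forall>b'\<in>B. b \<noteq> b' \<longrightarrow> g q (F b q) (F b' q) = 0) \<and>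
      (\<forall>b\<in>B. g q (F b q) (F b q) \<noteq> 0) \<and> T q \<subseteq> span ((\<lambda>b. F b q) ` B)) (nhdsin S p)"
      using ev ex
    proof eventually_elim
      case (elim q)
      have "T q \<subseteq> span ((\<lambda>b. E b q) ` B)"
      proof
        fix v assume "v \<in> T q"
        then have "v = (\<Sum>b\<in>B. v (\<kappa> b) *\<^sub>R E b q)" using elim(2) by blast
        moreover have "\<dots> \<in> span ((\<lambda>b. E b q) ` B)" by (intro span_sum span_scale span_base) auto
        ultimately show "v \<in> span ((\<lambda>b. E b q) ` B)" by simp
      qed
      then show ?case using elim(1) by auto
    qed
  qed
qed

text \<open>In an orthogonal frame F_b the projection of V is the sum of g(V, F_b) / g(F_b, F_b)
  F_b, whose coefficients are smooth. It yields the smoothness of covariant derivatives for the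
  induced connection.\<close>

lemma vfield_at_tanp:
  assumes p: "p \<in> topspace S" and V: "vfield_at N (mtop N) p V"
  shows "vfield_at N S p (\<lambda>q. tanp q (V q))"
proof -
  obtain B :: "'e set" and F where fB: "finite B" and F: "\<And>b. b \<in> B \<Longrightarrow> vfield_at N S p (F b)"
    and ev: "eventually (\<lambda>q. (\<forall>b\<in>B. \<forall>b'\<in>B. b \<noteq> b' \<longrightarrow> g q (F b q) (F b' q) = 0) \<and>
      (\<forall>b\<in>B. g q (F b q) (F b q) \<noteq> 0) \<and> T q \<subseteq> span ((\<lambda>b. F b q) ` B)) (nhdsin S p)"
    by (rule orthogonal_frame[OF p]) (rule that)
  let ?k = "\<lambda>b q. g q (V q) (F b q) * inverse (g q (F b q) (F b q))"
  show ?thesis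
  proof (rule vfield_at_cong)
    show "vfield_at N S p (\<lambda>q. \<Sum>b\<in>B. ?k b q *\<^sub>R F b q)"
    proof (intro vfield_at_sum p vfield_at_scale smooth_fun_at_mult metric_smooth_mixed[OF V]
        smooth_fun_at_inverse metric_smooth[OF metric_S] F)
      show "g p (F b p) (F b p) \<noteq> 0" if "b \<in> B" for b
        using eventually_nhdsin_self[OF ev p] that by blast
    qed
    have "eventually (\<lambda>q. \<forall>b\<in>B. vfield_at N S q (F b)) (nhdsin S p)"
      using vfield_at_nbhd[OF F] fB by (simp add: eventually_ball_finite)
    then show "eventually (\<lambda>q. (\<Sum>b\<in>B. ?k b q *\<^sub>R F b q) = tanp q (V q)) (nhdsin S p)"
      using ev nhdsin_ambient[OF vfield_at_nbhd[OF V]] eventually_nhdsin_topspace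
    proof eventually_elim
      case (elim q)
      interpret inner_space "TN q" "g q" by (rule inner_ambient[OF elim(4)])
      have FT: "F b q \<in> T q" if "b \<in> B" for b using elim(1) that vfield_at_tangent by metis
      have FN: "F b q \<in> TN q" if "b \<in> B" for b using FT[OF that] tangent_subset by blast
      have VN: "V q \<in> TN q" by (rule vfield_at_tangent[OF elim(3)])
      define s where "s = (\<Sum>b\<in>B. ?k b q *\<^sub>R F b q)"
      have sT: "s \<in> T q" unfolding s_def by (intro subspace_sum subspace_scale subspace_tangent elim(4) FT)
      then have sN: "s \<in> TN q" using tangent_subset by blast
      have o: "g q (V q - s) (F b q) = 0" if b: "b \<in> B" for b
      proof -
        have "g q s (F b q) = (\<Sum>b'\<in>B. ?k b' q * g q (F b' q) (F b q))"
          unfolding s_def by (rule G_sum) (use FN b in auto)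
        also have "\<dots> = (\<Sum>b'\<in>B. if b' = b then ?k b q * g q (F b q) (F b q) else 0)"
          by (intro sum.cong refl) (use elim(2) b in auto)
        also have "\<dots> = g q (V q) (F b q)" using fB b elim(2) by simp
        finally show ?thesis using G_diff(2)[OF VN sN FN[OF b]] by simp
      qed
      have dN: "V q - s \<in> TN q" by (rule subspace_diff[OF subspace_V VN sN])
      have "span ((\<lambda>b. F b q) ` B) \<subseteq> {u \<in> TN q. g q (V q - s) u = 0}"
      proof (rule span_minimal)
        show "(\<lambda>b. F b q) ` B \<subseteq> {u \<in> TN q. g q (V q - s) u = 0}" using o FN by auto
        show "subspace {u \<in> TN q. g q (V q - s) u = 0}"
          using dN subspace_V unfolding subspace_def by (auto simp: G_add G_scale G_zero)
      qed
      then have "g q (V q - s) u = 0" if "u \<in> T q" for u using elim(2) that by blast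
      from tanp_unique[OF elim(4) VN sT this] show ?case by (simp add: s_def)
    qed
  qed
qed

text \<open>Both terms of the bracket differentiate in directions tangent to \<open>S\<close>, so
  only the values of the functions along \<open>S\<close> matter and any extensions give the same
  result.\<close>

lemma lie_bracket_ambient:
  assumes X: "vfield_at N S p X" "vfield_at N (mtop N) p X'" "eventually (\<lambda>q. X q = X' q) (nhdsin S p)"
    and Y: "vfield_at N S p Y" "vfield_at N (mtop N) p Y'" "eventually (\<lambda>q. Y q = Y' q) (nhdsin S p)"
  shows "lie_bracket N S X Y p = lie_bracket N (mtop N) X' Y' p"
proof (rule ext)
  note p = vfield_at_topspace[OF X(1)]
  have *: "dir_deriv N S p (U p) (\<lambda>q. W q F) = dir_deriv N (mtop N) p (U' p) (\<lambda>q. W' q F)"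
    if F: "smooth_at N p F" and U: "vfield_at N S p U" "eventually (\<lambda>q. U q = U' q) (nhdsin S p)"
      and W: "vfield_at N S p W" "vfield_at N (mtop N) p W'" "eventually (\<lambda>q. W q = W' q) (nhdsin S p)"
    for F U U' W W'
  proof -
    have "dir_deriv N S p (U p) (\<lambda>q. W q F) = dir_deriv N S p (U p) (\<lambda>q. W' q F)"
      by (rule dir_deriv_cong[OF vfield_at_tangent[OF U(1)] vfield_at_smooth[OF W(1) F]])
        (use W(3) in \<open>auto elim: eventually_mono\<close>)
    also have "\<dots> = dir_deriv N (mtop N) p (U p) (\<lambda>q. W' q F)"
      by (rule dir_deriv_ambient[OF p vfield_at_tangent[OF U(1)] vfield_at_smooth[OF W(2) F], symmetric])
    finally show ?thesis using eventually_nhdsin_self[OF U(2) p] by simp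
  qed
  fix F show "lie_bracket N S X Y p F = lie_bracket N (mtop N) X' Y' p F"
    using *[OF _ X(1,3) Y] *[OF _ Y(1,3) X]
    by (cases "smooth_at N p F") (simp_all add: lie_bracket_def)
qed

text \<open>The coordinates of a slice chart that are transversal to the slice are constant along \<open>S\<close>,
  hence annihilated by brackets of fields tangent to \<open>S\<close>.\<close>

lemma lie_bracket_in_tangent:
  assumes X: "vfield_at N S p X" and Y: "vfield_at N S p Y"
    and TN: "lie_bracket N S X Y p \<in> TN p"
  shows "lie_bracket N S X Y p \<in> T p"
proof -
  note p = vfield_at_topspace[OF X]
  obtain W U \<phi> L where s: "slice N S W U \<phi> L" "p \<in> W"
    using immersed_submanifold_slice[OF immersed p] by metis
  note c = sliceD(2)[OF s(1)]
  have pU: "p \<in> U" using slice_topspace[OF s] by simp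
  obtain a where a: "lie_bracket N S X Y p = tanvec N U \<phi> p a"
    using TN tangent_tanvec[OF c pU] by blast
  obtain y z where yz: "y \<in> span L" "\<And>w. w \<in> span L \<Longrightarrow> orthogonal z w" "a = y + z"
    using orthogonal_subspace_decomp_exists by metis
  have sL: "span L = L" using sliceD(5)[OF s(1)] by (simp add: span_eq_iff)
  let ?F = "\<lambda>r. \<phi> r \<bullet> z"
  have sF: "smooth_at N p ?F" by (rule smooth_at_coordinate[OF c pU])
  have evW: "eventually (\<lambda>q. q \<in> W) (nhdsin S p)"
    unfolding eventually_nhdsin using s(2) sliceD(1)[OF s(1)] by blast
  have z0: "eventually (\<lambda>q. V q ?F = 0) (nhdsin S p)" if "vfield_at N S p V" for V
    using vfield_at_nbhd[OF that] evW
  proof eventually_elim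
    case (elim q)
    obtain b where b: "b \<in> L" "V q = tanvec N U \<phi> q b"
      using vfield_at_tangent[OF elim(1)] tangent_space_slice[OF s(1) elim(2)] by blast
    have "q \<in> U" using slice_topspace[OF s(1) elim(2)] by simp
    then show ?case
      using tanvec_coordinate[OF c, of q b z] yz(2)[of b] b sL
      by (simp add: orthogonal_def inner_commute)
  qed
  have d0: "dir_deriv N S p v (\<lambda>q. V q ?F) = 0" if "v \<in> T p" "vfield_at N S p V" for v V
    using dir_deriv_cong[OF that(1) vfield_at_smooth[OF that(2) sF] z0[OF that(2)]]
      dir_deriv_const[OF that(1) p] by simp
  have "lie_bracket N S X Y p ?F = 0"
    using d0 X Y by (simp add: lie_bracket_apply[OF sF] vfield_at_tangent)
  then have "a \<bullet> z = 0" unfolding a by (simp add: tanvec_coordinate[OF c pU])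
  then have "z = 0"
    using yz(2)[OF yz(1)] unfolding yz(3)
    by (simp add: inner_add_left inner_add_right orthogonal_def inner_commute)
  then have "a \<in> L" using yz sL by simp
  then show ?thesis unfolding a tangent_space_slice[OF s] by blast
qed

end

text \<open>The assumptions are symmetric in the two connections and also hold when both are the
  Levi-Civita connection. Each result below is therefore used three times: for \<open>D\<close>, for
  \<open>Ds\<close>, and for the Levi-Civita connection as its own dual.\<close>

locale dual_pair = riemannian_submanifold N S n g
  for N :: "('a, 'e::euclidean_space) smooth_mfd" and S n g +
  fixes D Ds :: "'a connection"
  assumes aff: "affine_connection N (mtop N) D" and affs: "affine_connection N (mtop N) Ds"
    and tf: "torsion_free N (mtop N) D" and tfs: "torsion_free N (mtop N) Ds"
    and dual: "dual_connections N (mtop N) g D Ds"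
begin

lemma dual_pair_swap: "dual_pair N S n g Ds D"
proof unfold_locales
  show "dual_connections N (mtop N) g Ds D"
    unfolding dual_connections_def
  proof (intro ballI allI impI)
    fix p X Y Z assume p: "p \<in> topspace (mtop N)" and X: "vfield_at N (mtop N) p X"
      and Y: "vfield_at N (mtop N) p Y" and Z: "vfield_at N (mtop N) p Z"
    have sm: "g q u v = g q v u" if "q \<in> topspace (mtop N)" "u \<in> TN q" "v \<in> TN q" for q u v
      using inner_space.sym[OF amb.metric_inner_space[OF metric that(1)] that(2,3)] .
    note t = vfield_at_tangent
    have "dir_deriv N (mtop N) p (X p) (\<lambda>q. g q (Y q) (Z q))
        = dir_deriv N (mtop N) p (X p) (\<lambda>q. g q (Z q) (Y q))"
    proof (rule amb.dir_deriv_cong[OF t[OF X] amb.metric_smooth[OF metric Y Z]])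
      show "eventually (\<lambda>q. g q (Y q) (Z q) = g q (Z q) (Y q)) (nhdsin (mtop N) p)"
        using vfield_at_nbhd[OF Y] vfield_at_nbhd[OF Z]
        by eventually_elim (rule sm[OF vfield_at_topspace t t])
    qed
    also have "\<dots> = g p (D p (X p) Z) (Y p) + g p (Z p) (Ds p (X p) Y)"
      by (rule amb.dual_connectionsD[OF dual X Z Y])
    also have "\<dots> = g p (covd Ds X Y p) (Z p) + g p (Y p) (covd D X Z p)"
      using sm[OF p amb.conn_tangent[OF aff t[OF X] Z] t[OF Y]]
        sm[OF p t[OF Z] amb.conn_tangent[OF affs t[OF X] Y]] by (simp add: covd_def)
    finally show "dir_deriv N (mtop N) p (X p) (\<lambda>q. g q (Y q) (Z q))
        = g p (covd Ds X Y p) (Z p) + g p (Y p) (covd D X Z p)" .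
  qed
qed (fact affs aff tfs tf)+

lemma tangent_TN: "v \<in> T p \<Longrightarrow> v \<in> TN p"
  using tangent_subset by blast

text \<open>By duality, \<open>g (D\<^sub>x Y) W = x (g Y W) - g Y (Ds\<^sub>x W)\<close> only involves the values of \<open>Y\<close> along \<open>S\<close>.\<close>

lemma conn_along:
  assumes x: "x \<in> T p" and Y: "vfield_at N (mtop N) p Y" "vfield_at N (mtop N) p Y'"
    and e: "eventually (\<lambda>q. Y q = Y' q) (nhdsin S p)" and p: "p \<in> topspace S"
  shows "D p x Y = D p x Y'"
proof -
  interpret inner_space "TN p" "g p" by (rule inner_ambient[OF p])
  note pN = topspace_ambient[OF p]
  have xN: "x \<in> TN p" by (rule tangent_TN[OF x])
  show ?thesis
  proof (rule G_eqI)
    fix w assume w: "w \<in> TN p"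
    let ?W = "local_ext N (mtop N) p w"
    have W: "vfield_at N (mtop N) p ?W" "?W p = w" using amb.local_ext[OF pN w] by auto
    have "dir_deriv N (mtop N) p x (\<lambda>q. g q (Y q) (?W q)) = dir_deriv N (mtop N) p x (\<lambda>q. g q (Y' q) (?W q))"
      unfolding dir_deriv_ambient[OF p x amb.metric_smooth[OF metric Y(1) W(1)]]
        dir_deriv_ambient[OF p x amb.metric_smooth[OF metric Y(2) W(1)]]
    proof (rule dir_deriv_cong[OF x smooth_fun_at_of_ambient[OF p amb.metric_smooth[OF metric Y(1) W(1)]]])
      show "eventually (\<lambda>q. g q (Y q) (?W q) = g q (Y' q) (?W q)) (nhdsin S p)"
        using e by eventually_elim simp
    qed
    then show "g p (D p x Y) w = g p (D p x Y') w"
      using amb.dual_conn[OF dual xN Y(1) W(1)] amb.dual_conn[OF dual xN Y(2) W(1)] W(2)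
        eventually_nhdsin_self[OF e p] by simp
  qed (intro amb.conn_tangent[OF aff xN] Y)+
qed

abbreviation ind :: "'a connection" where "ind \<equiv> induced_connection N S g D"

text \<open>The extension chosen by \<open>ambient_ext\<close> may be replaced by any other, because
  \<open>D\<close> in a direction tangent to \<open>S\<close> sees only values along
  \<open>S\<close>.\<close>

lemma induced_eq:
  assumes x: "x \<in> T p" and Y: "vfield_at N S p Y" "vfield_at N (mtop N) p Y'"
    and e: "eventually (\<lambda>q. Y q = Y' q) (nhdsin S p)"
  shows "ind p x Y = tanp p (D p x Y')"
proof -
  have "eventually (\<lambda>q. ambient_ext N S p Y q = Y' q) (nhdsin S p)"
    using ambient_ext(2)[OF Y(1)] e by eventually_elim simp
  from conn_along[OF x ambient_ext(1)[OF Y(1)] Y(2) this vfield_at_topspace[OF Y(1)]]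
  show ?thesis by (simp add: induced_connection_def)
qed

lemma covd_induced_eq:
  assumes X: "vfield_at N S p X" and Y: "vfield_at N S p Y" "vfield_at N (mtop N) p Y'"
      "eventually (\<lambda>q. Y q = Y' q) (nhdsin S p)"
    and X': "eventually (\<lambda>q. X q = X' q) (nhdsin S p)"
  shows "eventually (\<lambda>q. covd ind X Y q = tanp q (covd D X' Y' q)) (nhdsin S p)"
  using vfield_at_nbhd[OF X] vfield_at_nbhd[OF Y(1)] nhdsin_ambient[OF vfield_at_nbhd[OF Y(2)]]
    eventually_nhdsin_open[OF Y(3)] X'
proof eventually_elim
  case (elim q)
  show ?case unfolding covd_def elim(5)[symmetric]
    by (rule induced_eq[OF vfield_at_tangent[OF elim(1)] elim(2,3,4)])
qed

text \<open>Each axiom is the tangential part of the ambient axiom for extended fields; tangent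
  vectors are fixed by the projection, which accounts for the derivative term in the product
  rule.\<close>

lemma induced_affine: "affine_connection N S ind"
  unfolding affine_connection_def
proof (intro ballI conjI allI impI)
  fix p assume p: "p \<in> topspace S"
  note pN = topspace_ambient[OF p]
  note ext = ambient_ext
  have DN: "D p v Y \<in> TN p" if "v \<in> T p" "vfield_at N (mtop N) p Y" for v Y
    by (rule amb.conn_tangent[OF aff tangent_TN[OF that(1)] that(2)])
  note tl = linear_on_subspaceD[OF tanp_linear[OF p]]
  show "linear_on_subspace (T p) (\<lambda>v. ind p v Y)" if Y: "vfield_at N S p Y" for Y
    unfolding linear_on_subspace_def
  proof (intro ballI allI)
    fix u v a b assume u: "u \<in> T p" and v: "v \<in> T p"
    have uv: "a *\<^sub>R u + b *\<^sub>R v \<in> T p"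
      by (intro subspace_add subspace_scale subspace_tangent p u v)
    show "ind p (a *\<^sub>R u + b *\<^sub>R v) Y = a *\<^sub>R ind p u Y + b *\<^sub>R ind p v Y"
      unfolding induced_eq[OF uv Y ext[OF Y]] induced_eq[OF u Y ext[OF Y]] induced_eq[OF v Y ext[OF Y]]
        linear_on_subspaceD(1)[OF amb.conn_linear[OF aff ext(1)[OF Y]] tangent_TN[OF u] tangent_TN[OF v]]
      by (rule tl(1)[OF DN[OF u ext(1)[OF Y]] DN[OF v ext(1)[OF Y]]])
  qed
  show "ind p v Y \<in> T p" if v: "v \<in> T p" and Y: "vfield_at N S p Y" for v Y
    unfolding induced_eq[OF v Y ext[OF Y]] by (rule tanp(1)[OF p DN[OF v ext(1)[OF Y]]])
  show "ind p v (Y + Z) = ind p v Y + ind p v Z"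
    if v: "v \<in> T p" and Y: "vfield_at N S p Y" and Z: "vfield_at N S p Z" for v Y Z
  proof -
    have e: "eventually (\<lambda>q. (Y + Z) q = (ambient_ext N S p Y + ambient_ext N S p Z) q) (nhdsin S p)"
      using ext(2)[OF Y] ext(2)[OF Z] by eventually_elim simp
    show ?thesis
      unfolding induced_eq[OF v vfield_at_add[OF Y Z] amb.vfield_at_add[OF ext(1)[OF Y] ext(1)[OF Z]] e]
        induced_eq[OF v Y ext[OF Y]] induced_eq[OF v Z ext[OF Z]]
        amb.conn_add[OF aff tangent_TN[OF v] ext(1)[OF Y] ext(1)[OF Z]]
      by (rule tl(2)[OF DN[OF v ext(1)[OF Y]] DN[OF v ext(1)[OF Z]]])
  qed
  show "ind p v (\<lambda>q. f q *\<^sub>R Y q) = dir_deriv N S p v f *\<^sub>R Y p + f p *\<^sub>R ind p v Y"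
    if v: "v \<in> T p" and f: "smooth_fun_at N S p f" and Y: "vfield_at N S p Y" for v f Y
  proof -
    obtain F where F: "smooth_at N p F" "eventually (\<lambda>q. f q = F q) (nhdsin S p)"
      by (rule smooth_fun_atE[OF f])
    have F': "smooth_fun_at N (mtop N) p F" by (rule amb.smooth_fun_at_restrict[OF pN F(1)])
    let ?Y = "ambient_ext N S p Y"
    have e: "eventually (\<lambda>q. f q *\<^sub>R Y q = F q *\<^sub>R ?Y q) (nhdsin S p)"
      using ext(2)[OF Y] F(2) by eventually_elim simp
    have Yp: "?Y p = Y p" using eventually_nhdsin_self[OF ext(2)[OF Y] p] by simp
    have Fp: "F p = f p" using eventually_nhdsin_self[OF F(2) p] by simp
    have dF: "dir_deriv N (mtop N) p v F = dir_deriv N S p v f"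
      unfolding dir_deriv_ambient[OF p v F'] by (rule dir_deriv_cong[OF v f F(2), symmetric])
    have "ind p v (\<lambda>q. f q *\<^sub>R Y q) = tanp p (D p v (\<lambda>q. F q *\<^sub>R ?Y q))"
      by (rule induced_eq[OF v vfield_at_scale[OF f Y] amb.vfield_at_scale[OF F' ext(1)[OF Y]] e])
    also have "\<dots> = tanp p (dir_deriv N S p v f *\<^sub>R Y p + f p *\<^sub>R D p v ?Y)"
      unfolding amb.conn_scale[OF aff tangent_TN[OF v] F' ext(1)[OF Y]] Yp Fp dF ..
    also have "\<dots> = dir_deriv N S p v f *\<^sub>R tanp p (Y p) + f p *\<^sub>R tanp p (D p v ?Y)"
      by (rule tl(1)[OF tangent_TN[OF vfield_at_tangent[OF Y]] DN[OF v ext(1)[OF Y]]])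
    finally show ?thesis
      unfolding induced_eq[OF v Y ext[OF Y]] tanp_tangent[OF p vfield_at_tangent[OF Y]] .
  qed
  show "ind p v Y = ind p v Z"
    if v: "v \<in> T p" and Y: "vfield_at N S p Y" and YZ: "agree_near S p Y Z" for v Y Z
  proof -
    have e: "eventually (\<lambda>q. Y q = Z q) (nhdsin S p)" using YZ agree_near_eventually[OF p, of Y Z] by simp
    have "eventually (\<lambda>q. Z q = ambient_ext N S p Y q) (nhdsin S p)"
      using e ext(2)[OF Y] by eventually_elim simp
    then show ?thesis
      using induced_eq[OF v Y ext[OF Y]] induced_eq[OF v vfield_at_cong[OF Y e] ext(1)[OF Y]] by simp
  qed
  show "vfield_at N S p (covd ind X Y)" if X: "vfield_at N S p X" and Y: "vfield_at N S p Y" for X Y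
  proof (rule vfield_at_cong)
    show "vfield_at N S p (\<lambda>q. tanp q (covd D (ambient_ext N S p X) (ambient_ext N S p Y) q))"
      by (rule vfield_at_tanp[OF p amb.covd_vfield[OF aff ext(1)[OF X] ext(1)[OF Y]]])
    show "eventually (\<lambda>q. tanp q (covd D (ambient_ext N S p X) (ambient_ext N S p Y) q)
        = covd ind X Y q) (nhdsin S p)"
      using covd_induced_eq[OF X Y ext[OF Y] ext(2)[OF X]] by eventually_elim simp
  qed
qed

text \<open>The two ambient derivatives need not be tangent to \<open>S\<close>, but their
  difference is the bracket, and the bracket is. Its tangential part gives torsion-freeness of the
  induced connection, its vanishing normal part the symmetry of \<sigma>.\<close>

lemma bracket_ext:
  assumes X: "vfield_at N S p X" "vfield_at N (mtop N) p X'" "eventually (\<lambda>q. X q = X' q) (nhdsin S p)"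
    and Y: "vfield_at N S p Y" "vfield_at N (mtop N) p Y'" "eventually (\<lambda>q. Y q = Y' q) (nhdsin S p)"
  shows "lie_bracket N S X Y p = D p (X p) Y' - D p (Y p) X'" and "lie_bracket N S X Y p \<in> T p"
    and "lie_bracket N (mtop N) X' Y' p = lie_bracket N S X Y p"
proof -
  note p = vfield_at_topspace[OF X(1)]
  show e: "lie_bracket N (mtop N) X' Y' p = lie_bracket N S X Y p"
    using lie_bracket_ambient[OF X Y] by simp
  show *: "lie_bracket N S X Y p = D p (X p) Y' - D p (Y p) X'"
    unfolding e[symmetric] amb.torsion_freeD[OF tf X(2) Y(2)]
    using eventually_nhdsin_self[OF X(3) p] eventually_nhdsin_self[OF Y(3) p] by simp
  show "lie_bracket N S X Y p \<in> T p"
    by (rule lie_bracket_in_tangent[OF X(1) Y(1)])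
      (use amb.lie_bracket_tangent[OF aff tf X(2) Y(2)] e in simp)
qed

lemma D_ambient: "x \<in> T p \<Longrightarrow> vfield_at N (mtop N) p Y \<Longrightarrow> D p x Y \<in> TN p"
  by (rule amb.conn_tangent[OF aff tangent_TN])

lemma induced_torsion_free: "torsion_free N S ind"
  unfolding torsion_free_def
proof (intro ballI allI impI)
  fix p X Y assume p: "p \<in> topspace S" and X: "vfield_at N S p X" and Y: "vfield_at N S p Y"
  note eX = ambient_ext[OF X] and eY = ambient_ext[OF Y]
  note tX = vfield_at_tangent[OF X] and tY = vfield_at_tangent[OF Y]
  have "covd ind X Y p - covd ind Y X p
      = tanp p (D p (X p) (ambient_ext N S p Y)) - tanp p (D p (Y p) (ambient_ext N S p X))"
    unfolding covd_def induced_eq[OF tX Y eY] induced_eq[OF tY X eX] ..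
  also have "\<dots> = tanp p (D p (X p) (ambient_ext N S p Y) - D p (Y p) (ambient_ext N S p X))"
    by (rule linear_on_subspaceD(3)[OF tanp_linear[OF p], symmetric])
      (intro D_ambient tX tY eX(1) eY(1))+
  also have "\<dots> = lie_bracket N S X Y p"
    using tanp_tangent[OF p bracket_ext(2)[OF X eX Y eY]] bracket_ext(1)[OF X eX Y eY] by simp
  finally show "covd ind X Y p - covd ind Y X p = lie_bracket N S X Y p" .
qed

lemma dir_deriv_metric_ext:
  assumes x: "x \<in> T p" and Y: "vfield_at N S p Y" "vfield_at N (mtop N) p Y'" "eventually (\<lambda>q. Y q = Y' q) (nhdsin S p)"
    and Z: "vfield_at N S p Z" "vfield_at N (mtop N) p Z'" "eventually (\<lambda>q. Z q = Z' q) (nhdsin S p)"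
  shows "dir_deriv N S p x (\<lambda>q. g q (Y q) (Z q)) = g p (D p x Y') (Z p) + g p (Y p) (Ds p x Z')"
proof -
  note p = vfield_at_topspace[OF Y(1)]
  have "dir_deriv N S p x (\<lambda>q. g q (Y q) (Z q)) = dir_deriv N S p x (\<lambda>q. g q (Y' q) (Z' q))"
  proof (rule dir_deriv_cong[OF x metric_smooth[OF metric_S Y(1) Z(1)]])
    show "eventually (\<lambda>q. g q (Y q) (Z q) = g q (Y' q) (Z' q)) (nhdsin S p)"
      using Y(3) Z(3) by eventually_elim simp
  qed
  also have "\<dots> = dir_deriv N (mtop N) p x (\<lambda>q. g q (Y' q) (Z' q))"
    by (rule dir_deriv_ambient[OF p x amb.metric_smooth[OF metric Y(2) Z(2)], symmetric])
  also have "\<dots> = g p (D p x Y') (Z' p) + g p (Y' p) (Ds p x Z')"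
    by (rule amb.dual_conn[OF dual tangent_TN[OF x] Y(2) Z(2)])
  finally show ?thesis
    using eventually_nhdsin_self[OF Y(3) p] eventually_nhdsin_self[OF Z(3) p] by simp
qed

text \<open>Pairing with a tangent vector does not see the normal part removed by the projection, so
  the ambient duality passes to \<open>S\<close>.\<close>

lemma induced_dual: "dual_connections N S g ind (induced_connection N S g Ds)"
  unfolding dual_connections_def
proof (intro ballI allI impI)
  interpret sw: dual_pair N S n g Ds D by (rule dual_pair_swap)
  fix p X Y Z assume p: "p \<in> topspace S" and X: "vfield_at N S p X" and Y: "vfield_at N S p Y"
    and Z: "vfield_at N S p Z"
  interpret inner_space "TN p" "g p" by (rule inner_ambient[OF p])
  note eY = ambient_ext[OF Y] and eZ = ambient_ext[OF Z]
  note tX = vfield_at_tangent[OF X] and tY = vfield_at_tangent[OF Y] and tZ = vfield_at_tangent[OF Z]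
  have 1: "g p (covd ind X Y p) (Z p) = g p (D p (X p) (ambient_ext N S p Y)) (Z p)"
    unfolding covd_def induced_eq[OF tX Y eY] by (rule tanp_inner[OF p D_ambient[OF tX eY(1)] tZ])
  have DZ: "Ds p (X p) (ambient_ext N S p Z) \<in> TN p" by (rule sw.D_ambient[OF tX eZ(1)])
  have 2: "g p (Y p) (covd (induced_connection N S g Ds) X Z p) = g p (Y p) (Ds p (X p) (ambient_ext N S p Z))"
    unfolding covd_def sw.induced_eq[OF tX Z eZ]
    using tanp_inner[OF p DZ tY] sym[OF tangent_TN[OF tY] DZ]
      sym[OF tangent_TN[OF tY] tangent_TN[OF tanp(1)[OF p DZ]]] by simp
  show "dir_deriv N S p (X p) (\<lambda>q. g q (Y q) (Z q))
      = g p (covd ind X Y p) (Z p) + g p (Y p) (covd (induced_connection N S g Ds) X Z p)"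
    unfolding 1 2 by (rule dir_deriv_metric_ext[OF tX Y eY Z eZ])
qed

section \<open>The second fundamental form\<close>

abbreviation sff :: "'a \<Rightarrow> 'a tvec \<Rightarrow> 'a tvec \<Rightarrow> 'a tvec"
  where "sff \<equiv> second_fundamental_form N S g D"

text \<open>Dependence on the first argument is pointwise for any connection. For the second
  argument the normal parts of D_X Z and D_Z X agree, their difference being a tangent bracket;
  exchanging the arguments twice replaces the chosen extension by an arbitrary one.\<close>

lemma sff_eq:
  assumes x: "x \<in> T p" and Y: "vfield_at N S p Y" "vfield_at N (mtop N) p Y'" "eventually (\<lambda>q. Y q = Y' q) (nhdsin S p)"
  shows "sff p x (Y p) = D p x Y' - tanp p (D p x Y')" and "sff p (Y p) x = sff p x (Y p)"
proof -
  note p = vfield_at_topspace[OF Y(1)]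
  note tl = linear_on_subspaceD(3)[OF tanp_linear[OF p]]
  define nor where "nor = (\<lambda>v. v - tanp p v)"
  have sff: "sff p u v = nor (D p u (ambient_ext N S p (local_ext N S p v)))" for u v
    by (simp add: second_fundamental_form_def nor_def Let_def)
  have key: "nor (D p (X p) Z') = nor (D p (Z p) X')"
    if X: "vfield_at N S p X" "vfield_at N (mtop N) p X'" "eventually (\<lambda>q. X q = X' q) (nhdsin S p)"
      and Z: "vfield_at N S p Z" "vfield_at N (mtop N) p Z'" "eventually (\<lambda>q. Z q = Z' q) (nhdsin S p)"
    for X X' Z Z'
  proof -
    have DN: "D p (X p) Z' \<in> TN p" "D p (Z p) X' \<in> TN p"
      by (intro D_ambient vfield_at_tangent[OF X(1)] vfield_at_tangent[OF Z(1)] X Z)+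
    have "tanp p (D p (X p) Z' - D p (Z p) X') = D p (X p) Z' - D p (Z p) X'"
      using tanp_tangent[OF p bracket_ext(2)[OF X Z]] bracket_ext(1)[OF X Z] by simp
    then show ?thesis unfolding nor_def tl[OF DN] by (simp add: algebra_simps)
  qed
  note ex = local_ext[OF p x]
  note ey = local_ext[OF p vfield_at_tangent[OF Y(1)]]
  have *: "nor (D p x Y') = sff p (Y p) x"
    unfolding sff using key[OF ex(1) ambient_ext[OF ex(1)] Y] ex(2) by simp
  have "sff p x (Y p) = sff p (Y p) x"
    unfolding sff using key[OF ex(1) ambient_ext[OF ex(1)] ey(1) ambient_ext[OF ey(1)]] ex(2) ey(2) by simp
  then show "sff p x (Y p) = D p x Y' - tanp p (D p x Y')" "sff p (Y p) x = sff p x (Y p)"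
    using * by (simp_all add: nor_def)
qed

lemma sff_sym:
  assumes p: "p \<in> topspace S" and "x \<in> T p" "y \<in> T p"
  shows "sff p x y = sff p y x"
  using sff_eq(2)[OF assms(2) local_ext(1)[OF p assms(3)] ambient_ext[OF local_ext(1)[OF p assms(3)]]]
    local_ext(2)[OF p assms(3)] by simp

lemma sff_normal:
  assumes p: "p \<in> topspace S" and x: "x \<in> T p" and y: "y \<in> T p"
  shows "sff p x y \<in> TN p" and "z \<in> T p \<Longrightarrow> g p (sff p x y) z = 0"
proof -
  interpret inner_space "TN p" "g p" by (rule inner_ambient[OF p])
  note e = local_ext[OF p y]
  have w: "D p x (ambient_ext N S p (local_ext N S p y)) \<in> TN p"
    by (rule D_ambient[OF x ambient_ext(1)[OF e(1)]])
  show "sff p x y \<in> TN p" "z \<in> T p \<Longrightarrow> g p (sff p x y) z = 0"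
    unfolding second_fundamental_form_def Let_def
    using tanp[OF p w] w tangent_TN by (auto intro: subspace_diff[OF subspace_V])
qed

text \<open>Linearity in the first argument comes from the connection, linearity in the second from
  symmetry.\<close>

lemma sff_bilinear:
  assumes p: "p \<in> topspace S"
  shows "bilinear_on (T p) (sff p)"
proof -
  have l: "linear_on_subspace (T p) (\<lambda>x. sff p x y)" if y: "y \<in> T p" for y
    unfolding linear_on_subspace_def
  proof (intro ballI allI)
    fix u v a b assume u: "u \<in> T p" and v: "v \<in> T p"
    let ?Y = "ambient_ext N S p (local_ext N S p y)"
    note Y = ambient_ext(1)[OF local_ext(1)[OF p y]]
    have "D p (a *\<^sub>R u + b *\<^sub>R v) ?Y = a *\<^sub>R D p u ?Y + b *\<^sub>R D p v ?Y"
      by (rule linear_on_subspaceD(1)[OF amb.conn_linear[OF aff Y] tangent_TN[OF u] tangent_TN[OF v]])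
    then show "sff p (a *\<^sub>R u + b *\<^sub>R v) y = a *\<^sub>R sff p u y + b *\<^sub>R sff p v y"
      using linear_on_subspaceD(1)[OF tanp_linear[OF p] D_ambient[OF u Y] D_ambient[OF v Y], of a b]
      by (simp add: second_fundamental_form_def Let_def scaleR_diff_right)
  qed
  moreover have "linear_on_subspace (T p) (sff p x)" if x: "x \<in> T p" for x
    using l[OF x] sff_sym[OF p x] subspace_tangent[OF p] unfolding linear_on_subspace_def
    by (simp add: subspace_add subspace_scale)
  ultimately show ?thesis by (simp add: bilinear_on_def)
qed

end

context dual_pair
begin

text \<open>From here on \<open>swap.sff\<close> and \<open>swap.ind\<close> are the second
  fundamental form and the induced connection of the dual connection \<open>Ds\<close>.\<close>

sublocale swap: dual_pair N S n g Ds D by (rule dual_pair_swap)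

end

section \<open>The Gauss equation\<close>

context dual_pair
begin

text \<open>Split D_V Z along \<open>S\<close> into its tangential part Y and a normal part.
  Differentiating the orthogonality of the normal part to a tangent field W moves the derivative to
  W, and duality turns it into a derivative by \<open>Ds\<close>. This is how the product of one
  second fundamental form with the other arises.\<close>

lemma induced_second_derivative:
  assumes U: "vfield_at N S p U" and V: "vfield_at N S p V" and Z: "vfield_at N S p Z"
    and V': "vfield_at N (mtop N) p V'" "eventually (\<lambda>q. V q = V' q) (nhdsin S p)"
    and Z': "vfield_at N (mtop N) p Z'" "eventually (\<lambda>q. Z q = Z' q) (nhdsin S p)"
    and w: "w \<in> T p"
  shows "g p (ind p (U p) (covd ind V Z)) w
    = g p (D p (U p) (covd D V' Z')) w + g p (sff p (V p) (Z p)) (swap.sff p (U p) w)"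
proof -
  note p = vfield_at_topspace[OF U]
  interpret inner_space "TN p" "g p" by (rule inner_ambient[OF p])
  note u = vfield_at_tangent[OF U] and v = vfield_at_tangent[OF V] and z = vfield_at_tangent[OF Z]
  define A where "A = covd D V' Z'"
  define Y where "Y = covd ind V Z"
  define Y' where "Y' = ambient_ext N S p Y"
  define W where "W = local_ext N S p w"
  define W' where "W' = ambient_ext N S p W"
  have A: "vfield_at N (mtop N) p A" unfolding A_def by (rule amb.covd_vfield[OF aff V'(1) Z'(1)])
  have Y: "vfield_at N S p Y" unfolding Y_def by (rule covd_vfield[OF induced_affine V Z])
  have Y': "vfield_at N (mtop N) p Y'" "eventually (\<lambda>q. Y q = Y' q) (nhdsin S p)"
    unfolding Y'_def by (rule ambient_ext[OF Y])+
  have W: "vfield_at N S p W" "W p = w" unfolding W_def using local_ext[OF p w] by auto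
  have W': "vfield_at N (mtop N) p W'" "eventually (\<lambda>q. W q = W' q) (nhdsin S p)"
    unfolding W'_def by (rule ambient_ext[OF W(1)])+
  have W'p: "W' p = w" using eventually_nhdsin_self[OF W'(2) p] W(2) by simp
  have YA: "eventually (\<lambda>q. Y q = tanp q (A q)) (nhdsin S p)"
    unfolding Y_def A_def by (rule covd_induced_eq[OF V Z Z' V'(2)])
  \<comment> \<open>An ambient field whose values along \<open>S\<close> are the normal parts of D_V
    Z; away from \<open>S\<close> it depends on the chosen extensions.\<close>
  define \<nu> where "\<nu> = A - Y'"
  have \<nu>: "vfield_at N (mtop N) p \<nu>" unfolding \<nu>_def by (rule amb.vfield_at_diff[OF A Y'(1)])
  have DA: "D p (U p) A \<in> TN p" "D p (U p) Y' \<in> TN p" "D p (U p) \<nu> \<in> TN p"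
    by (intro D_ambient u A Y' \<nu>)+
  have wN: "w \<in> TN p" by (rule tangent_TN[OF w])
  have "eventually (\<lambda>q. g q (\<nu> q) (W' q) = 0) (nhdsin S p)"
    using YA Y'(2) W'(2) vfield_at_nbhd[OF W(1)] nhdsin_ambient[OF vfield_at_nbhd[OF A]]
      eventually_nhdsin_topspace
  proof eventually_elim
    case (elim q)
    have "\<nu> q = A q - tanp q (A q)" using elim(1,2) by (simp add: \<nu>_def)
    moreover have "W' q \<in> T q" using vfield_at_tangent[OF elim(4)] elim(3) by simp
    ultimately show ?case using tanp(2)[OF elim(6) vfield_at_tangent[OF elim(5)]] by simp
  qed
  from dir_deriv_cong[OF u smooth_fun_at_of_ambient[OF p amb.metric_smooth[OF metric \<nu> W'(1)]] this]
  have "dir_deriv N (mtop N) p (U p) (\<lambda>q. g q (\<nu> q) (W' q)) = 0"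
    unfolding dir_deriv_ambient[OF p u amb.metric_smooth[OF metric \<nu> W'(1)]]
    using dir_deriv_const[OF u p] by simp
  then have n0: "g p (D p (U p) \<nu>) w + g p (\<nu> p) (Ds p (U p) W') = 0"
    using amb.dual_conn[OF dual tangent_TN[OF u] \<nu> W'(1)] W'p by simp
  have "Z p = Z' p" "V p = V' p"
    using eventually_nhdsin_self[OF Z'(2) p] eventually_nhdsin_self[OF V'(2) p] by auto
  have \<nu>p: "\<nu> p = sff p (V p) (Z p)"
    unfolding sff_eq(1)[OF v Z Z'] \<nu>_def
    using eventually_nhdsin_self[OF YA p] eventually_nhdsin_self[OF Y'(2) p] \<open>V p = V' p\<close>
    by (simp add: A_def covd_def)
  note s = sff_normal[OF p v z]
  have DW: "Ds p (U p) W' \<in> TN p" by (rule swap.D_ambient[OF u W'(1)])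
  have tW: "tanp p (Ds p (U p) W') \<in> T p" by (rule tanp(1)[OF p DW])
  have "swap.sff p (U p) w = Ds p (U p) W' - tanp p (Ds p (U p) W')"
    using swap.sff_eq(1)[OF u W(1) W'] W(2) by simp
  then have "g p (sff p (V p) (Z p)) (swap.sff p (U p) w) = g p (\<nu> p) (Ds p (U p) W')"
    unfolding \<nu>p using G_diff(1)[OF s(1) DW tangent_TN[OF tW]] s(2)[OF tW] by simp
  moreover have "g p (D p (U p) \<nu>) w = g p (D p (U p) A) w - g p (D p (U p) Y') w"
    unfolding \<nu>_def amb.conn_diff[OF aff tangent_TN[OF u] A Y'(1)]
    by (rule G_diff(2)[OF DA(1,2) wN])
  moreover have "g p (ind p (U p) Y) w = g p (D p (U p) Y') w"
    unfolding induced_eq[OF u Y Y'] by (rule tanp_inner[OF p DA(2) w])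
  ultimately show ?thesis using n0 unfolding Y_def A_def by linarith
qed

text \<open>The two second derivatives contribute the products of the forms. The bracket term
  contributes nothing, because the bracket is tangent to \<open>S\<close> and the projection does
  not affect the pairing with \<open>w\<close>.\<close>

theorem gauss_equation:
  assumes p: "p \<in> topspace S" and x: "x \<in> T p" and y: "y \<in> T p" and z: "z \<in> T p" and w: "w \<in> T p"
  shows "g p (curvature N S ind p x y z) w = g p (curvature N (mtop N) D p x y z) w
    + g p (sff p y z) (swap.sff p x w) - g p (sff p x z) (swap.sff p y w)"
proof -
  interpret inner_space "TN p" "g p" by (rule inner_ambient[OF p])
  let ?X = "local_ext N S p x" and ?Y = "local_ext N S p y" and ?Z = "local_ext N S p z"
  let ?X' = "ambient_ext N S p ?X" and ?Y' = "ambient_ext N S p ?Y" and ?Z' = "ambient_ext N S p ?Z"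
  note X = local_ext[OF p x] and Y = local_ext[OF p y] and Z = local_ext[OF p z]
  note X' = ambient_ext[OF X(1)] and Y' = ambient_ext[OF Y(1)] and Z' = ambient_ext[OF Z(1)]
  have v: "?X' p = x" "?Y' p = y" "?Z' p = z"
    using eventually_nhdsin_self[OF X'(2) p] eventually_nhdsin_self[OF Y'(2) p]
      eventually_nhdsin_self[OF Z'(2) p] X(2) Y(2) Z(2) by auto
  let ?b = "lie_bracket N S ?X ?Y p"
  have b: "?b \<in> T p" and be: "lie_bracket N (mtop N) ?X' ?Y' p = ?b"
    using bracket_ext(2,3)[OF X(1) X' Y(1) Y'] by auto
  have wN: "w \<in> TN p" by (rule tangent_TN[OF w])
  have IN: "ind p u V \<in> TN p" if "u \<in> T p" "vfield_at N S p V" for u V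
    by (rule tangent_TN[OF conn_tangent[OF induced_affine that]])
  note cv = covd_vfield[OF induced_affine] and cv' = amb.covd_vfield[OF aff]
  have 1: "g p (curvature N S ind p x y z) w
      = g p (ind p x (covd ind ?Y ?Z)) w - g p (ind p y (covd ind ?X ?Z)) w - g p (ind p ?b ?Z) w"
    unfolding curvature_def curvature_field_apply X(2) Y(2)
    using G_diff(2)[OF subspace_diff[OF subspace_V IN[OF x cv[OF Y(1) Z(1)]] IN[OF y cv[OF X(1) Z(1)]]]
        IN[OF b Z(1)] wN]
      G_diff(2)[OF IN[OF x cv[OF Y(1) Z(1)]] IN[OF y cv[OF X(1) Z(1)]] wN] by simp
  have DN: "D p x (covd D ?Y' ?Z') \<in> TN p" "D p y (covd D ?X' ?Z') \<in> TN p" "D p ?b ?Z' \<in> TN p"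
    by (intro D_ambient x y b cv' X' Y' Z')+
  have "curvature N (mtop N) D p x y z = curvature_field N (mtop N) D ?X' ?Y' ?Z' p"
    using amb.curvature_eq[OF aff tf X'(1) Y'(1) Z'(1)] v by simp
  also have "\<dots> = D p x (covd D ?Y' ?Z') - D p y (covd D ?X' ?Z') - D p ?b ?Z'"
    by (simp only: amb.curvature_field_apply be v)
  finally have "g p (curvature N (mtop N) D p x y z) w
      = g p (D p x (covd D ?Y' ?Z') - D p y (covd D ?X' ?Z') - D p ?b ?Z') w" by simp
  also have "\<dots> = g p (D p x (covd D ?Y' ?Z')) w - g p (D p y (covd D ?X' ?Z')) w - g p (D p ?b ?Z') w"
    using G_diff(2)[OF subspace_diff[OF subspace_V DN(1,2)] DN(3) wN] G_diff(2)[OF DN(1,2) wN] by simp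
  finally have 2: "g p (curvature N (mtop N) D p x y z) w
      = g p (D p x (covd D ?Y' ?Z')) w - g p (D p y (covd D ?X' ?Z')) w - g p (D p ?b ?Z') w" .
  have 3: "g p (ind p ?b ?Z) w = g p (D p ?b ?Z') w"
    unfolding induced_eq[OF b Z(1) Z'] by (rule tanp_inner[OF p DN(3) w])
  have 4: "g p (ind p x (covd ind ?Y ?Z)) w
      = g p (D p x (covd D ?Y' ?Z')) w + g p (sff p y z) (swap.sff p x w)"
    using induced_second_derivative[OF X(1) Y(1) Z(1) Y' Z' w] X(2) Y(2) Z(2) by simp
  have 5: "g p (ind p y (covd ind ?X ?Z)) w
      = g p (D p y (covd D ?X' ?Z')) w + g p (sff p x z) (swap.sff p y w)"
    using induced_second_derivative[OF Y(1) X(1) Z(1) X' Z' w] X(2) Y(2) Z(2) by simp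
  show ?thesis unfolding 1 2 3 4 5 by simp
qed

end

section \<open>The Levi-Civita connection as the mean of two dual connections\<close>

definition mean_connection :: "'a connection \<Rightarrow> 'a connection \<Rightarrow> 'a connection"
  where "mean_connection D Ds = (\<lambda>p v Y. (1/2) *\<^sub>R (D p v Y + Ds p v Y))"

context submanifold
begin

lemma mean_affine:
  assumes A: "affine_connection N S D" and B: "affine_connection N S Ds"
  shows "affine_connection N S (mean_connection D Ds)"
  unfolding affine_connection_def
proof (intro ballI conjI allI impI)
  fix p assume p: "p \<in> topspace S"
  show "linear_on_subspace (T p) (\<lambda>v. mean_connection D Ds p v Y)" if Y: "vfield_at N S p Y" for Y
    using conn_linear[OF A Y] conn_linear[OF B Y] unfolding linear_on_subspace_def mean_connection_def
    by (simp add: scaleR_add_right scaleR_left_commute ac_simps)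
  show "mean_connection D Ds p v Y \<in> T p" if "v \<in> T p" "vfield_at N S p Y" for v Y
    unfolding mean_connection_def
    by (intro subspace_scale subspace_add subspace_tangent p conn_tangent[OF A] conn_tangent[OF B] that)
  show "mean_connection D Ds p v (Y + Z) = mean_connection D Ds p v Y + mean_connection D Ds p v Z"
    if "v \<in> T p" "vfield_at N S p Y" "vfield_at N S p Z" for v Y Z
    unfolding mean_connection_def conn_add[OF A that] conn_add[OF B that]
    by (simp only: scaleR_add_right ac_simps)
  show "mean_connection D Ds p v (\<lambda>q. f q *\<^sub>R Y q)
      = dir_deriv N S p v f *\<^sub>R Y p + f p *\<^sub>R mean_connection D Ds p v Y"
    if "v \<in> T p" "smooth_fun_at N S p f" "vfield_at N S p Y" for v f Y
  proof -
    have *: "(1/2) *\<^sub>R ((a + b) + (a + c)) = a + (1/2) *\<^sub>R (b + c)" for a b c :: "'a tvec"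
    proof -
      have "(1/2) *\<^sub>R ((a + b) + (a + c)) = (1/2) *\<^sub>R (a + a) + (1/2) *\<^sub>R (b + c)"
        by (simp only: scaleR_add_right ac_simps)
      then show ?thesis by (simp only: scaleR_half_double)
    qed
    show ?thesis
      unfolding mean_connection_def conn_scale[OF A that] conn_scale[OF B that] *
      by (simp only: scaleR_add_right scaleR_left_commute)
  qed
  show "mean_connection D Ds p v Y = mean_connection D Ds p v Z"
    if "v \<in> T p" "vfield_at N S p Y" "agree_near S p Y Z" for v Y Z
    using conn_cong[OF A that(1,2)] conn_cong[OF B that(1,2)] that(3)
      agree_near_eventually[OF p, of Y Z] by (simp only: mean_connection_def)
  show "vfield_at N S p (covd (mean_connection D Ds) X Y)"
    if X: "vfield_at N S p X" and Y: "vfield_at N S p Y" for X Y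
    using vfield_at_cmult[OF vfield_at_add[OF covd_vfield[OF A X Y] covd_vfield[OF B X Y]], of "1/2"]
    by (simp only: covd_def mean_connection_def plus_fun_apply)
qed

lemma mean_torsion_free:
  assumes A: "torsion_free N S D" and B: "torsion_free N S Ds"
  shows "torsion_free N S (mean_connection D Ds)"
  unfolding torsion_free_def
proof (intro ballI allI impI)
  fix p X Y assume p: "p \<in> topspace S" and X: "vfield_at N S p X" and Y: "vfield_at N S p Y"
  have *: "(1/2) *\<^sub>R (a + b) - (1/2) *\<^sub>R (c + d) = l" if "l = a - c" "l = b - d" for a b c d l :: "'a tvec"
  proof -
    have "(1/2) *\<^sub>R (a + b) - (1/2) *\<^sub>R (c + d) = (1/2) *\<^sub>R ((a - c) + (b - d))"
      by (simp only: scaleR_diff_right[symmetric] add_diff_add)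
    also have "\<dots> = l" by (simp only: that(1)[symmetric] that(2)[symmetric] scaleR_half_double)
    finally show ?thesis .
  qed
  show "covd (mean_connection D Ds) X Y p - covd (mean_connection D Ds) Y X p = lie_bracket N S X Y p"
    unfolding covd_def mean_connection_def
    by (rule *[OF torsion_freeD[OF A X Y] torsion_freeD[OF B X Y]])
qed

end

context dual_pair
begin

text \<open>Adding the duality identities for (\<open>D\<close>, \<open>Ds\<close>) and for
  (\<open>Ds\<close>, \<open>D\<close>) and halving makes the mean metric. This is the witness for
  the \<open>SOME\<close> in \<open>levi_civita\<close>; uniqueness then gives the Levi-Civita form
  as the mean of the two others.\<close>

lemma mean_levi_civita: "is_levi_civita N (mtop N) g (mean_connection D Ds)"
  unfolding is_levi_civita_def
proof (intro conjI)
  show "affine_connection N (mtop N) (mean_connection D Ds)" by (rule amb.mean_affine[OF aff affs])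
  show "torsion_free N (mtop N) (mean_connection D Ds)" by (rule amb.mean_torsion_free[OF tf tfs])
  show "dual_connections N (mtop N) g (mean_connection D Ds) (mean_connection D Ds)"
    unfolding dual_connections_def
  proof (intro ballI allI impI)
    fix p X Y Z assume p: "p \<in> topspace (mtop N)" and X: "vfield_at N (mtop N) p X"
      and Y: "vfield_at N (mtop N) p Y" and Z: "vfield_at N (mtop N) p Z"
    interpret inner_space "TN p" "g p" by (rule amb.metric_inner_space[OF metric p])
    note t = vfield_at_tangent
    note c = amb.conn_tangent[OF aff t[OF X]] amb.conn_tangent[OF affs t[OF X]]
    have "g p ((1/2) *\<^sub>R (D p (X p) Y + Ds p (X p) Y)) (Z p)
        = (g p (D p (X p) Y) (Z p) + g p (Ds p (X p) Y) (Z p)) / 2"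
      using G_scale(2)[OF subspace_add[OF subspace_V c[OF Y]] t[OF Z], of "1/2"]
        G_add(2)[OF c[OF Y] t[OF Z]] by simp
    moreover have "g p (Y p) ((1/2) *\<^sub>R (D p (X p) Z + Ds p (X p) Z))
        = (g p (Y p) (D p (X p) Z) + g p (Y p) (Ds p (X p) Z)) / 2"
      using G_scale(1)[OF t[OF Y] subspace_add[OF subspace_V c[OF Z]], of "1/2"]
        G_add(1)[OF t[OF Y] c[OF Z]] by simp
    ultimately show "dir_deriv N (mtop N) p (X p) (\<lambda>q. g q (Y q) (Z q))
        = g p (covd (mean_connection D Ds) X Y p) (Z p) + g p (Y p) (covd (mean_connection D Ds) X Z p)"
      using amb.dual_connectionsD[OF dual X Y Z] amb.dual_connectionsD[OF swap.dual X Y Z]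
      unfolding covd_def mean_connection_def by simp
  qed
qed

abbreviation LC :: "'a connection" where "LC \<equiv> levi_civita N (mtop N) g"

lemma levi_civita_ambient: "is_levi_civita N (mtop N) g LC"
  unfolding levi_civita_def by (rule someI[of "is_levi_civita N (mtop N) g", OF mean_levi_civita])

lemma levi_civita_dual_pair: "dual_pair N S n g LC LC"
  using levi_civita_ambient by unfold_locales (auto simp: is_levi_civita_def)

sublocale lc: dual_pair N S n g LC LC by (rule levi_civita_dual_pair)

text \<open>The connection induced on \<open>S\<close> by the ambient Levi-Civita connection is
  again torsion-free and metric, so it coincides on local fields with the one chosen for
  \<open>S\<close>. The Gauss equation for \<open>lc\<close> thereby reaches the intrinsic
  curvature.\<close>

lemma curvature_levi_civita:
  assumes p: "p \<in> topspace S" and "x \<in> T p" "y \<in> T p" "z \<in> T p"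
  shows "curvature N S (levi_civita N S g) p x y z = curvature N S lc.ind p x y z"
proof -
  have i: "is_levi_civita N S g lc.ind"
    unfolding is_levi_civita_def using lc.induced_affine lc.induced_torsion_free lc.induced_dual by blast
  then have l: "is_levi_civita N S g (levi_civita N S g)" unfolding levi_civita_def[of N S] by (rule someI[of "is_levi_civita N S g"])
  show ?thesis
    unfolding curvature_def
  proof (rule curvature_field_cong)
    show "levi_civita N S g q (X q) Y = lc.ind q (X q) Y"
      if "vfield_at N S q X" "vfield_at N S q Y" for q X Y
      by (rule levi_civita_unique[OF metric_S l i that])
  qed (use l i assms local_ext(1)[OF p] in \<open>auto simp: is_levi_civita_def\<close>)
qed

lemma sff_levi_civita:
  assumes p: "p \<in> topspace S" and x: "x \<in> T p" and y: "y \<in> T p"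
  shows "lc.sff p x y = (1/2) *\<^sub>R (sff p x y + swap.sff p x y)"
proof -
  let ?Y = "ambient_ext N S p (local_ext N S p y)"
  note Y = ambient_ext(1)[OF local_ext(1)[OF p y]]
  let ?X = "local_ext N (mtop N) p x"
  note X = amb.local_ext[OF topspace_ambient[OF p] tangent_TN[OF x]]
  have L: "LC p x ?Y = (1/2) *\<^sub>R D p x ?Y + (1/2) *\<^sub>R Ds p x ?Y"
    using amb.levi_civita_unique[OF metric levi_civita_ambient mean_levi_civita X(1) Y] X(2)
    by (simp add: mean_connection_def scaleR_add_right)
  have "tanp p (LC p x ?Y) = (1/2) *\<^sub>R tanp p (D p x ?Y) + (1/2) *\<^sub>R tanp p (Ds p x ?Y)"
    unfolding L by (rule linear_on_subspaceD(1)[OF tanp_linear[OF p] D_ambient[OF x Y] swap.D_ambient[OF x Y]])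
  then show ?thesis
    unfolding second_fundamental_form_def Let_def L
    by (simp only: scaleR_add_right scaleR_diff_right add_diff_add)
qed

text \<open>The left-hand side is \<open>K - K\<^sub>0 + 2 K'\<^sub>0\<close>, where \<open>K'\<^sub>0\<close> is the ambient sectional curvature.  The products of
  \<open>\<sigma>\<close> with \<open>\<sigma>\<^sup>*\<close> cancel because the Levi-Civita second fundamental form is \<open>(\<sigma> + \<sigma>\<^sup>*) / 2\<close>.\<close>

lemma curvature_combination:
  assumes p: "p \<in> topspace S" and x: "x \<in> T p" and y: "y \<in> T p"
  shows "(g p (curvature N S ind p x y y) x + g p (curvature N S swap.ind p x y y) x
        - 2 * g p (curvature N S (levi_civita N S g) p x y y) x) / 2
      - g p (curvature N S (levi_civita N S g) p x y y) x
      + 2 * g p (curvature N (mtop N) LC p x y y) x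
    = (g p (curvature N (mtop N) D p x y y) x + g p (curvature N (mtop N) Ds p x y y) x) / 2
      - ((g p (sff p x x) (sff p y y) - g p (sff p x y) (sff p x y))
        + (g p (swap.sff p x x) (swap.sff p y y) - g p (swap.sff p x y) (swap.sff p x y))) / 2"
proof -
  interpret inner_space "TN p" "g p" by (rule inner_ambient[OF p])
  note N1 = sff_normal(1)[OF p] and N2 = swap.sff_normal(1)[OF p]
  have m: "g p ((1/2) *\<^sub>R (a + b)) ((1/2) *\<^sub>R (d + e)) = (g p a d + g p a e + g p b d + g p b e) / 4"
    if "a \<in> TN p" "b \<in> TN p" "d \<in> TN p" "e \<in> TN p" for a b d e
  proof -
    have "g p ((1/2) *\<^sub>R u) ((1/2) *\<^sub>R v) = g p u v / 4" if "u \<in> TN p" "v \<in> TN p" for u v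
      using that by (simp add: G_scale subspace_scale[OF subspace_V])
    from this[OF subspace_add[OF subspace_V that(1,2)] subspace_add[OF subspace_V that(3,4)]]
    show ?thesis using that by (simp add: G_add subspace_add[OF subspace_V])
  qed
  show ?thesis
    unfolding curvature_levi_civita[OF p x y y] gauss_equation[OF p x y y x] swap.gauss_equation[OF p x y y x]
      lc.gauss_equation[OF p x y y x] sff_levi_civita[OF p x y] sff_levi_civita[OF p x x]
      sff_levi_civita[OF p y y] sff_levi_civita[OF p y x]
      sff_sym[OF p y x] swap.sff_sym[OF p y x]
      m[OF N1[OF x y] N2[OF x y] N1[OF x y] N2[OF x y]] m[OF N1[OF y y] N2[OF y y] N1[OF x x] N2[OF x x]]
    using sym[OF N1[OF x x] N1[OF y y]] sym[OF N2[OF x x] N2[OF y y]]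
      sym[OF N1[OF x x] N2[OF y y]] sym[OF N2[OF x x] N1[OF y y]] sym[OF N1[OF x y] N2[OF x y]]
    by (simp add: field_simps)
qed

end

section \<open>The equality case of the Chen inequality\<close>

lemma sum_pairs:
  fixes F :: "nat \<Rightarrow> nat \<Rightarrow> real"
  assumes "\<And>i j. i \<in> {1..n} \<Longrightarrow> j \<in> {1..n} \<Longrightarrow> F i j = F j i"
  shows "(\<Sum>i=1..n. \<Sum>j=1..n. F i j) = (\<Sum>i=1..n. F i i) + 2 * (\<Sum>i=1..n. \<Sum>j=i+1..n. F i j)"
  using assms
proof (induction n)
  case (Suc n)
  have IH: "(\<Sum>i=1..n. \<Sum>j=1..n. F i j) = (\<Sum>i=1..n. F i i) + 2 * (\<Sum>i=1..n. \<Sum>j=i+1..n. F i j)"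
    by (rule Suc.IH) (use Suc.prems in auto)
  have s: "(\<Sum>j=1..n. F (Suc n) j) = (\<Sum>i=1..n. F i (Suc n))"
    by (intro sum.cong refl Suc.prems) auto
  have "(\<Sum>i=1..n. \<Sum>j=i+1..Suc n. F i j) = (\<Sum>i=1..n. (\<Sum>j=i+1..n. F i j) + F i (Suc n))"
    by (intro sum.cong refl) auto
  then show ?case using IH s by (simp add: sum.distrib)
qed simp

section \<open>Products of second fundamental forms and their invariance\<close>

context inner_space
begin

definition sym_form :: "'v set \<Rightarrow> ('v \<Rightarrow> 'v \<Rightarrow> 'v) \<Rightarrow> bool"
  where "sym_form U \<sigma> \<longleftrightarrow> bilinear_on U \<sigma> \<and> (\<forall>x\<in>U. \<forall>y\<in>U. \<sigma> x y \<in> V \<and> \<sigma> x y = \<sigma> y x)"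

text \<open>The extrinsic term of the classical Gauss equation for the plane of x and y. It is
  quadratic in a single form, since the mixed products have already cancelled.\<close>

definition gauss_term :: "('v \<Rightarrow> 'v \<Rightarrow> 'v) \<Rightarrow> 'v \<Rightarrow> 'v \<Rightarrow> real"
  where "gauss_term \<sigma> x y = G (\<sigma> x x) (\<sigma> y y) - G (\<sigma> x y) (\<sigma> x y)"

lemma bilinear_on_subset: "bilinear_on U B \<Longrightarrow> W \<subseteq> U \<Longrightarrow> bilinear_on W B"
  unfolding bilinear_on_def linear_on_subspace_def by blast

lemma sym_form_subset: "sym_form U \<sigma> \<Longrightarrow> W \<subseteq> U \<Longrightarrow> sym_form W \<sigma>"
  unfolding sym_form_def using bilinear_on_subset by blast

lemma bilinear_on_G:
  assumes "linear_on_subspace U A" "\<And>u. u \<in> U \<Longrightarrow> A u \<in> V"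
  shows "bilinear_on U (\<lambda>u v. G (A u) (A v))"
proof -
  have A: "A (a *\<^sub>R u + b *\<^sub>R v) = a *\<^sub>R A u + b *\<^sub>R A v" if "u \<in> U" "v \<in> U" for u v a b
    using assms(1) that unfolding linear_on_subspace_def by blast
  note l = linear_on_subspaceD(1)[OF linear_G] linear_on_subspaceD(1)[OF linear_G_left]
  show ?thesis
    unfolding bilinear_on_def linear_on_subspace_def using A l assms(2) by simp
qed

text \<open>The first part of the sum is the squared length of the trace, and the second is a trace
  in each of the two slots separately. Summing over all ordered pairs makes both visible; the
  diagonal pairs contribute zero.\<close>

lemma gauss_term_total_invariant:
  assumes e: "orthonormal I e" "finite I" and f: "orthonormal J f" "finite J"
    and U: "span (e ` I) = U" "span (f ` J) = U" and \<sigma>: "sym_form U \<sigma>"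
  shows "(\<Sum>i\<in>I. \<Sum>k\<in>I. gauss_term \<sigma> (e i) (e k)) = (\<Sum>i\<in>J. \<Sum>k\<in>J. gauss_term \<sigma> (f i) (f k))"
proof -
  have eU: "e i \<in> U" if "i \<in> I" for i unfolding U(1)[symmetric] using that by (simp add: span_base)
  have fU: "f j \<in> U" if "j \<in> J" for j unfolding U(2)[symmetric] using that by (simp add: span_base)
  have \<sigma>V: "\<sigma> x y \<in> V" if "x \<in> U" "y \<in> U" for x y using \<sigma> that unfolding sym_form_def by blast
  have bl: "bilinear_on U \<sigma>" using \<sigma> unfolding sym_form_def by blast
  note inv = trace_invariant[OF e f U]
  have tr: "(\<Sum>i\<in>I. \<sigma> (e i) (e i)) = (\<Sum>j\<in>J. \<sigma> (f j) (f j))" by (rule inv[OF bl])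
  have tr2: "(\<Sum>i\<in>K. \<Sum>k\<in>K. G (\<sigma> (h i) (h i)) (\<sigma> (h k) (h k)))
      = G (\<Sum>i\<in>K. \<sigma> (h i) (h i)) (\<Sum>i\<in>K. \<sigma> (h i) (h i))"
    if "\<And>i. i \<in> K \<Longrightarrow> h i \<in> U" for K and h :: "'z \<Rightarrow> 'v"
  proof -
    have s: "(\<Sum>i\<in>K. \<sigma> (h i) (h i)) \<in> V" by (intro subspace_sum subspace_V \<sigma>V that)
    have "G (\<Sum>i\<in>K. \<sigma> (h i) (h i)) (\<Sum>i\<in>K. \<sigma> (h i) (h i))
        = (\<Sum>i\<in>K. G (\<sigma> (h i) (h i)) (\<Sum>k\<in>K. \<sigma> (h k) (h k)))"
      by (rule G_sum1(2)[OF s]) (intro \<sigma>V that)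
    also have "\<dots> = (\<Sum>i\<in>K. \<Sum>k\<in>K. G (\<sigma> (h i) (h i)) (\<sigma> (h k) (h k)))"
      by (intro sum.cong refl G_sum1(1) \<sigma>V that)
    finally show ?thesis by simp
  qed
  have b1: "bilinear_on U (\<lambda>u v. G (\<sigma> x u) (\<sigma> x v))" if x: "x \<in> U" for x
    by (rule bilinear_on_G) (use bl x \<sigma>V in \<open>auto simp: bilinear_on_def\<close>)
  have b2: "bilinear_on U (\<lambda>u v. G (\<sigma> u x) (\<sigma> v x))" if x: "x \<in> U" for x
    by (rule bilinear_on_G) (use bl x \<sigma>V in \<open>auto simp: bilinear_on_def\<close>)
  have "(\<Sum>i\<in>I. \<Sum>k\<in>I. G (\<sigma> (e i) (e k)) (\<sigma> (e i) (e k)))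
      = (\<Sum>i\<in>I. \<Sum>k\<in>J. G (\<sigma> (e i) (f k)) (\<sigma> (e i) (f k)))"
    by (intro sum.cong refl inv b1 eU)
  also have "\<dots> = (\<Sum>k\<in>J. \<Sum>i\<in>I. G (\<sigma> (e i) (f k)) (\<sigma> (e i) (f k)))" by (rule sum.swap)
  also have "\<dots> = (\<Sum>k\<in>J. \<Sum>i\<in>J. G (\<sigma> (f i) (f k)) (\<sigma> (f i) (f k)))"
    by (intro sum.cong refl inv b2 fU)
  also have "\<dots> = (\<Sum>i\<in>J. \<Sum>k\<in>J. G (\<sigma> (f i) (f k)) (\<sigma> (f i) (f k)))" by (rule sum.swap)
  finally have sq: "(\<Sum>i\<in>I. \<Sum>k\<in>I. G (\<sigma> (e i) (e k)) (\<sigma> (e i) (e k)))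
      = (\<Sum>i\<in>J. \<Sum>k\<in>J. G (\<sigma> (f i) (f k)) (\<sigma> (f i) (f k)))" .
  show ?thesis
    unfolding gauss_term_def sum_subtractf sq using tr2[of I e] tr2[of J f] eU fU tr by simp
qed

lemma gauss_term_sym:
  "sym_form U \<sigma> \<Longrightarrow> x \<in> U \<Longrightarrow> y \<in> U \<Longrightarrow> gauss_term \<sigma> x y = gauss_term \<sigma> y x"
  unfolding gauss_term_def sym_form_def using sym by metis

lemma gauss_term_pairs:
  assumes \<sigma>: "sym_form U \<sigma>" and e: "\<And>i. i \<in> {1..n::nat} \<Longrightarrow> e i \<in> U"
  shows "(\<Sum>i=1..n. \<Sum>j=1..n. gauss_term \<sigma> (e i) (e j))
    = 2 * (\<Sum>i=1..n. \<Sum>j=i+1..n. gauss_term \<sigma> (e i) (e j))"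
  by (subst sum_pairs) (use gauss_term_sym[OF \<sigma> e e] in \<open>auto simp: gauss_term_def\<close>)

lemma gauss_term_pairs_invariant:
  assumes e: "orthonormal {1..n::nat} e" and f: "orthonormal {1..n} f"
    and U: "span (e ` {1..n}) = U" "span (f ` {1..n}) = U" and \<sigma>: "sym_form U \<sigma>"
  shows "(\<Sum>i=1..n. \<Sum>j=i+1..n. gauss_term \<sigma> (e i) (e j))
    = (\<Sum>i=1..n. \<Sum>j=i+1..n. gauss_term \<sigma> (f i) (f j))"
proof -
  have eU: "e i \<in> U" if "i \<in> {1..n}" for i unfolding U(1)[symmetric] using that by (simp add: span_base)
  have fU: "f i \<in> U" if "i \<in> {1..n}" for i unfolding U(2)[symmetric] using that by (simp add: span_base)
  show ?thesis
    using gauss_term_total_invariant[OF e finite_atLeastAtMost f finite_atLeastAtMost U \<sigma>]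
      gauss_term_pairs[OF \<sigma> eU] gauss_term_pairs[OF \<sigma> fU] by simp
qed

text \<open>The case of two basis vectors: there is one pair, so the term depends only on the
  plane.\<close>

lemma gauss_term_plane:
  assumes e: "orthonormal {1..2::nat} e" and f: "orthonormal {1..2::nat} f"
    and eq: "span (e ` {1..2}) = span (f ` {1..2})" and sub: "span (f ` {1..2}) \<subseteq> U" and \<sigma>: "sym_form U \<sigma>"
  shows "gauss_term \<sigma> (e 1) (e 2) = gauss_term \<sigma> (f 1) (f 2)"
proof -
  have s: "(\<Sum>i=1..2. \<Sum>j=i+1..2::nat. F i j) = F 1 2" for F :: "nat \<Rightarrow> nat \<Rightarrow> real"
    by (simp add: numeral_2_eq_2)
  show ?thesis
    using gauss_term_pairs_invariant[OF e f eq refl sym_form_subset[OF \<sigma> sub]] unfolding s .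
qed

text \<open>Complete squares after grouping the diagonal into the \<open>n - 2\<close> blocks
  \<open>s\<^sub>1\<^sub>1 + s\<^sub>2\<^sub>2\<close>, \<open>s\<^sub>3\<^sub>3 + s\<^sub>4\<^sub>4\<close>, \<open>s\<^sub>5\<^sub>5\<close>, ..., \<open>s\<^sub>n\<^sub>n\<close>, whose mean is \<open>t\<close>.\<close>

lemma chen_identity:
  fixes s :: "nat \<Rightarrow> nat \<Rightarrow> 'v"
  assumes n: "n \<ge> 4" and sV: "\<And>i j. i \<in> {1..n} \<Longrightarrow> j \<in> {1..n} \<Longrightarrow> s i j \<in> V"
    and ss: "\<And>i j. i \<in> {1..n} \<Longrightarrow> j \<in> {1..n} \<Longrightarrow> s i j = s j i"
  defines "F \<equiv> \<lambda>i j. G (s i i) (s j j) - G (s i j) (s i j)"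
    and "h \<equiv> \<Sum>i=1..n. s i i"
    and "t \<equiv> (1 / (real n - 2)) *\<^sub>R (\<Sum>i=1..n. s i i)"
    and "R \<equiv> {1..n} \<times> {1..n} - (\<lambda>i. (i, i)) ` {1..n} - {(1,2),(2,1),(3,4),(4,3)}"
    and "sq \<equiv> \<lambda>v. G v v"
  shows "2 * ((\<Sum>i=1..n. \<Sum>j=i+1..n. F i j) - F 1 2 - F 3 4)
    = (real n - 3) / (real n - 2) * sq h
      - (sq (s 1 1 + s 2 2 - t) + sq (s 3 3 + s 4 4 - t) + (\<Sum>i=5..n. sq (s i i - t)))
      - (\<Sum>(i,j)\<in>R. sq (s i j))"
proof -
  let ?N = "real n - 2"
  have N: "?N > 0" using n by simp
  have d: "s i i \<in> V" if "i \<in> {1..n}" for i using sV that by blast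
  have hV: "h \<in> V" unfolding h_def by (intro subspace_sum subspace_V d)
  have t: "t = (1 / ?N) *\<^sub>R h" unfolding t_def h_def ..
  have tV: "t \<in> V" unfolding t by (intro subspace_scale subspace_V hV)
  have split: "(\<Sum>i=1..n. u i) = u 1 + u 2 + u 3 + u 4 + (\<Sum>i=5..n. u i)" for u :: "nat \<Rightarrow> real"
  proof -
    have "{1..n} = {1,2,3,4} \<union> {5..n}" using n by auto
    then show ?thesis by (simp only: sum.union_disjoint) (subst sum.union_disjoint; simp)
  qed
  have hh: "(\<Sum>i=1..n. \<Sum>j=1..n. G (s i i) (s j j)) = G h h"
  proof -
    have "G h h = (\<Sum>i=1..n. G (s i i) h)" unfolding h_def by (rule G_sum1(2)[OF hV[unfolded h_def] d])
    also have "\<dots> = (\<Sum>i=1..n. \<Sum>j=1..n. G (s i i) (s j j))"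
      unfolding h_def by (intro sum.cong refl G_sum1(1) d)
    finally show ?thesis by simp
  qed
  have ht: "(\<Sum>i=1..n. G (s i i) t) = G h h / ?N"
  proof -
    have "(\<Sum>i=1..n. G (s i i) t) = G h t" unfolding h_def by (rule G_sum1(2)[OF tV d, symmetric])
    also have "\<dots> = G h h / ?N" unfolding t using G_scale(1)[OF hV hV] by simp
    finally show ?thesis .
  qed
  have tt: "G t t = G h h / ?N / ?N"
    unfolding t using hV by (simp add: G_scale subspace_scale[OF subspace_V])
  have "(\<Sum>i=1..n. \<Sum>j=1..n. F i j) = (\<Sum>i=1..n. F i i) + 2 * (\<Sum>i=1..n. \<Sum>j=i+1..n. F i j)"
    by (rule sum_pairs) (use ss d in \<open>auto simp: F_def sym\<close>)
  then have F2: "2 * (\<Sum>i=1..n. \<Sum>j=i+1..n. F i j) = G h h - (\<Sum>i=1..n. \<Sum>j=1..n. sq (s i j))"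
    unfolding F_def sum_subtractf hh by (simp add: sq_def)
  \<comment> \<open>The squares at (1,2) and (3,4) are kept apart because subtracting
    \<open>F 1 2\<close> and \<open>F 3 4\<close> cancels exactly these.\<close>
  have sqs: "(\<Sum>i=1..n. \<Sum>j=1..n. sq (s i j))
      = (\<Sum>i=1..n. sq (s i i)) + (\<Sum>(i,j)\<in>R. sq (s i j)) + 2 * sq (s 1 2) + 2 * sq (s 3 4)"
  proof -
    let ?D = "(\<lambda>i. (i, i)) ` {1..n}" and ?P = "{(1,2),(2,1),(3,4),(4,3)} :: (nat \<times> nat) set"
    have "?P \<subseteq> {1..n} \<times> {1..n}" "?D \<subseteq> {1..n} \<times> {1..n}" using n by auto
    then have e: "{1..n} \<times> {1..n} = ?D \<union> (R \<union> ?P)" unfolding R_def by blast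
    have fR: "finite R" unfolding R_def by (intro finite_Diff finite_cartesian_product finite_atLeastAtMost)
    have "(\<Sum>i=1..n. \<Sum>j=1..n. sq (s i j)) = (\<Sum>(i,j)\<in>{1..n} \<times> {1..n}. sq (s i j))"
      by (rule sum.cartesian_product)
    also have "\<dots> = (\<Sum>(i,j)\<in>?D. sq (s i j)) + (\<Sum>(i,j)\<in>R \<union> ?P. sq (s i j))"
      unfolding e by (rule sum.union_disjoint) (use fR in \<open>auto simp: R_def\<close>)
    also have "(\<Sum>(i,j)\<in>R \<union> ?P. sq (s i j)) = (\<Sum>(i,j)\<in>R. sq (s i j)) + (\<Sum>(i,j)\<in>?P. sq (s i j))"
      by (rule sum.union_disjoint) (use fR in \<open>auto simp: R_def\<close>)
    also have "(\<Sum>(i,j)\<in>?D. sq (s i j)) = (\<Sum>i=1..n. sq (s i i))"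
      by (subst sum.reindex) (auto simp: inj_on_def)
    also have "(\<Sum>(i,j)\<in>?P. sq (s i j)) = 2 * sq (s 1 2) + 2 * sq (s 3 4)"
      using ss[of 2 1] ss[of 4 3] n by simp
    finally show ?thesis by simp
  qed
  have two: "sq (s i i + s j j - t) = sq (s i i) + sq (s j j) + 2 * G (s i i) (s j j)
      - 2 * G (s i i) t - 2 * G (s j j) t + G t t" if "i \<in> {1..n}" "j \<in> {1..n}" for i j
    using d[OF that(1)] d[OF that(2)] tV sym[OF tV d[OF that(1)]] sym[OF tV d[OF that(2)]]
      sym[OF d[OF that(2)] d[OF that(1)]] unfolding sq_def
    by (simp add: G_add G_diff subspace_add[OF subspace_V] subspace_diff[OF subspace_V])
  have one: "(\<Sum>i=5..n. sq (s i i - t)) = (\<Sum>i=5..n. sq (s i i)) - 2 * (\<Sum>i=5..n. G (s i i) t)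
      + (real n - 4) * G t t"
  proof -
    have "(\<Sum>i=5..n. sq (s i i - t)) = (\<Sum>i=5..n. sq (s i i) - 2 * G (s i i) t + G t t)"
    proof (intro sum.cong refl)
      fix i assume "i \<in> {5..n}"
      then have i: "s i i \<in> V" by (intro d) auto
      show "sq (s i i - t) = sq (s i i) - 2 * G (s i i) t + G t t"
        using i tV sym[OF tV i] by (simp add: sq_def G_diff subspace_diff[OF subspace_V])
    qed
    also have "\<dots> = (\<Sum>i=5..n. sq (s i i)) - 2 * (\<Sum>i=5..n. G (s i i) t) + (real n - 4) * G t t"
      using n by (simp add: sum.distrib sum_subtractf sum_distrib_left of_nat_diff)
    finally show ?thesis .
  qed
  have "sq (s 1 1 + s 2 2 - t) + sq (s 3 3 + s 4 4 - t) + (\<Sum>i=5..n. sq (s i i - t))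
      = (\<Sum>i=1..n. sq (s i i)) + 2 * G (s 1 1) (s 2 2) + 2 * G (s 3 3) (s 4 4)
        - 2 * (\<Sum>i=1..n. G (s i i) t) + ?N * G t t"
    using n unfolding one split[of "\<lambda>i. sq (s i i)"] split[of "\<lambda>i. G (s i i) t"]
    by (simp add: two algebra_simps)
  \<comment> \<open>Centring at the mean \<open>t = h / (n - 2)\<close> adds -2 |h|^2/(n-2) + (n-2)
    |t|^2, that is -|h|^2/(n-2).\<close>
  also have "\<dots> = (\<Sum>i=1..n. sq (s i i)) + 2 * G (s 1 1) (s 2 2) + 2 * G (s 3 3) (s 4 4) - G h h / ?N"
    unfolding ht tt using N by simp
  finally have Q: "sq (s 1 1 + s 2 2 - t) + sq (s 3 3 + s 4 4 - t) + (\<Sum>i=5..n. sq (s i i - t))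
      = (\<Sum>i=1..n. sq (s i i)) + 2 * G (s 1 1) (s 2 2) + 2 * G (s 3 3) (s 4 4) - G h h / ?N" .
  have "(real n - 3) / ?N * sq h = G h h - G h h / ?N"
    unfolding sq_def using N by (simp add: field_simps)
  then show ?thesis
    unfolding Q right_diff_distrib F2 sqs by (simp add: F_def sq_def)
qed

text \<open>A basis \<open>f\<close> beginning with bases of the two planes turns the equality into
  the vanishing of a sum of squares for \<open>\<sigma>\<close> and \<open>\<sigma>'\<close> at
  once. Indices from 5 on form blocks of their own, so their diagonal entries equal the block mean
  and all their off-diagonal entries vanish.\<close>

lemma chen_equality:
  assumes e: "orthonormal {1..n::nat} e" "span (e ` {1..n}) = U" and n: "n \<ge> 6"
    and \<sigma>: "sym_form U \<sigma>" and \<sigma>': "sym_form U \<sigma>'"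
    and a: "orthonormal {1..2::nat} a" "a ` {1..2} \<subseteq> U" and b: "orthonormal {1..2::nat} b" "b ` {1..2} \<subseteq> U"
    and ab: "\<And>i j. i \<in> {1..2} \<Longrightarrow> j \<in> {1..2} \<Longrightarrow> G (a i) (b j) = 0"
  defines "t \<equiv> \<lambda>\<sigma>. (1 / (real n - 2)) *\<^sub>R (\<Sum>i=1..n. \<sigma> (e i) (e i))"
    and "h \<equiv> \<lambda>\<sigma>. \<Sum>i=1..n. \<sigma> (e i) (e i)"
    and "q \<equiv> \<lambda>x y. gauss_term \<sigma> x y + gauss_term \<sigma>' x y"
  assumes eq: "2 * ((\<Sum>i=1..n. \<Sum>j=i+1..n. q (e i) (e j)) - q (a 1) (a 2) - q (b 1) (b 2))
    = (real n - 3) / (real n - 2) * (G (h \<sigma>) (h \<sigma>) + G (h \<sigma>') (h \<sigma>'))"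
  obtains f where "orthonormal {1..n} f" "span (f ` {1..n}) = U"
    "\<And>\<tau>. \<tau> \<in> {\<sigma>, \<sigma>'} \<Longrightarrow> \<tau> (f 5) (f 5) = t \<tau> \<and> \<tau> (f 6) (f 6) = t \<tau> \<and>
      (\<forall>k\<in>{1..n}. k \<noteq> 5 \<longrightarrow> \<tau> (f 5) (f k) = 0)"
proof -
  have UV: "U \<subseteq> V" unfolding e(2)[symmetric] by (rule span_subset_V) (use e(1) in \<open>simp add: orthonormal_def\<close>)
  have a2: "a 1 \<in> U" "a 2 \<in> U" "b 1 \<in> U" "b 2 \<in> U" using a(2) b(2) by auto
  \<comment> \<open>Lists \<open>a 1\<close>, \<open>a 2\<close>, \<open>b 1\<close>,
    \<open>b 2\<close> as one family, orthonormal because the planes are orthogonal; it is extended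
    to all of \<open>U\<close>.\<close>
  define c where "c = (\<lambda>i::nat. if i \<le> 2 then a i else b (i - 2))"
  have four: "{1..4::nat} = {1,2,3,4}" by auto
  have c4: "c 1 = a 1" "c 2 = a 2" "c 3 = b 1" "c 4 = b 2" by (simp_all add: c_def)
  have oab: "G (a 1) (a 1) = 1" "G (a 2) (a 2) = 1" "G (a 1) (a 2) = 0" "G (a 2) (a 1) = 0"
    "G (b 1) (b 1) = 1" "G (b 2) (b 2) = 1" "G (b 1) (b 2) = 0" "G (b 2) (b 1) = 0"
    using orthonormalD(2)[OF a(1)] orthonormalD(2)[OF b(1)] by auto
  have oba: "G (a 1) (b 1) = 0" "G (a 1) (b 2) = 0" "G (a 2) (b 1) = 0" "G (a 2) (b 2) = 0" using ab by auto
  have oba': "G (b 1) (a 1) = 0" "G (b 2) (a 1) = 0" "G (b 1) (a 2) = 0" "G (b 2) (a 2) = 0"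
    using oba sym a2 UV by (metis subsetD)+
  have "orthonormal {1..4::nat} c"
    unfolding orthonormal_def four using a2 UV by (auto simp: c4 oab oba oba' simp del: One_nat_def)
  note oi = orthonormal_independent[OF e(1) finite_atLeastAtMost]
  have cU: "c ` {1..4} \<subseteq> U" unfolding four using a2 by (auto simp: c4 simp del: One_nat_def)
  have card: "card (e ` {1..n}) = n" using card_image[OF oi(1)] by simp
  obtain f where f: "orthonormal {1..n} f" "span (f ` {1..n}) = U" "\<forall>i\<in>{1..4}. f i = c i"
    using orthonormal_extend_dim[OF \<open>orthonormal {1..4} c\<close> _ oi(2) e(2)[symmetric] UV cU] card by auto
  have f4: "f 1 = a 1" "f 2 = a 2" "f 3 = b 1" "f 4 = b 2" using f(3) c4 unfolding four by simp_all
  have fU: "f i \<in> U" if "i \<in> {1..n}" for i unfolding f(2)[symmetric] using that by (simp add: span_base)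
  define R :: "(nat \<times> nat) set"
    where "R = {1..n} \<times> {1..n} - (\<lambda>i. (i, i)) ` {1..n} - {(1,2),(2,1),(3,4),(4,3)}"
  have fR: "finite R" unfolding R_def by (intro finite_Diff finite_cartesian_product finite_atLeastAtMost)
  have RD: "i \<in> {1..n}" "j \<in> {1..n}" if "(i, j) \<in> R" for i j
    using that unfolding R_def by blast+
  define Q where "Q = (\<lambda>\<tau>. (G (\<tau> (f 1) (f 1) + \<tau> (f 2) (f 2) - t \<tau>) (\<tau> (f 1) (f 1) + \<tau> (f 2) (f 2) - t \<tau>)
      + G (\<tau> (f 3) (f 3) + \<tau> (f 4) (f 4) - t \<tau>) (\<tau> (f 3) (f 3) + \<tau> (f 4) (f 4) - t \<tau>)
      + (\<Sum>i=5..n. G (\<tau> (f i) (f i) - t \<tau>) (\<tau> (f i) (f i) - t \<tau>))))"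
  define P where "P = (\<lambda>\<tau>. \<Sum>(i,j)\<in>R. G (\<tau> (f i) (f j)) (\<tau> (f i) (f j)))"
  have main: "2 * ((\<Sum>i=1..n. \<Sum>j=i+1..n. gauss_term \<tau> (e i) (e j)) - gauss_term \<tau> (a 1) (a 2) - gauss_term \<tau> (b 1) (b 2))
      = (real n - 3) / (real n - 2) * G (h \<tau>) (h \<tau>) - Q \<tau> - P \<tau>"
    and V: "\<And>i j. i \<in> {1..n} \<Longrightarrow> j \<in> {1..n} \<Longrightarrow> \<tau> (f i) (f j) \<in> V" and tV: "t \<tau> \<in> V"
    if \<tau>: "sym_form U \<tau>" for \<tau>
  proof -
    show V: "\<tau> (f i) (f j) \<in> V" if "i \<in> {1..n}" "j \<in> {1..n}" for i j
      using \<tau> fU that unfolding sym_form_def by blast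
    have s: "\<tau> (f i) (f j) = \<tau> (f j) (f i)" if "i \<in> {1..n}" "j \<in> {1..n}" for i j
      using \<tau> fU that unfolding sym_form_def by blast
    have tr: "(\<Sum>i=1..n. \<tau> (e i) (e i)) = (\<Sum>i=1..n. \<tau> (f i) (f i))"
      by (rule trace_invariant[OF e(1) _ f(1) _ e(2) f(2)]) (use \<tau> in \<open>simp_all add: sym_form_def\<close>)
    show "t \<tau> \<in> V" unfolding t_def tr by (intro subspace_scale subspace_sum subspace_V V)
    have n4: "n \<ge> 4" using n by simp
    show "2 * ((\<Sum>i=1..n. \<Sum>j=i+1..n. gauss_term \<tau> (e i) (e j)) - gauss_term \<tau> (a 1) (a 2) - gauss_term \<tau> (b 1) (b 2))
      = (real n - 3) / (real n - 2) * G (h \<tau>) (h \<tau>) - Q \<tau> - P \<tau>"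
      unfolding gauss_term_pairs_invariant[OF e(1) f(1) e(2) f(2) \<tau>] f4[symmetric]
      using chen_identity[OF n4 V s]
      unfolding Q_def P_def t_def h_def tr R_def gauss_term_def by simp
  qed
  have nonneg: "Q \<tau> \<ge> 0" "P \<tau> \<ge> 0" if \<tau>: "sym_form U \<tau>" for \<tau>
  proof -
    have "\<tau> (f 1) (f 1) + \<tau> (f 2) (f 2) - t \<tau> \<in> V" "\<tau> (f 3) (f 3) + \<tau> (f 4) (f 4) - t \<tau> \<in> V"
      by (intro subspace_add subspace_diff subspace_V V[OF \<tau>] tV[OF \<tau>]; use n in simp)+
    moreover have "\<tau> (f i) (f i) - t \<tau> \<in> V" if "i \<in> {5..n}" for i
      by (intro subspace_diff subspace_V V[OF \<tau>] tV[OF \<tau>]; use that in simp)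
    ultimately show "Q \<tau> \<ge> 0" unfolding Q_def by (intro add_nonneg_nonneg sum_nonneg G_nonneg)
    show "P \<tau> \<ge> 0" unfolding P_def
      by (rule sum_nonneg) (use RD in \<open>auto intro!: G_nonneg V[OF \<tau>] simp del: atLeastAtMost_iff\<close>)
  qed
  \<comment> \<open>Only the sum of the two defects is known to vanish; nonnegativity separates them
    afterwards.\<close>
  have "Q \<sigma> + P \<sigma> + (Q \<sigma>' + P \<sigma>') = 0"
  proof -
    have arith: "x + y + (z + w) = 0"
      if "2 * (S - A - B) = Y" "S = S1 + S2" "A = A1 + A2" "B = B1 + B2" "Y = Y1 + Y2"
        "2 * (S1 - A1 - B1) = Y1 - x - y" "2 * (S2 - A2 - B2) = Y2 - z - w"
      for x y z w S A B S1 S2 A1 A2 B1 B2 Y Y1 Y2 :: real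
    proof -
      have "x + y = Y1 - 2 * (S1 - A1 - B1)" "z + w = Y2 - 2 * (S2 - A2 - B2)" using that(6,7) by simp_all
      then have "x + y + (z + w) = (Y1 + Y2) - 2 * ((S1 + S2) - (A1 + A2) - (B1 + B2))" by simp
      then show ?thesis using that(1) unfolding that(2-5) by simp
    qed
    have "(\<Sum>i=1..n. \<Sum>j=i+1..n. q (e i) (e j)) = (\<Sum>i=1..n. \<Sum>j=i+1..n. gauss_term \<sigma> (e i) (e j))
        + (\<Sum>i=1..n. \<Sum>j=i+1..n. gauss_term \<sigma>' (e i) (e j))"
      unfolding q_def by (simp only: sum.distrib)
    from arith[OF eq this _ _ distrib_left main[OF \<sigma>] main[OF \<sigma>']] show ?thesis
      unfolding q_def by blast
  qed
  then have z: "Q \<tau> = 0" "P \<tau> = 0" if "\<tau> \<in> {\<sigma>, \<sigma>'}" for \<tau>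
    using nonneg[OF \<sigma>] nonneg[OF \<sigma>'] that by auto
  show thesis
  proof (rule that[OF f(1,2)])
    fix \<tau> assume \<tau>': "\<tau> \<in> {\<sigma>, \<sigma>'}"
    then have \<tau>: "sym_form U \<tau>" using \<sigma> \<sigma>' by auto
    have dV: "\<tau> (f i) (f i) - t \<tau> \<in> V" if "i \<in> {5..n}" for i
      by (intro subspace_diff subspace_V V[OF \<tau>] tV[OF \<tau>]; use that in simp)
    have "\<tau> (f 1) (f 1) + \<tau> (f 2) (f 2) - t \<tau> \<in> V" "\<tau> (f 3) (f 3) + \<tau> (f 4) (f 4) - t \<tau> \<in> V"
      by (intro subspace_add subspace_diff subspace_V V[OF \<tau>] tV[OF \<tau>]; use n in simp)+
    then have "(\<Sum>i=5..n. G (\<tau> (f i) (f i) - t \<tau>) (\<tau> (f i) (f i) - t \<tau>)) \<le> 0"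
      using z(1)[OF \<tau>'] G_nonneg[of "\<tau> (f 1) (f 1) + \<tau> (f 2) (f 2) - t \<tau>"]
        G_nonneg[of "\<tau> (f 3) (f 3) + \<tau> (f 4) (f 4) - t \<tau>"] unfolding Q_def by linarith
    moreover have nn: "0 \<le> G (\<tau> (f i) (f i) - t \<tau>) (\<tau> (f i) (f i) - t \<tau>)" if "i \<in> {5..n}" for i
      by (rule G_nonneg[OF dV[OF that]])
    ultimately have "(\<Sum>i=5..n. G (\<tau> (f i) (f i) - t \<tau>) (\<tau> (f i) (f i) - t \<tau>)) = 0"
      using sum_nonneg[of "{5..n}"] by (metis (mono_tags, lifting) order_antisym)
    then have d0: "\<forall>i\<in>{5..n}. G (\<tau> (f i) (f i) - t \<tau>) (\<tau> (f i) (f i) - t \<tau>) = 0"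
      using sum_nonneg_eq_0_iff[of "{5..n}"] nn by (metis (mono_tags, lifting) finite_atLeastAtMost)
    have d: "\<tau> (f i) (f i) = t \<tau>" if "i \<in> {5..n}" for i
      using d0 that G_eq_0[OF dV[OF that]] by simp
    have RV: "\<forall>x\<in>R. 0 \<le> (case x of (i, j) \<Rightarrow> G (\<tau> (f i) (f j)) (\<tau> (f i) (f j)))"
      using RD by (auto intro!: G_nonneg V[OF \<tau>] simp del: atLeastAtMost_iff)
    have "\<forall>x\<in>R. (case x of (i, j) \<Rightarrow> G (\<tau> (f i) (f j)) (\<tau> (f i) (f j))) = 0"
      using z(2)[OF \<tau>'] sum_nonneg_eq_0_iff[OF fR, of "\<lambda>x. case x of (i, j) \<Rightarrow> G (\<tau> (f i) (f j)) (\<tau> (f i) (f j))"] RV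
      unfolding P_def by blast
    then have "G (\<tau> (f i) (f j)) (\<tau> (f i) (f j)) = 0" if "(i, j) \<in> R" for i j using that by auto
    then have o: "\<tau> (f i) (f j) = 0" if "(i, j) \<in> R" for i j
      using that G_eq_0[OF V[OF \<tau>, of i j]] by (meson RD)
    show "\<tau> (f 5) (f 5) = t \<tau> \<and> \<tau> (f 6) (f 6) = t \<tau> \<and> (\<forall>k\<in>{1..n}. k \<noteq> 5 \<longrightarrow> \<tau> (f 5) (f k) = 0)"
    proof (intro conjI ballI impI)
      fix k assume k: "k \<in> {1..n}" "k \<noteq> 5"
      then have "(5, k) \<in> R" using n unfolding R_def by auto
      then show "\<tau> (f 5) (f k) = 0" by (rule o)
    qed (use d[of 5] d[of 6] n in auto)
  qed
qed

end

section \<open>Lagrangian submanifolds\<close>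

lemma three_arith: "\<beta> + 2 + 1 = (\<beta>::3)" "\<beta> + 2 + 2 = \<beta> + (1::3)" "\<beta> + 1 + 1 = \<beta> + (2::3)"
  "\<beta> \<noteq> \<beta> + (1::3)" "\<beta> \<noteq> \<beta> + (2::3)" "\<beta> + 1 \<noteq> \<beta> + (2::3)"
proof -
  have "(3::3) = 0" by simp
  moreover have "(2::3) + 1 = 3" by simp
  ultimately have *: "(2::3) + 1 = 0" by (rule trans[rotated])
  show "\<beta> + 2 + 1 = \<beta>" using * by (simp add: add.assoc)
  show "\<beta> + 1 + 1 = \<beta> + (2::3)" by (simp add: add.assoc)
  have "(2::3) + 2 = 1" by simp
  then show "\<beta> + 2 + 2 = \<beta> + (1::3)" by (metis add.assoc)
qed simp_all

text \<open>Lets a sum over the three structures start at any index, so that one cyclic computation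
  covers all three.\<close>

lemma three_UNIV: "(UNIV :: 3 set) = {\<beta>, \<beta> + 1, \<beta> + 2}"
proof -
  have "card {\<beta>, \<beta> + 1, \<beta> + 2} = CARD(3)" using three_arith[of \<beta>] by simp
  then show ?thesis by (metis card_subset_eq finite subset_UNIV)
qed

text \<open>Injectivity is included so that the cardinality of the image can be counted by the index
  set.\<close>

lemma independent_family:
  fixes v :: "'i \<Rightarrow> 'v::real_vector"
  assumes "finite I" and z: "\<And>c. (\<Sum>i\<in>I. c i *\<^sub>R v i) = 0 \<Longrightarrow> \<forall>i\<in>I. c i = 0"
  shows "inj_on v I" "independent (v ` I)"
proof -
  show inj: "inj_on v I"
  proof (rule inj_onI, rule ccontr)
    fix i j assume ij: "i \<in> I" "j \<in> I" "v i = v j" "i \<noteq> j"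
    let ?c = "\<lambda>k. (if k = i then 1 else 0) - (if k = j then 1 else 0) :: real"
    have "(\<Sum>k\<in>I. ?c k *\<^sub>R v k) = (\<Sum>k\<in>I. (if k = i then v k else 0)) - (\<Sum>k\<in>I. (if k = j then v k else 0))"
      unfolding sum_subtractf[symmetric] by (intro sum.cong refl) auto
    also have "\<dots> = 0" using ij assms(1) by simp
    finally have "\<forall>k\<in>I. ?c k = 0" by (rule z)
    from bspec[OF this ij(1)] show False using ij(4) by simp
  qed
  show "independent (v ` I)"
  proof
    assume "dependent (v ` I)"
    then obtain u w where u: "w \<in> v ` I" "u w \<noteq> 0" "(\<Sum>w\<in>v ` I. u w *\<^sub>R w) = 0"
      unfolding dependent_finite[OF finite_imageI[OF assms(1)]] by metis
    have "(\<Sum>i\<in>I. u (v i) *\<^sub>R v i) = 0"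
      using u(3) unfolding sum.reindex[OF inj] by (simp add: comp_def)
    from z[OF this] show False using u(1,2) by auto
  qed
qed

context inner_space
begin

text \<open>If \<open>x\<^sub>0 + J\<^sub>1 x\<^sub>1 + J\<^sub>2 x\<^sub>2 + J\<^sub>3 x\<^sub>3 = 0\<close> with all \<open>x\<^sub>i\<close> in \<open>U\<close>, then \<open>x\<^sub>0 = 0\<close> by orthogonality, and
  applying \<open>J\<^sub>i\<close> turns \<open>J\<^sub>i x\<^sub>i\<close> into the only summand in \<open>U\<close>.  So \<open>U\<close> and its three images span \<open>V\<close>.\<close>

lemma quaternionic_normal_zero:
  fixes J :: "3 \<Rightarrow> 'v \<Rightarrow> 'v"
  assumes J: "\<And>\<alpha>. linear_on_subspace V (J \<alpha>)" "\<And>\<alpha> v. v \<in> V \<Longrightarrow> J \<alpha> v \<in> V"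
    and rel: "\<And>\<alpha> v. v \<in> V \<Longrightarrow> J \<alpha> (J \<alpha> v) = - v"
      "\<And>\<alpha> v. v \<in> V \<Longrightarrow> J \<alpha> (J (\<alpha> + 1) v) = J (\<alpha> + 2) v"
      "\<And>\<alpha> v. v \<in> V \<Longrightarrow> J (\<alpha> + 1) (J \<alpha> v) = - J (\<alpha> + 2) v"
    and f: "orthonormal {1..n::nat} f" "span (f ` {1..n}) = U"
    and real: "\<And>\<alpha> x y. x \<in> U \<Longrightarrow> y \<in> U \<Longrightarrow> G (J \<alpha> x) y = 0"
    and B: "V = span B" "finite B" "card B = 4 * n"
    and t: "t \<in> V" "\<And>i. i \<in> {1..n} \<Longrightarrow> G t (f i) = 0" "\<And>\<alpha> i. i \<in> {1..n} \<Longrightarrow> G t (J \<alpha> (f i)) = 0"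
  shows "t = 0"
proof -
  let ?I = "{1..n} \<times> (UNIV :: 3 option set)"
  define v where "v = (\<lambda>(i, k). case k of None \<Rightarrow> f i | Some \<alpha> \<Rightarrow> J \<alpha> (f i))"
  have fV: "f i \<in> V" if "i \<in> {1..n}" for i using orthonormalD(1)[OF f(1) that] .
  have fU: "f i \<in> U" if "i \<in> {1..n}" for i unfolding f(2)[symmetric] using that by (simp add: span_base)
  have sU: "subspace U" unfolding f(2)[symmetric] by simp
  have UV: "x \<in> V" if "x \<in> U" for x
    using span_subset_V[of "f ` {1..n}"] fV f(2) that by blast
  have fin: "finite ?I" by simp
  have c0: "\<forall>i\<in>?I. c i = 0" if c: "(\<Sum>i\<in>?I. c i *\<^sub>R v i) = 0" for c
  proof -
    define x0 where "x0 = (\<Sum>i=1..n. c (i, None) *\<^sub>R f i)"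
    define x where "x = (\<lambda>\<alpha>. \<Sum>i=1..n. c (i, Some \<alpha>) *\<^sub>R f i)"
    have xU: "x0 \<in> U" "x \<alpha> \<in> U" for \<alpha>
      unfolding x0_def x_def by (intro subspace_sum subspace_scale sU fU; simp)+
    have xV: "x0 \<in> V" "x \<alpha> \<in> V" for \<alpha> using xU UV by blast+
    have JV: "J \<alpha> (x \<beta>) \<in> V" for \<alpha> \<beta> by (rule J(2)[OF xV(2)])
    have Jx: "J \<alpha> (x \<alpha>) = (\<Sum>i=1..n. c (i, Some \<alpha>) *\<^sub>R J \<alpha> (f i))" for \<alpha>
      unfolding x_def by (rule linear_on_subspace_sum[OF subspace_V J(1) fV])
    have "(\<Sum>i\<in>?I. c i *\<^sub>R v i) = (\<Sum>i=1..n. \<Sum>k\<in>UNIV. c (i, k) *\<^sub>R v (i, k))"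
      by (simp add: sum.cartesian_product)
    also have "\<dots> = (\<Sum>i=1..n. c (i, None) *\<^sub>R f i + (\<Sum>\<alpha>\<in>UNIV. c (i, Some \<alpha>) *\<^sub>R J \<alpha> (f i)))"
      by (intro sum.cong refl) (simp add: UNIV_option_conv sum.reindex v_def)
    also have "\<dots> = x0 + (\<Sum>i=1..n. \<Sum>\<alpha>\<in>UNIV. c (i, Some \<alpha>) *\<^sub>R J \<alpha> (f i))"
      by (simp only: sum.distrib x0_def)
    also have "(\<Sum>i=1..n. \<Sum>\<alpha>\<in>UNIV. c (i, Some \<alpha>) *\<^sub>R J \<alpha> (f i)) = (\<Sum>\<alpha>\<in>UNIV. J \<alpha> (x \<alpha>))"
      unfolding Jx by (rule sum.swap)
    finally have e: "x0 + (\<Sum>\<alpha>\<in>UNIV. J \<alpha> (x \<alpha>)) = 0" using c by simp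
    have sV: "(\<Sum>\<alpha>\<in>UNIV. J \<alpha> (x \<alpha>)) \<in> V" by (intro subspace_sum subspace_V JV)
    have "G (\<Sum>\<alpha>\<in>UNIV. J \<alpha> (x \<alpha>)) x0 = 0"
      using G_sum1(2)[OF xV(1), of UNIV "\<lambda>\<alpha>. J \<alpha> (x \<alpha>)"] JV real xU by simp
    then have "G x0 x0 = 0"
      using G_add(2)[OF xV(1) sV xV(1)] e G_zero(2)[OF xV(1)] by simp
    then have x0: "x0 = 0" using G_eq_0[OF xV(1)] by simp
    have x\<beta>: "x \<beta> = 0" for \<beta>
    proof -
      have U3: "(\<Sum>\<alpha>\<in>UNIV. J \<alpha> (x \<alpha>)) = J \<beta> (x \<beta>) + (J (\<beta> + 1) (x (\<beta> + 1)) + J (\<beta> + 2) (x (\<beta> + 2)))"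
        unfolding three_UNIV[of \<beta>] using three_arith[of \<beta>] by simp
      have "J \<beta> (J \<beta> (x \<beta>) + (J (\<beta> + 1) (x (\<beta> + 1)) + J (\<beta> + 2) (x (\<beta> + 2)))) = J \<beta> 0"
        using e x0 U3 by simp
      then have "J \<beta> (J \<beta> (x \<beta>)) + (J \<beta> (J (\<beta> + 1) (x (\<beta> + 1))) + J \<beta> (J (\<beta> + 2) (x (\<beta> + 2)))) = 0"
        using linear_on_subspaceD(2)[OF J(1) JV subspace_add[OF subspace_V JV JV]]
          linear_on_subspaceD(2)[OF J(1) JV JV] linear_on_subspaceD(6)[OF J(1) xV(1) xV(1)] by simp
      \<comment> \<open>The anticommutation rule at index \<beta> + 2, whose successor modulo 3 is
        \<beta>.\<close>
      moreover have "J \<beta> (J (\<beta> + 2) w) = - J (\<beta> + 1) w" if "w \<in> V" for w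
        using rel(3)[OF that, of "\<beta> + 2"] unfolding three_arith .
      ultimately have e2: "- x \<beta> + (J (\<beta> + 2) (x (\<beta> + 1)) + - J (\<beta> + 1) (x (\<beta> + 2))) = 0"
        by (simp only: rel(1)[OF xV(2)] rel(2)[OF xV(2)] xV(2))
      have "x \<beta> = x \<beta> + (- x \<beta> + (J (\<beta> + 2) (x (\<beta> + 1)) + - J (\<beta> + 1) (x (\<beta> + 2))))"
        by (simp only: e2 add_0_right)
      also have "\<dots> = J (\<beta> + 2) (x (\<beta> + 1)) - J (\<beta> + 1) (x (\<beta> + 2))" by simp
      finally have "x \<beta> = J (\<beta> + 2) (x (\<beta> + 1)) - J (\<beta> + 1) (x (\<beta> + 2))" .
      then have "G (x \<beta>) (x \<beta>) = G (J (\<beta> + 2) (x (\<beta> + 1)) - J (\<beta> + 1) (x (\<beta> + 2))) (x \<beta>)" by simp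
      also have "\<dots> = 0" unfolding G_diff(2)[OF JV JV xV(2)] using real xU by simp
      finally show ?thesis using G_eq_0[OF xV(2)] by simp
    qed
    have co: "c (i, k) = G (\<Sum>j=1..n. c (j, k) *\<^sub>R f j) (f i)" if i: "i \<in> {1..n}" for i k
    proof -
      have "G (\<Sum>j=1..n. c (j, k) *\<^sub>R f j) (f i) = (\<Sum>j=1..n. c (j, k) * G (f j) (f i))"
        by (rule G_sum(2)[OF fV[OF i] fV])
      also have "\<dots> = (\<Sum>j=1..n. if j = i then c (i, k) else 0)"
        by (intro sum.cong refl) (use orthonormalD(2)[OF f(1) _ i] in simp)
      finally show ?thesis using i by simp
    qed
    show ?thesis
    proof
      fix z assume "z \<in> ?I"
      then obtain i k where z: "z = (i, k)" "i \<in> {1..n}" by auto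
      have "(\<Sum>j=1..n. c (j, k) *\<^sub>R f j) = 0"
        using x0 x\<beta> by (cases k) (simp_all add: x0_def x_def)
      then show "c z = 0" unfolding z(1) co[OF z(2)] using G_zero(2)[OF fV[OF z(2)]] by simp
    qed
  qed
  have vV: "v i \<in> V" if "i \<in> ?I" for i
    using that fV J(2) by (auto simp: v_def split: option.splits)
  have ortho: "G t (v i) = 0" if "i \<in> ?I" for i
    using that t(2,3) by (auto simp: v_def split: option.splits)
  have inj: "inj_on v ?I" by (rule independent_family(1)[OF fin]) (rule c0)
  have ind: "independent (v ` ?I)" by (rule independent_family(2)[OF fin]) (rule c0)
  have cardI: "card (v ` ?I) = 4 * n"
    unfolding card_image[OF inj] by (simp add: card_UNIV_option)
  \<comment> \<open>Dimension count: the family has 4n independent members, so a \<open>t\<close>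
    outside its span would give 4n + 1 independent vectors in the span of 4n.\<close>
  have tspan: "t \<in> span (v ` ?I)"
  proof (rule ccontr)
    assume nt: "t \<notin> span (v ` ?I)"
    then have "independent (insert t (v ` ?I))" using ind by (rule independent_insertI)
    moreover have "insert t (v ` ?I) \<subseteq> span B"
      unfolding B(1)[symmetric] by (intro insert_subsetI image_subsetI t(1) vV)
    ultimately have "card (insert t (v ` ?I)) \<le> card B" using independent_span_bound[OF B(2)] by blast
    moreover have "t \<notin> v ` ?I" using nt span_base by metis
    ultimately show False using cardI B(3) fin by simp
  qed
  have "span (v ` ?I) \<subseteq> {w \<in> V. G t w = 0}"
  proof (rule span_minimal)
    show "v ` ?I \<subseteq> {w \<in> V. G t w = 0}" using vV ortho by blast
    show "subspace {w \<in> V. G t w = 0}"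
      using t(1) subspace_V unfolding subspace_def by (auto simp: G_add G_scale G_zero)
  qed
  then have "G t t = 0" using tspan by blast
  then show ?thesis using G_eq_0[OF t(1)] by simp
qed

end

section \<open>Pointwise geometry of a Lagrangian submanifold\<close>

locale lagrangian = dual_pair N S n g D Ds
  for N :: "('a, 'e::euclidean_space) smooth_mfd" and S n g D Ds +
  fixes Q :: "'a \<Rightarrow> ('a tvec \<Rightarrow> 'a tvec) set" and c :: real
  assumes kaehler: "quaternionic_kaehler_like N g D Ds Q"
    and curv: "has_quaternionic_curvature N g D Ds Q c"
    and real: "totally_real N g Q S"
    and dim: "DIM('e) = 4 * n"
begin

context
  fixes p :: 'a and U :: "'a set" and J :: "3 \<Rightarrow> 'a \<Rightarrow> 'a tvec \<Rightarrow> 'a tvec"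
  assumes p: "p \<in> topspace S" and pU: "p \<in> U" and lb: "local_basis N Q U J"
begin

interpretation inner_space "TN p" "g p" by (rule inner_ambient[OF p])

lemma J_props:
  shows J_linear: "linear_on_subspace (TN p) (J \<alpha> p)"
    and J_TN: "v \<in> TN p \<Longrightarrow> J \<alpha> p v \<in> TN p"
    and J_square: "v \<in> TN p \<Longrightarrow> J \<alpha> p (J \<alpha> p v) = - v"
    and J_mult: "v \<in> TN p \<Longrightarrow> J \<alpha> p (J (\<alpha> + 1) p v) = J (\<alpha> + 2) p v"
    and J_mult': "v \<in> TN p \<Longrightarrow> J (\<alpha> + 1) p (J \<alpha> p v) = - J (\<alpha> + 2) p v"
    and J_vfield: "vfield_at N (mtop N) p X \<Longrightarrow> vfield_at N (mtop N) p (\<lambda>q. J \<alpha> q (X q))"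
proof -
  have "\<forall>p\<in>U. \<forall>\<alpha>. J \<alpha> p \<in> tangent_End N p \<and>
       (\<forall>v \<in> TN p. J \<alpha> p (J \<alpha> p v) = - v \<and> J \<alpha> p (J (\<alpha> + 1) p v) = J (\<alpha> + 2) p v \<and>
          J (\<alpha> + 1) p (J \<alpha> p v) = - J (\<alpha> + 2) p v) \<and>
       (\<forall>X. vfield_at N (mtop N) p X \<longrightarrow> vfield_at N (mtop N) p (\<lambda>q. J \<alpha> q (X q)))"
    using lb unfolding local_basis_def by (rule conjunct1[OF conjunct2])
  note * = this[THEN bspec, OF pU, THEN spec, of \<alpha>]
  have E: "J \<alpha> p \<in> tangent_End N p" by (rule *[THEN conjunct1])
  show "linear_on_subspace (TN p) (J \<alpha> p)" using E by (simp add: tangent_End_def)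
  show "v \<in> TN p \<Longrightarrow> J \<alpha> p v \<in> TN p" using E by (simp add: tangent_End_def)
  note r = *[THEN conjunct2, THEN conjunct1, THEN bspec]
  show "v \<in> TN p \<Longrightarrow> J \<alpha> p (J \<alpha> p v) = - v" by (rule r[THEN conjunct1])
  show "v \<in> TN p \<Longrightarrow> J \<alpha> p (J (\<alpha> + 1) p v) = J (\<alpha> + 2) p v"
    by (rule r[THEN conjunct2, THEN conjunct1])
  show "v \<in> TN p \<Longrightarrow> J (\<alpha> + 1) p (J \<alpha> p v) = - J (\<alpha> + 2) p v"
    by (rule r[THEN conjunct2, THEN conjunct2])
  show "vfield_at N (mtop N) p X \<Longrightarrow> vfield_at N (mtop N) p (\<lambda>q. J \<alpha> q (X q))"
    by (rule *[THEN conjunct2, THEN conjunct2, THEN spec, THEN mp])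
qed

lemma J_real: "q \<in> U \<Longrightarrow> q \<in> topspace S \<Longrightarrow> x \<in> T q \<Longrightarrow> y \<in> T q \<Longrightarrow> g q (J \<alpha> q x) y = 0"
  using real lb unfolding totally_real_def by blast

definition Jstar :: "3 \<Rightarrow> 'a tvec \<Rightarrow> 'a tvec" where "Jstar \<alpha> = star_End N g p (J \<alpha> p)"

lemma Jstar:
  assumes y: "y \<in> TN p"
  shows Jstar_TN: "Jstar \<alpha> y \<in> TN p"
    and Jstar_dual: "x \<in> TN p \<Longrightarrow> g p x (Jstar \<alpha> y) = - g p (J \<alpha> p x) y"
proof -
  obtain B where B: "finite B" "span B = TN p" using amb.tangent_space_basis[OF topspace_ambient[OF p]] by metis
  have "linear_on_subspace (TN p) (\<lambda>x. - g p (J \<alpha> p x) y)"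
    unfolding linear_on_subspace_def
  proof (intro ballI allI)
    fix u v a b assume "u \<in> TN p" "v \<in> TN p"
    then show "- g p (J \<alpha> p (a *\<^sub>R u + b *\<^sub>R v)) y = a *\<^sub>R (- g p (J \<alpha> p u) y) + b *\<^sub>R (- g p (J \<alpha> p v) y)"
      using linear_on_subspaceD(1)[OF J_linear] linear_on_subspaceD(1)[OF linear_G_left[OF y] J_TN J_TN]
      by simp
  qed
  from riesz_ex1[OF B(2)[symmetric] B(1) this]
  have ex: "\<exists>!z. z \<in> TN p \<and> (\<forall>x\<in>TN p. g p (J \<alpha> p x) y + g p x z = 0)"
    by (simp add: eq_neg_iff_add_eq_0 add.commute eq_commute[of "- _"])
  have "Jstar \<alpha> y = (THE z. z \<in> TN p \<and> (\<forall>x\<in>TN p. g p (J \<alpha> p x) y + g p x z = 0))"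
    unfolding Jstar_def star_End_def using y by simp
  then have "Jstar \<alpha> y \<in> TN p \<and> (\<forall>x\<in>TN p. g p (J \<alpha> p x) y + g p x (Jstar \<alpha> y) = 0)"
    using theI'[OF ex] by simp
  then show "Jstar \<alpha> y \<in> TN p" "x \<in> TN p \<Longrightarrow> g p x (Jstar \<alpha> y) = - g p (J \<alpha> p x) y"
    by (auto simp: eq_neg_iff_add_eq_0 add.commute)
qed

lemma Jstar_real:
  assumes x: "x \<in> T p" and y: "y \<in> T p"
  shows "g p (Jstar \<alpha> x) y = 0"
  using Jstar_dual[OF tangent_TN[OF x] tangent_TN[OF y]] J_real[OF pU p y x]
    sym[OF Jstar_TN[OF tangent_TN[OF x]] tangent_TN[OF y]] by simp

lemma G_eqI': "u \<in> TN p \<Longrightarrow> v \<in> TN p \<Longrightarrow> (\<And>w. w \<in> TN p \<Longrightarrow> g p w u = g p w v) \<Longrightarrow> u = v"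
  using G_eqI sym by metis

lemma Jstar_twice:
  assumes "v \<in> TN p" "w \<in> TN p"
  shows "g p w (Jstar \<alpha> (Jstar \<beta> v)) = g p (J \<beta> p (J \<alpha> p w)) v"
  using Jstar_dual[OF Jstar_TN[OF assms(1)] assms(2)] Jstar_dual[OF assms(1) J_TN[OF assms(2)]] by simp

text \<open>Taking adjoints reverses the order of a product, and anticommutation turns this into a
  sign. The minus sign in the definition of the dual structure absorbs it, so the dual structures
  satisfy the same quaternion relations.\<close>

lemma Jstar_props:
  shows "linear_on_subspace (TN p) (Jstar \<alpha>)"
    and "v \<in> TN p \<Longrightarrow> Jstar \<alpha> (Jstar \<alpha> v) = - v"
    and "v \<in> TN p \<Longrightarrow> Jstar \<alpha> (Jstar (\<alpha> + 1) v) = Jstar (\<alpha> + 2) v"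
    and "v \<in> TN p \<Longrightarrow> Jstar (\<alpha> + 1) (Jstar \<alpha> v) = - Jstar (\<alpha> + 2) v"
proof -
  note m = subspace_neg[OF subspace_V]
  show "linear_on_subspace (TN p) (Jstar \<alpha>)"
    unfolding linear_on_subspace_def
  proof (intro ballI allI)
    fix u v a b assume u: "u \<in> TN p" and v: "v \<in> TN p"
    have cl: "x \<in> TN p \<Longrightarrow> y \<in> TN p \<Longrightarrow> a *\<^sub>R x + b *\<^sub>R y \<in> TN p" for x y
      by (intro subspace_add subspace_scale subspace_V)
    show "Jstar \<alpha> (a *\<^sub>R u + b *\<^sub>R v) = a *\<^sub>R Jstar \<alpha> u + b *\<^sub>R Jstar \<alpha> v"
    proof (rule G_eqI')
      show "Jstar \<alpha> (a *\<^sub>R u + b *\<^sub>R v) \<in> TN p" by (rule Jstar_TN[OF cl[OF u v]])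
      show "a *\<^sub>R Jstar \<alpha> u + b *\<^sub>R Jstar \<alpha> v \<in> TN p" by (rule cl[OF Jstar_TN[OF u] Jstar_TN[OF v]])
      fix w assume w: "w \<in> TN p"
      show "g p w (Jstar \<alpha> (a *\<^sub>R u + b *\<^sub>R v)) = g p w (a *\<^sub>R Jstar \<alpha> u + b *\<^sub>R Jstar \<alpha> v)"
        unfolding linear_on_subspaceD(1)[OF linear_G[OF w] Jstar_TN[OF u] Jstar_TN[OF v]]
          Jstar_dual[OF cl[OF u v] w] Jstar_dual[OF u w] Jstar_dual[OF v w]
          linear_on_subspaceD(1)[OF linear_G[OF J_TN[OF w]] u v] by simp
    qed
  qed
  show "Jstar \<alpha> (Jstar \<alpha> v) = - v" if v: "v \<in> TN p"
    by (rule G_eqI'[OF Jstar_TN[OF Jstar_TN[OF v]] m[OF v]])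
      (simp add: Jstar_twice v J_square G_minus)
  show "Jstar \<alpha> (Jstar (\<alpha> + 1) v) = Jstar (\<alpha> + 2) v" if v: "v \<in> TN p"
    by (rule G_eqI'[OF Jstar_TN[OF Jstar_TN[OF v]] Jstar_TN[OF v]])
      (simp add: Jstar_twice v J_mult' G_minus Jstar_dual J_TN)
  show "Jstar (\<alpha> + 1) (Jstar \<alpha> v) = - Jstar (\<alpha> + 2) v" if v: "v \<in> TN p"
    by (rule G_eqI'[OF Jstar_TN[OF Jstar_TN[OF v]] m[OF Jstar_TN[OF v]]])
      (simp add: Jstar_twice v J_mult G_minus Jstar_dual J_TN Jstar_TN)
qed

text \<open>Every summand with \<open>K\<close> has a coefficient that pairs a tangent vector with
  the image of a tangent vector, so total reality leaves only (c/4) x. A general \<open>K\<close> is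
  used because the formula is needed for the structures and for their duals.\<close>

lemma curvature_form_real:
  fixes K :: "3 \<Rightarrow> 'a tvec \<Rightarrow> 'a tvec"
  assumes K: "\<And>\<alpha> v. v \<in> TN p \<Longrightarrow> K \<alpha> v \<in> TN p" "\<And>\<alpha> x y. x \<in> T p \<Longrightarrow> y \<in> T p \<Longrightarrow> g p (K \<alpha> x) y = 0"
    and x: "x \<in> T p" and y: "y \<in> T p" and xy: "g p x x = 1" "g p y y = 1" "g p x y = 0"
  shows "g p (quaternionic_curvature_form g p c K x y y) x = c / 4"
proof -
  note N = tangent_TN[OF x] tangent_TN[OF y]
  have K': "g p u (K \<alpha> v) = 0" if "u \<in> T p" "v \<in> T p" for u v \<alpha>
    using K(2)[OF that(2,1)] sym[OF tangent_TN[OF that(1)] K(1)[OF tangent_TN[OF that(2)]]] by simp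
  have "quaternionic_curvature_form g p c K x y y = (c / 4) *\<^sub>R x"
    unfolding quaternionic_curvature_form_def
    using K(2)[OF x y] K'[OF x y] K'[OF y x] K'[OF y y] xy sum.neutral
    by simp
  then show ?thesis using G_scale(2)[OF N(1) N(1)] xy by simp
qed

lemma ambient_curvature:
  assumes x: "x \<in> T p" and y: "y \<in> T p" and xy: "g p x x = 1" "g p y y = 1" "g p x y = 0"
  shows "g p (curvature N (mtop N) D p x y y) x = c / 4"
    and "g p (curvature N (mtop N) Ds p x y y) x = c / 4"
proof -
  note N = tangent_TN[OF x] tangent_TN[OF y]
  have 1: "curvature N (mtop N) D p x y y = quaternionic_curvature_form g p c (\<lambda>\<alpha>. J \<alpha> p) x y y"
    and 2: "curvature N (mtop N) Ds p x y y = quaternionic_curvature_form g p c Jstar x y y"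
    using curv lb pU N unfolding has_quaternionic_curvature_def Jstar_def[abs_def] by blast+
  show "g p (curvature N (mtop N) D p x y y) x = c / 4"
    unfolding 1 by (rule curvature_form_real[OF J_TN J_real[OF pU p] x y xy])
  show "g p (curvature N (mtop N) Ds p x y y) x = c / 4"
    unfolding 2 by (rule curvature_form_real[OF Jstar_TN Jstar_real x y xy])
qed

text \<open>Differentiate \<open>g (J Y) Z = 0\<close> along \<open>S\<close>; the connection forms contribute only normal terms.\<close>

lemma sff_duality:
  assumes x: "x \<in> T p" and y: "y \<in> T p" and z: "z \<in> T p"
  shows "g p (sff p x y) (Jstar \<alpha> z) = g p (J \<alpha> p y) (swap.sff p x z)"
proof -
  note pN = topspace_ambient[OF p]
  define X where "X = local_ext N (mtop N) p x"
  have X: "vfield_at N (mtop N) p X" "X p = x"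
    unfolding X_def using amb.local_ext[OF pN tangent_TN[OF x]] by auto
  note Y = local_ext[OF p y] and Z = local_ext[OF p z]
  note Y' = ambient_ext[OF Y(1)] and Z' = ambient_ext[OF Z(1)]
  define Yh where "Yh = ambient_ext N S p (local_ext N S p y)"
  define Zh where "Zh = ambient_ext N S p (local_ext N S p z)"
  note Y' = Y'[folded Yh_def] and Z' = Z'[folded Zh_def]
  have v: "Yh p = y" "Zh p = z"
    using eventually_nhdsin_self[OF Y'(2) p] eventually_nhdsin_self[OF Z'(2) p] Y(2) Z(2) by auto
  let ?JY = "\<lambda>q. J \<alpha> q (Yh q)"
  have JY: "vfield_at N (mtop N) p ?JY" by (rule J_vfield[OF Y'(1)])
  have "openin (mtop N) U" using lb by (simp add: local_basis_def)
  then have evU: "eventually (\<lambda>q. q \<in> U) (nhdsin S p)"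
    by (intro nhdsin_ambient) (use pU in \<open>auto simp: eventually_nhdsin\<close>)
  have ev0: "eventually (\<lambda>q. g q (?JY q) (Zh q) = 0) (nhdsin S p)"
    using evU Y'(2) Z'(2) vfield_at_nbhd[OF Y(1)] vfield_at_nbhd[OF Z(1)] eventually_nhdsin_topspace
  proof eventually_elim
    case (elim q)
    show ?case
      using J_real[OF elim(1,6) vfield_at_tangent[OF elim(4)] vfield_at_tangent[OF elim(5)]] elim(2,3)
      by simp
  qed
  have sm: "smooth_fun_at N (mtop N) p (\<lambda>q. g q (?JY q) (Zh q))"
    by (rule amb.metric_smooth[OF metric JY Z'(1)])
  have "dir_deriv N (mtop N) p x (\<lambda>q. g q (?JY q) (Zh q)) = 0"
    unfolding dir_deriv_ambient[OF p x sm]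
    using dir_deriv_cong[OF x smooth_fun_at_of_ambient[OF p sm] ev0] dir_deriv_const[OF x p] by simp
  then have 0: "g p (D p x ?JY) z + g p (J \<alpha> p y) (Ds p x Zh) = 0"
    using amb.dual_conn[OF dual tangent_TN[OF x] JY Z'(1)] v by simp
  note N = tangent_TN[OF x] tangent_TN[OF y] tangent_TN[OF z]
  have DY: "D p x Yh \<in> TN p" by (rule D_ambient[OF x Y'(1)])
  have DZ: "Ds p x Zh \<in> TN p" by (rule swap.D_ambient[OF x Z'(1)])
  obtain \<omega> :: "3 \<Rightarrow> 'a \<Rightarrow> 'a tvec \<Rightarrow> real" where
    \<omega>: "\<forall>p\<in>U. \<forall>X Y \<alpha>. vfield_at N (mtop N) p X \<longrightarrow> vfield_at N (mtop N) p Y \<longrightarrow>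
             covd D X (\<lambda>q. J \<alpha> q (Y q)) p - J \<alpha> p (covd D X Y p)
               = \<omega> (\<alpha> + 2) p (X p) *\<^sub>R J (\<alpha> + 1) p (Y p) - \<omega> (\<alpha> + 1) p (X p) *\<^sub>R J (\<alpha> + 2) p (Y p)"
    using kaehler[unfolded quaternionic_kaehler_like_def, THEN conjunct2, THEN conjunct2,
        THEN spec, THEN spec, THEN mp, OF lb]
    by (elim exE conjE) (rule that)
  obtain a b where "D p x ?JY - J \<alpha> p (D p x Yh) = a *\<^sub>R J (\<alpha> + 1) p y - b *\<^sub>R J (\<alpha> + 2) p y"
    using \<omega>[THEN bspec, OF pU, THEN spec, THEN spec, THEN spec, THEN mp, OF X(1), THEN mp, OF Y'(1), of \<alpha>] X(2) v(1)
    unfolding covd_def by metis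
  then have "D p x ?JY = J \<alpha> p (D p x Yh) + (a *\<^sub>R J (\<alpha> + 1) p y - b *\<^sub>R J (\<alpha> + 2) p y)"
    by (simp only: diff_eq_eq add.commute)
  then have 1: "g p (D p x ?JY) z = g p (J \<alpha> p (D p x Yh)) z"
    using J_real[OF pU p y z] N DY
    by (simp add: G_add G_diff G_scale J_TN subspace_diff[OF subspace_V] subspace_scale[OF subspace_V])
  have tY: "tanp p (D p x Yh) \<in> T p" and tZ: "tanp p (Ds p x Zh) \<in> T p"
    by (rule tanp(1)[OF p DY], rule tanp(1)[OF p DZ])
  have s: "sff p x y = D p x Yh - tanp p (D p x Yh)" using sff_eq(1)[OF x Y(1) Y'] Y(2) by simp
  have s': "swap.sff p x z = Ds p x Zh - tanp p (Ds p x Zh)" using swap.sff_eq(1)[OF x Z(1) Z'] Z(2) by simp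
  \<comment> \<open>The image under \<open>J\<close> of the tangential part is normal, so the
    derivative of Y may be replaced by its normal part.\<close>
  have 2: "g p (J \<alpha> p (sff p x y)) z = g p (J \<alpha> p (D p x Yh)) z"
    unfolding s linear_on_subspaceD(3)[OF J_linear DY tangent_TN[OF tY]]
      G_diff(2)[OF J_TN[OF DY] J_TN[OF tangent_TN[OF tY]] N(3)]
    using J_real[OF pU p tY z] by simp
  have 3: "g p (J \<alpha> p y) (swap.sff p x z) = g p (J \<alpha> p y) (Ds p x Zh)"
    unfolding s' G_diff(1)[OF J_TN[OF N(2)] DZ tangent_TN[OF tZ]]
    using J_real[OF pU p y tZ] by simp
  \<comment> \<open>Two minus signs cancel: one from the product rule for a zero function, one from
    the definition of the dual structure.\<close>
  show ?thesis
    using 0 1 2 3 Jstar_dual[OF N(3) sff_normal(1)[OF p x y]] by simp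
qed

text \<open>The duality identity is read in both directions. With equal first two arguments it makes
  \<open>t\<close> orthogonal to the dual images of the basis; with equal first and third arguments
  it makes \<open>t'\<close> orthogonal to the images under \<open>J\<close>. Being normal, both are
  then orthogonal to a spanning family.\<close>

lemma diagonal_zero:
  assumes f: "orthonormal {1..n} f" "span (f ` {1..n}) = T p" and n: "n \<ge> 6"
    and t: "sff p (f 5) (f 5) = t" "sff p (f 6) (f 6) = t" "\<And>k. k \<in> {1..n} \<Longrightarrow> k \<noteq> 5 \<Longrightarrow> sff p (f 5) (f k) = 0"
    and t': "swap.sff p (f 5) (f 5) = t'" "swap.sff p (f 6) (f 6) = t'"
      "\<And>k. k \<in> {1..n} \<Longrightarrow> k \<noteq> 5 \<Longrightarrow> swap.sff p (f 5) (f k) = 0"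
  shows "t = 0" "t' = 0"
proof -
  obtain B where B: "finite B" "card B = 4 * n" "TN p = span B"
    using amb.tangent_space_basis[OF topspace_ambient[OF p]] dim by metis
  have fT: "f i \<in> T p" if "i \<in> {1..n}" for i unfolding f(2)[symmetric] using that by (simp add: span_base)
  have f56: "f 5 \<in> T p" "f 6 \<in> T p" using fT n by auto
  have N: "t \<in> TN p" "t' \<in> TN p"
    unfolding t(1)[symmetric] t'(1)[symmetric]
    by (rule sff_normal(1)[OF p f56(1) f56(1)], rule swap.sff_normal(1)[OF p f56(1) f56(1)])
  have T0: "g p t (f i) = 0" "g p t' (f i) = 0" if "i \<in> {1..n}" for i
    unfolding t(1)[symmetric] t'(1)[symmetric]
    by (rule sff_normal(2)[OF p f56(1) f56(1) fT[OF that]], rule swap.sff_normal(2)[OF p f56(1) f56(1) fT[OF that]])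
  have s65: "sff p (f 6) (f 5) = 0" "swap.sff p (f 6) (f 5) = 0"
    using t(3)[of 6] t'(3)[of 6] n sff_sym[OF p f56] swap.sff_sym[OF p f56] by auto
  have A: "g p t (Jstar \<alpha> (f i)) = 0" "g p t' (J \<alpha> p (f i)) = 0" if i: "i \<in> {1..n}" for i \<alpha>
  proof -
    \<comment> \<open>\<open>f 5\<close> serves every index except 5, where \<open>f 6\<close> takes
      over: a second direction with the same diagonal values and vanishing mixed values with
      \<open>f 5\<close>.\<close>
    obtain x where x: "x \<in> T p" "sff p x x = t" "swap.sff p x x = t'" "sff p x (f i) = 0" "swap.sff p x (f i) = 0"
      using t t' i s65 f56 by (cases "i = 5") auto
    note xN = tangent_TN[OF x(1)]
    show "g p t (Jstar \<alpha> (f i)) = 0"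
      using sff_duality[OF x(1) x(1) fT[OF i], of \<alpha>] x G_zero(1)[OF J_TN[OF xN]] by simp
    show "g p t' (J \<alpha> p (f i)) = 0"
      using sff_duality[OF x(1) fT[OF i] x(1), of \<alpha>] x G_zero(2)[OF Jstar_TN[OF xN]]
        sym[OF N(2) J_TN[OF tangent_TN[OF fT[OF i]]]] by simp
  qed
  show "t = 0"
  proof (rule quaternionic_normal_zero[where J = Jstar])
    show "orthonormal {1..n} f" "span (f ` {1..n}) = T p" by (fact f)+
    show "TN p = span B" "finite B" "card B = 4 * n" by (fact B)+
    show "t \<in> TN p" by (fact N)
  qed (fact Jstar_props Jstar_TN Jstar_real T0 A)+
  show "t' = 0"
  proof (rule quaternionic_normal_zero[where J = "\<lambda>\<alpha>. J \<alpha> p"])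
    show "orthonormal {1..n} f" "span (f ` {1..n}) = T p" by (fact f)+
    show "TN p = span B" "finite B" "card B = 4 * n" by (fact B)+
    show "t' \<in> TN p" by (fact N)
    show "g p (J \<alpha> p x) y = 0" if "x \<in> T p" "y \<in> T p" for \<alpha> x y by (rule J_real[OF pU p that])
  qed (fact J_linear J_TN J_square J_mult J_mult' T0 A)+
qed

end

end

section \<open>From the Chen equality to minimality at a point\<close>

context lagrangian
begin

context
  fixes p :: 'a and U :: "'a set" and J :: "3 \<Rightarrow> 'a \<Rightarrow> 'a tvec \<Rightarrow> 'a tvec"
  assumes p: "p \<in> topspace S" and pU: "p \<in> U" and lb: "local_basis N Q U J"
begin

interpretation inner_space "TN p" "g p" by (rule inner_ambient[OF p])

lemma some_onb:
  assumes B: "finite B" "independent B" "W = span B" "card B = k" and W: "W \<subseteq> TN p"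
  shows "orthonormal {1..k} (some_onb g p W k)" "span (some_onb g p W k ` {1..k}) = W"
proof -
  have "orthonormal {1..0::nat} (\<lambda>_. 0)" by (simp add: orthonormal_def)
  from orthonormal_extend_dim[OF this B(1,2,3) W] obtain f where
    f: "orthonormal {1..k} f" "span (f ` {1..k}) = W" using B(4) by auto
  then have "orthonormal_basis g p W k f"
    unfolding orthonormal_basis_def orthonormal_def by blast
  then have *: "orthonormal_basis g p W k (some_onb g p W k)"
    unfolding some_onb_def by (rule someI[of "orthonormal_basis g p W k"])
  then show sp: "span (some_onb g p W k ` {1..k}) = W" unfolding orthonormal_basis_def by blast
  have "some_onb g p W k ` {1..k} \<subseteq> W" using sp span_superset by metis
  then show "orthonormal {1..k} (some_onb g p W k)"
    using * W unfolding orthonormal_basis_def orthonormal_def by blast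
qed

lemma sff_sym_form: "sym_form (T p) (sff p)" "sym_form (T p) (swap.sff p)"
  unfolding sym_form_def
  using sff_bilinear[OF p] swap.sff_bilinear[OF p] sff_sym[OF p] swap.sff_sym[OF p]
    sff_normal(1)[OF p] swap.sff_normal(1)[OF p] by blast+

definition dual_gauss_term :: "'a tvec \<Rightarrow> 'a tvec \<Rightarrow> real"
  where "dual_gauss_term x y = gauss_term (sff p) x y + gauss_term (swap.sff p) x y"

text \<open>The Chen equality only involves this combination, which makes the Levi-Civita curvatures cancel.\<close>

definition reduced_curvature :: "'a tvec set \<Rightarrow> real"
  where "reduced_curvature \<pi> = sectional_K_curvature N S g ind swap.ind p \<pi>
    - sectional_curvature N S g p \<pi> + 2 * sectional_curvature N (mtop N) g p \<pi>"

text \<open>All three sectional curvatures use the same chosen basis of the plane, so their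
  combination is evaluated there by the Gauss equations. Invariance of the Gauss terms then passes
  to the given basis \<open>e\<close>.\<close>

lemma reduced_curvature:
  assumes e: "orthonormal {1..2::nat} e" "span (e ` {1..2}) = \<pi>" and \<pi>: "\<pi> \<subseteq> T p"
  shows "reduced_curvature \<pi> = c / 4 - dual_gauss_term (e 1) (e 2) / 2"
proof -
  have \<pi>N: "\<pi> \<subseteq> TN p" using \<pi> tangent_subset by blast
  note oi = orthonormal_independent[OF e(1) finite_atLeastAtMost]
  define f where "f = some_onb g p \<pi> 2"
  have card: "card (e ` {1..2}) = 2" using card_image[OF oi(1)] by simp
  have f: "orthonormal {1..2} f" "span (f ` {1..2}) = \<pi>"
    unfolding f_def
    by (rule some_onb[OF finite_imageI[OF finite_atLeastAtMost] oi(2) e(2)[symmetric] card \<pi>N])+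
  have f12: "f 1 \<in> T p" "f 2 \<in> T p"
    using f(2) \<pi> span_base[of "f 1" "f ` {1..2}"] span_base[of "f 2" "f ` {1..2}"] by auto
  have fo: "g p (f 1) (f 1) = 1" "g p (f 2) (f 2) = 1" "g p (f 1) (f 2) = 0"
    using orthonormalD(2)[OF f(1)] by auto
  have "reduced_curvature \<pi> = (c / 4 + c / 4) / 2 - dual_gauss_term (f 1) (f 2) / 2"
    using curvature_combination[OF p f12]
    unfolding reduced_curvature_def sectional_K_curvature_def sectional_curvature_def Let_def f_def[symmetric]
      ambient_curvature[OF p pU lb f12 fo] dual_gauss_term_def gauss_term_def by simp
  also have "dual_gauss_term (f 1) (f 2) = dual_gauss_term (e 1) (e 2)"
    unfolding dual_gauss_term_def
    using gauss_term_plane[OF f(1) e(1) _ _ sff_sym_form(1)] gauss_term_plane[OF f(1) e(1) _ _ sff_sym_form(2)]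
      e(2) f(2) \<pi> by simp
  finally show ?thesis by simp
qed

text \<open>Written in \<open>reduced_curvature\<close>, the Chen equality becomes a statement about
  the second fundamental forms alone: all terms with c cancel, and the equality case of the
  algebraic inequality remains.\<close>

lemma chen_minimal:
  assumes n: "n \<ge> 6" and \<pi>1: "two_plane N S p \<pi>\<^sub>1" and \<pi>2: "two_plane N S p \<pi>\<^sub>2"
    and orth: "orthogonal_planes g p \<pi>\<^sub>1 \<pi>\<^sub>2"
    and chen: "chen_delta22_equality N g D Ds S n c p \<pi>\<^sub>1 \<pi>\<^sub>2"
  shows "mean_curvature N S g n D p = 0" "mean_curvature N S g n Ds p = 0"
proof -
  define e where "e = some_onb g p (T p) n"
  obtain B where B: "finite B" "card B = n" "independent B" "span B = T p"
    using tangent_space_basis[OF p] by metis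
  have e: "orthonormal {1..n} e" "span (e ` {1..n}) = T p"
    unfolding e_def using some_onb[OF B(1,3) B(4)[symmetric] B(2) tangent_subset] by auto
  have eT: "e i \<in> T p" if "i \<in> {1..n}" for i unfolding e(2)[symmetric] using that by (simp add: span_base)
  have plane: "\<exists>B. finite B \<and> independent B \<and> \<pi> = span B \<and> card B = 2 \<and> \<pi> \<subseteq> T p"
    if \<pi>: "two_plane N S p \<pi>" for \<pi>
  proof -
    obtain B where B: "B \<subseteq> \<pi>" "independent B" "\<pi> \<subseteq> span B" "card B = dim \<pi>"
      using basis_exists[of \<pi>] by metis
    have s: "subspace \<pi>" "dim \<pi> = 2" "\<pi> \<subseteq> T p" using \<pi> by (auto simp: two_plane_def)
    have "span B = \<pi>" using B(1,3) s(1) by (meson span_minimal subset_antisym)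
    moreover have "finite B" using B(4) s(2) card.infinite by fastforce
    ultimately show ?thesis using B s by metis
  qed
  have onb: "orthonormal {1..2} (some_onb g p \<pi> 2)" "span (some_onb g p \<pi> 2 ` {1..2}) = \<pi>" "\<pi> \<subseteq> T p"
    if \<pi>: "two_plane N S p \<pi>" for \<pi>
  proof -
    obtain B where B: "finite B" "independent B" "\<pi> = span B" "card B = 2" "\<pi> \<subseteq> T p"
      using plane[OF \<pi>] by blast
    have N: "\<pi> \<subseteq> TN p" using B(5) tangent_subset by blast
    show "orthonormal {1..2} (some_onb g p \<pi> 2)" "span (some_onb g p \<pi> 2 ` {1..2}) = \<pi>" "\<pi> \<subseteq> T p"
      using some_onb[OF B(1-4) N] B(5) by auto
  qed
  define a where "a = some_onb g p \<pi>\<^sub>1 2"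
  define b where "b = some_onb g p \<pi>\<^sub>2 2"
  note a = onb[OF \<pi>1, folded a_def] and b = onb[OF \<pi>2, folded b_def]
  have aU: "a ` {1..2} \<subseteq> T p" "b ` {1..2} \<subseteq> T p"
    using a(2,3) b(2,3) span_superset by (metis order_trans)+
  have ab: "g p (a i) (b j) = 0" if "i \<in> {1..2}" "j \<in> {1..2}" for i j
  proof -
    have "a i \<in> \<pi>\<^sub>1" "b j \<in> \<pi>\<^sub>2"
      unfolding a(2)[symmetric] b(2)[symmetric] using that by (simp_all add: span_base)
    then show ?thesis using orth unfolding orthogonal_planes_def by blast
  qed
  define h where "h = (\<lambda>\<sigma>::'a tvec \<Rightarrow> 'a tvec \<Rightarrow> 'a tvec. \<Sum>i=1..n. \<sigma> (e i) (e i))"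
  have hN: "h (sff p) \<in> TN p" "h (swap.sff p) \<in> TN p"
    unfolding h_def by (intro subspace_sum subspace_V sff_normal(1)[OF p] swap.sff_normal(1)[OF p] eT; assumption)+
  have H: "mean_curvature N S g n D p = (1 / real n) *\<^sub>R h (sff p)"
    "mean_curvature N S g n Ds p = (1 / real n) *\<^sub>R h (swap.sff p)"
    unfolding mean_curvature_def Let_def e_def[symmetric] h_def by simp_all
  let ?q = dual_gauss_term
  have Eij: "reduced_curvature (span {e i, e j}) = c / 4 - ?q (e i) (e j) / 2"
    if ij: "i \<in> {1..n}" "j \<in> {i+1..n}" for i j
  proof -
    let ?x = "\<lambda>k::nat. if k = 1 then e i else e j"
    have two: "{1..2::nat} = {1, 2}" by auto
    have i: "i \<in> {1..n}" "j \<in> {1..n}" "i \<noteq> j" using ij by auto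
    have im: "?x ` {1..2} = {e i, e j}" unfolding two by auto
    have o: "orthonormal {1..2} ?x"
      using orthonormalD[OF e(1)] i unfolding orthonormal_def two by auto
    have "span {e i, e j} \<subseteq> T p"
      by (rule span_minimal) (use eT i subspace_tangent[OF p] in auto)
    from reduced_curvature[OF o _ this] show ?thesis unfolding im by simp
  qed
  have cnt: "(\<Sum>i=1..n. \<Sum>j=i+1..n. c / 4) = (real n * real n - real n) / 2 * (c / 4)"
    using sum_pairs[of n "\<lambda>_ _. c / 4"] by (simp add: field_simps)
  have "scalar_sum N S g n (sectional_K_curvature N S g ind swap.ind) p - scalar_sum N S g n (sectional_curvature N S g) p
      + 2 * scalar_sum N S g n (sectional_curvature N (mtop N) g) p
      = (\<Sum>i=1..n. \<Sum>j=i+1..n. reduced_curvature (span {e i, e j}))"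
    unfolding scalar_sum_def Let_def e_def[symmetric] reduced_curvature_def
    by (simp only: sum.distrib sum_subtractf sum_distrib_left)
  also have "\<dots> = (\<Sum>i=1..n. \<Sum>j=i+1..n. c / 4 - ?q (e i) (e j) / 2)"
    by (intro sum.cong refl Eij)
  also have "\<dots> = (real n * real n - real n) / 2 * (c / 4) - (\<Sum>i=1..n. \<Sum>j=i+1..n. ?q (e i) (e j)) / 2"
    by (simp only: sum_subtractf cnt sum_divide_distrib)
  finally have tot: "scalar_sum N S g n (sectional_K_curvature N S g ind swap.ind) p
      - scalar_sum N S g n (sectional_curvature N S g) p
      + 2 * scalar_sum N S g n (sectional_curvature N (mtop N) g) p
      = (real n * real n - real n) / 2 * (c / 4) - (\<Sum>i=1..n. \<Sum>j=i+1..n. ?q (e i) (e j)) / 2" .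
  have E1: "reduced_curvature \<pi>\<^sub>1 = c / 4 - ?q (a 1) (a 2) / 2" by (rule reduced_curvature[OF a])
  have E2: "reduced_curvature \<pi>\<^sub>2 = c / 4 - ?q (b 1) (b 2) / 2" by (rule reduced_curvature[OF b])
  define X where "X = (\<Sum>i=1..n. \<Sum>j=i+1..n. ?q (e i) (e j))"
  define Y where "Y = g p (h (sff p)) (h (sff p)) + g p (h (swap.sff p)) (h (swap.sff p))"
  have gH: "g p ((1 / real n) *\<^sub>R u) ((1 / real n) *\<^sub>R u) = g p u u / (real n)\<^sup>2" if "u \<in> TN p" for u
    using that by (simp add: G_scale subspace_scale[OF subspace_V] power2_eq_square)
  have HH: "g p (mean_curvature N S g n D p) (mean_curvature N S g n D p)
      + g p (mean_curvature N S g n Ds p) (mean_curvature N S g n Ds p) = Y / (real n)\<^sup>2"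
    unfolding H gH[OF hN(1)] gH[OF hN(2)] Y_def by (simp add: add_divide_distrib)
  \<comment> \<open>The mean curvature is the trace divided by n, so the factor n^2 of the Chen
    bound disappears when the trace is used instead.\<close>
  have k: "(real n)\<^sup>2 * (real n - 3) / (4 * (real n - 2)) * (Y / (real n)\<^sup>2)
      = (real n - 3) / (real n - 2) * Y / 4"
    using n by (simp add: field_simps)
  \<comment> \<open>Pure bookkeeping with abstract reals: the c-terms match because (n^2 - n)/2 - 2
    planes contribute c/4 each.\<close>
  have arith: "2 * (x - y - z) = w"
    if "(t1 - k1 - k2) - (t0 - l1 - l2) = c / 8 * ((real n)\<^sup>2 - real n - 4) - w / 4 - 2 * (th - m1 - m2)"
      "t1 - t0 + 2 * th = (real n * real n - real n) / 2 * (c / 4) - x / 2"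
      "k1 - l1 + 2 * m1 = c / 4 - y / 2" "k2 - l2 + 2 * m2 = c / 4 - z / 2"
    for x y z w t1 t0 th k1 k2 l1 l2 m1 m2 :: real
  proof -
    have "(t1 - t0 + 2 * th) - (k1 - l1 + 2 * m1) - (k2 - l2 + 2 * m2)
        = c / 8 * ((real n)\<^sup>2 - real n - 4) - w / 4"
      using that(1) by simp
    then show ?thesis unfolding that(2-4) by (simp add: power2_eq_square field_simps)
  qed
  have "2 * (X - ?q (a 1) (a 2) - ?q (b 1) (b 2)) = (real n - 3) / (real n - 2) * Y"
    by (rule arith[OF chen[unfolded chen_delta22_equality_def Let_def HH k] tot[folded X_def]
          E1[unfolded reduced_curvature_def] E2[unfolded reduced_curvature_def]])
  then have main: "2 * ((\<Sum>i=1..n. \<Sum>j=i+1..n. gauss_term (sff p) (e i) (e j) + gauss_term (swap.sff p) (e i) (e j))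
      - (gauss_term (sff p) (a 1) (a 2) + gauss_term (swap.sff p) (a 1) (a 2))
      - (gauss_term (sff p) (b 1) (b 2) + gauss_term (swap.sff p) (b 1) (b 2)))
    = (real n - 3) / (real n - 2) * (g p (\<Sum>i=1..n. sff p (e i) (e i)) (\<Sum>i=1..n. sff p (e i) (e i))
        + g p (\<Sum>i=1..n. swap.sff p (e i) (e i)) (\<Sum>i=1..n. swap.sff p (e i) (e i)))"
    unfolding X_def Y_def h_def dual_gauss_term_def .
  obtain f where f: "orthonormal {1..n} f" "span (f ` {1..n}) = T p"
    "\<And>\<tau>. \<tau> \<in> {sff p, swap.sff p} \<Longrightarrow>
      \<tau> (f 5) (f 5) = (1 / (real n - 2)) *\<^sub>R (\<Sum>i=1..n. \<tau> (e i) (e i)) \<and>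
      \<tau> (f 6) (f 6) = (1 / (real n - 2)) *\<^sub>R (\<Sum>i=1..n. \<tau> (e i) (e i)) \<and>
      (\<forall>k\<in>{1..n}. k \<noteq> 5 \<longrightarrow> \<tau> (f 5) (f k) = 0)"
    by (rule chen_equality[OF e n sff_sym_form a(1) aU(1) b(1) aU(2) _ main], erule (1) ab, rule that)
  have f1: "sff p (f 5) (f 5) = (1 / (real n - 2)) *\<^sub>R h (sff p)" "sff p (f 6) (f 6) = (1 / (real n - 2)) *\<^sub>R h (sff p)"
    "\<And>k. k \<in> {1..n} \<Longrightarrow> k \<noteq> 5 \<Longrightarrow> sff p (f 5) (f k) = 0"
    using f(3)[of "sff p"] unfolding h_def by auto
  have f2: "swap.sff p (f 5) (f 5) = (1 / (real n - 2)) *\<^sub>R h (swap.sff p)" "swap.sff p (f 6) (f 6) = (1 / (real n - 2)) *\<^sub>R h (swap.sff p)"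
    "\<And>k. k \<in> {1..n} \<Longrightarrow> k \<noteq> 5 \<Longrightarrow> swap.sff p (f 5) (f k) = 0"
    using f(3)[of "swap.sff p"] unfolding h_def by auto
  \<comment> \<open>The common diagonal value is the trace divided by n - 2, so its vanishing gives
    that of the trace.\<close>
  have "h (sff p) = 0" "h (swap.sff p) = 0"
    using diagonal_zero[OF p pU lb f(1,2) n f1 f2] n by simp_all
  then show "mean_curvature N S g n D p = 0" "mean_curvature N S g n Ds p = 0"
    unfolding H by simp_all
qed

end

end

theorem theorem4p3:
  fixes N :: "('a, 'e::euclidean_space) smooth_mfd"
    and g :: "'a tmetric" and D Ds :: "'a connection"
    and Q :: "'a \<Rightarrow> ('a tvec \<Rightarrow> 'a tvec) set"
    and M :: "'a topology" and m n :: nat and c :: real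
  assumes "smooth_manifold N" and "DIM('e) = 4 * m"
    and "quaternionic_kaehler_like N g D Ds Q"
    and "has_quaternionic_curvature N g D Ds Q c"
    and "lagrangian_submanifold N g Q m M n"
    and "n \<ge> 6"
    and "\<forall>p \<in> topspace M. \<exists>\<pi>\<^sub>1 \<pi>\<^sub>2.
           two_plane N M p \<pi>\<^sub>1 \<and> two_plane N M p \<pi>\<^sub>2 \<and> orthogonal_planes g p \<pi>\<^sub>1 \<pi>\<^sub>2 \<and>
           chen_delta22_equality N g D Ds M n c p \<pi>\<^sub>1 \<pi>\<^sub>2"
  shows "\<forall>p \<in> topspace M. mean_curvature N M g n D p = 0 \<and> mean_curvature N M g n Ds p = 0"
proof
  fix p assume p: "p \<in> topspace M"
  have lag: "immersed_submanifold N M n" "totally_real N g Q M" "n = m"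
    using assms(5) unfolding lagrangian_submanifold_def by blast+
  have st: "statistical_structure N (mtop N) g D Ds" and aq: "almost_quaternionic N Q"
    using assms(3) by (simp_all add: quaternionic_kaehler_like_def)
  \<comment> \<open>The Lagrangian condition n = m turns the ambient dimension 4m into 4n, as the
    spanning argument requires.\<close>
  interpret lagrangian N M n g D Ds Q c
    by unfold_locales (use assms lag st in \<open>simp_all add: statistical_structure_def\<close>)
  obtain U J where UJ: "p \<in> U" "local_basis N Q U J"
    using aq topspace_ambient[OF p] unfolding almost_quaternionic_def by metis
  obtain \<pi>\<^sub>1 \<pi>\<^sub>2 where \<pi>: "two_plane N M p \<pi>\<^sub>1" "two_plane N M p \<pi>\<^sub>2" "orthogonal_planes g p \<pi>\<^sub>1 \<pi>\<^sub>2"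
    "chen_delta22_equality N g D Ds M n c p \<pi>\<^sub>1 \<pi>\<^sub>2"
    using assms(7) p by metis
  show "mean_curvature N M g n D p = 0 \<and> mean_curvature N M g n Ds p = 0"
    using chen_minimal[OF p UJ assms(6) \<pi>] by blast
qed

end
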